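(* Let $n\ge2$, $p\in[2,\infty)$ and let $\omega$ be a majorant. Suppose that $\lambda_1$ and $\lambda_2$ are nonnegative continuous functions on $[0,1)$ and that, for every $r\in[0,1)$, $$\int_0^r\frac{\rho^{n-1}g_n(\rho,r)\lambda_2(\rho)}{(1-\rho^2)^n}\,d\rho<\frac1{np},\qquad\text{where } g_n(\rho,r)=\frac1n\int_\rho^r\frac{(1-s^2)^{n-2}}{s^{n-1}}\,ds.$$ Let $C>0$. Then there is a positive constant $C'$, depending only on $C$, with the following property. If $f\in\mathbf{H}_{\lambda_1,\lambda_2}(\mathbb{B}^n)$ satisfies $$M_p(r,\nabla f)\le C\,\omega\left(\frac1{1-r}\right)\quad\text{for all } r\in[0,1),$$ then for all $r\in[0,1)$, $$M_p(r,f)\le\frac1{\sqrt{C(r)}}\left[|f(0)|^2+\frac{2^{n-2}p\,C'\omega(1)}{n-1}\int_0^r\bigl(p-1+\lambda_1(\rho)\bigr)\,\omega\left(\frac1{1-\rho}\right)d\rho\right]^{\frac12},$$ where $$C(r)=1-np\int_0^r\frac{\rho^{n-1}g_n(\rho,r)\lambda_2(\rho)}{(1-\rho^2)^n}\,d\rho.$$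
   Context: $\mathbb{B}^n$ and $\mathbb{S}^{n-1}$ are the open unit ball and unit sphere of $\mathbb{R}^n$; $\sigma$ is the normalized surface measure on $\mathbb{S}^{n-1}$. A majorant is a continuous increasing function $\omega:[0,\infty)\to[0,\infty)$ with $\omega(0)=0$ such that $\omega(t)/t$ is non-increasing for $t>0$. For $f$ on $\mathbb{B}^n$ with values in some $\mathbb{R}^\nu$ and measurable, $M_p(r,f)=\left(\int_{\mathbb{S}^{n-1}}|f(r\zeta)|^p\,d\sigma(\zeta)\right)^{1/p}$. The Möbius invariant (hyperbolic) Laplacian is $$\Delta_hf(x)=(1-|x|^2)\left[(1-|x|^2)\Delta f(x)+2(n-2)\langle\nabla f(x),x\rangle\right],$$ with $\Delta$ the Euclidean Laplacian, and $|\nabla^hf(x)|^2=(1-|x|^2)^2|\nabla f(x)|^2$. $\mathbf{H}_{\lambda_1,\lambda_2}(\mathbb{B}^n)$ is the class of all $f\in C^2(\mathbb{B}^n)$, $f:\mathbb{B}^n\to\mathbb{R}$, satisfying $$0\le f(x)\Delta_hf(x)\le\lambda_1(|x|)|\nabla^hf(x)|^2+\lambda_2(|x|)|f(x)|^2,\quad x\in\mathbb{B}^n.$$ *)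

theory Defs
  imports "HOL-Analysis.Analysis"
begin

text \<open>The constant in the theorem must not depend on the dimension, so the dimension is a
  natural number quantified inside the formula. The space \<open>\<real>\<^sup>n\<close> is therefore the carrier of the
  product measure space below, i.e. the functions \<open>{..<n} \<rightarrow>\<^sub>E UNIV\<close>. On this
  carrier the library's (product) topology of \<open>nat \<Rightarrow> real\<close> is the Euclidean topology.\<close>

abbreviation lborel_n :: "nat \<Rightarrow> (nat \<Rightarrow> real) measure" where
  "lborel_n n \<equiv> PiM {..<n} (\<lambda>_. lborel)"

abbreviation Rn :: "nat \<Rightarrow> (nat \<Rightarrow> real) set" where
  "Rn n \<equiv> {..<n} \<rightarrow>\<^sub>E UNIV"

definition origin :: "nat \<Rightarrow> nat \<Rightarrow> real" where
  "origin n = (\<lambda>i\<in>{..<n}. 0)"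

definition scale :: "nat \<Rightarrow> real \<Rightarrow> (nat \<Rightarrow> real) \<Rightarrow> nat \<Rightarrow> real" where
  "scale n c x = (\<lambda>i\<in>{..<n}. c * x i)"

definition inner_n :: "nat \<Rightarrow> (nat \<Rightarrow> real) \<Rightarrow> (nat \<Rightarrow> real) \<Rightarrow> real" where
  "inner_n n x y = (\<Sum>i<n. x i * y i)"

definition norm_n :: "nat \<Rightarrow> (nat \<Rightarrow> real) \<Rightarrow> real" where
  "norm_n n x = L2_set x {..<n}"

definition unit_ball :: "nat \<Rightarrow> (nat \<Rightarrow> real) set" where
  "unit_ball n = {x \<in> Rn n. norm_n n x < 1}"

definition unit_sphere :: "nat \<Rightarrow> (nat \<Rightarrow> real) set" where
  "unit_sphere n = {x \<in> Rn n. norm_n n x = 1}"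

text \<open>Normalized surface measure as the cone measure: \<open>\<sigma>(A)\<close> is the proportion of the
  volume of the unit ball occupied by the points whose radial projection lies in \<open>A\<close>.
  The underlying space is all of \<open>\<real>\<^sup>n\<close>, but the measure is concentrated on the unit
  sphere (the origin, where the projection is degenerate, is a null set).\<close>

definition sphere_measure :: "nat \<Rightarrow> (nat \<Rightarrow> real) measure" where
  "sphere_measure n =
     distr (uniform_measure (lborel_n n) (unit_ball n)) (lborel_n n)
       (\<lambda>x. scale n (1 / norm_n n x) x)"

text \<open>For a vector-valued map \<open>F\<close>, the mean \<open>M\<^sub>p(r,F)\<close> is obtained by
  passing the real function \<open>\<lambda>x. |F x|\<close> as the last argument.\<close>

definition Mp :: "nat \<Rightarrow> real \<Rightarrow> real \<Rightarrow> ((nat \<Rightarrow> real) \<Rightarrow> real) \<Rightarrow> real" where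
  "Mp n p r f =
     (LINT \<zeta>:unit_sphere n|sphere_measure n. \<bar>f (scale n r \<zeta>)\<bar> powr p) powr (1 / p)"

definition majorant :: "(real \<Rightarrow> real) \<Rightarrow> bool" where
  "majorant \<omega> \<longleftrightarrow>
     continuous_on {0..} \<omega> \<and> mono_on {0..} \<omega> \<and> (\<forall>t\<ge>0. \<omega> t \<ge> 0) \<and> \<omega> 0 = 0 \<and>
     antimono_on {0<..} (\<lambda>t. \<omega> t / t)"

definition partial :: "nat \<Rightarrow> ((nat \<Rightarrow> real) \<Rightarrow> real) \<Rightarrow> (nat \<Rightarrow> real) \<Rightarrow> real" where
  "partial i f x = deriv (\<lambda>t. f (x(i := t))) (x i)"

definition has_partial :: "nat \<Rightarrow> ((nat \<Rightarrow> real) \<Rightarrow> real) \<Rightarrow> (nat \<Rightarrow> real) \<Rightarrow> bool" where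
  "has_partial i f x \<longleftrightarrow> (\<lambda>t. f (x(i := t))) differentiable (at (x i))"

definition C1_on :: "nat \<Rightarrow> (nat \<Rightarrow> real) set \<Rightarrow> ((nat \<Rightarrow> real) \<Rightarrow> real) \<Rightarrow> bool" where
  "C1_on n U f \<longleftrightarrow>
     continuous_on U f \<and>
     (\<forall>i<n. (\<forall>x\<in>U. has_partial i f x) \<and> continuous_on U (partial i f))"

definition C2_on :: "nat \<Rightarrow> (nat \<Rightarrow> real) set \<Rightarrow> ((nat \<Rightarrow> real) \<Rightarrow> real) \<Rightarrow> bool" where
  "C2_on n U f \<longleftrightarrow> C1_on n U f \<and> (\<forall>i<n. C1_on n U (partial i f))"

definition grad :: "nat \<Rightarrow> ((nat \<Rightarrow> real) \<Rightarrow> real) \<Rightarrow> (nat \<Rightarrow> real) \<Rightarrow> nat \<Rightarrow> real" where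
  "grad n f x = (\<lambda>i\<in>{..<n}. partial i f x)"

definition laplacian :: "nat \<Rightarrow> ((nat \<Rightarrow> real) \<Rightarrow> real) \<Rightarrow> (nat \<Rightarrow> real) \<Rightarrow> real" where
  "laplacian n f x = (\<Sum>i<n. partial i (partial i f) x)"

definition hyp_laplacian :: "nat \<Rightarrow> ((nat \<Rightarrow> real) \<Rightarrow> real) \<Rightarrow> (nat \<Rightarrow> real) \<Rightarrow> real" where
  "hyp_laplacian n f x =
     (1 - (norm_n n x)\<^sup>2) *
       ((1 - (norm_n n x)\<^sup>2) * laplacian n f x
        + 2 * (real n - 2) * inner_n n (grad n f x) x)"

text \<open>The squared length \<open>|\<nabla>\<^sup>h f(x)|\<^sup>2\<close> of the hyperbolic gradient.\<close>

definition hyp_grad_norm_sq :: "nat \<Rightarrow> ((nat \<Rightarrow> real) \<Rightarrow> real) \<Rightarrow> (nat \<Rightarrow> real) \<Rightarrow> real" where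
  "hyp_grad_norm_sq n f x = (1 - (norm_n n x)\<^sup>2)\<^sup>2 * (norm_n n (grad n f x))\<^sup>2"

text \<open>Membership only depends on the values of \<open>f\<close> on the unit ball.\<close>

definition H_class ::
    "nat \<Rightarrow> (real \<Rightarrow> real) \<Rightarrow> (real \<Rightarrow> real) \<Rightarrow> ((nat \<Rightarrow> real) \<Rightarrow> real) set" where
  "H_class n l1 l2 =
     {f. C2_on n (unit_ball n) f \<and>
         (\<forall>x\<in>unit_ball n.
            0 \<le> f x * hyp_laplacian n f x \<and>
            f x * hyp_laplacian n f x
              \<le> l1 (norm_n n x) * hyp_grad_norm_sq n f x + l2 (norm_n n x) * \<bar>f x\<bar>\<^sup>2)}"

definition green_g :: "nat \<Rightarrow> real \<Rightarrow> real \<Rightarrow> real" where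
  "green_g n \<rho> r = 1 / real n * integral {\<rho>..r} (\<lambda>s. (1 - s\<^sup>2) ^ (n - 2) / s ^ (n - 1))"

text \<open>At \<open>\<rho> = 0\<close> the integral defining \<open>green_g n 0 r\<close> diverges (for \<open>r > 0\<close>); the factor
  \<open>\<rho> ^ (n - 1)\<close> makes the integrand below vanish there, and away from this single point it
  is the mathematical one.\<close>

definition green_int :: "nat \<Rightarrow> (real \<Rightarrow> real) \<Rightarrow> real \<Rightarrow> real" where
  "green_int n l2 r =
     integral {0..r} (\<lambda>\<rho>. \<rho> ^ (n - 1) * green_g n \<rho> r * l2 \<rho> / (1 - \<rho>\<^sup>2) ^ n)"

definition C_fun :: "nat \<Rightarrow> real \<Rightarrow> (real \<Rightarrow> real) \<Rightarrow> real \<Rightarrow> real" where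
  "C_fun n p l2 r = 1 - real n * p * green_int n l2 r"

end

theory Submission
  imports Defs
begin

text \<open>Put \<open>u = |f|\<^sup>p\<close> and let \<open>U(r)\<close> be its mean over the sphere of radius \<open>r\<close>. Averaging \<open>\<Delta>\<^sub>h u\<close> over
  spheres turns the hyperbolic Laplacian into a radial second order operator, and integrating
  it twice gives \<open>U(r) = |f(0)|\<^sup>p + n \<integral>\<^sub>0\<^sup>r \<rho>\<^bsup>n-1\<^esup> (1-\<rho>\<^sup>2)\<^bsup>-n\<^esup> g\<^sub>n(\<rho>,r) A(\<rho>) d\<rho>\<close>, where \<open>A\<close> is the spherical
  mean of \<open>\<Delta>\<^sub>h u \<ge> 0\<close>; in particular \<open>U\<close> increases. The class inequality and Hoelder's inequality
  bound \<open>A(\<rho>)\<close> by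
  \<open>p(p-1+\<lambda>\<^sub>1)(1-\<rho>\<^sup>2)\<^sup>2 U(r)\<^bsup>1-2/p\<^esup> M\<^sub>p(\<rho>,\<nabla>f)\<^sup>2 + p \<lambda>\<^sub>2 U(r)\<close>. Dividing by \<open>U(r)\<^bsup>1-2/p\<^esup>\<close> and using
  \<open>\<omega>(t) \<le> t \<omega>(1)\<close> for \<open>t \<ge> 1\<close> gives the theorem with \<open>C' = C\<^sup>2\<close>.

  The formula for \<open>U\<close> needs neither the divergence theorem on spheres nor differentiation under
  the integral: coordinatewise integration by parts against radial test functions and
  polar coordinates give the radial differential equations weakly, and continuity of
  the spherical means upgrades them to classical ones.\<close>

section \<open>Euclidean space as a product\<close>

text \<open>The exponent \<open>1 - 2/p\<close> comes from Hoelder with exponents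
  \<open>p/(p-2)\<close> and \<open>p/2\<close> applied to \<open>|f|^(p-2) |grad f|^2\<close>.
  Because \<open>U\<close> increases, the factor it produces at radius \<rho> can be taken at the
  outer radius \<open>r\<close>. It then no longer depends on \<rho>, so it can be divided out, and
  what remains is a bound on the square of the mean. The \<open>l2\<close> contribution is
  proportional to \<open>U(r)\<close>; moved to the left it forms \<open>C(r)\<close>, which the
  integral hypothesis makes positive. Of the two factors \<open>\<omega> (1 / (1 - \<rho>))\<close>
  in the squared gradient mean, one stays under the integral. The other is absorbed by the factor
  \<open>1 - \<rho>\<close> in the bound of the Green kernel, whose remaining constant is
  \<open>2 ^ (n - 2) / (n - 1)\<close>. Two singularities shape the argument. At the unit sphere
  nothing is bounded, so test functions vanish near it and all integrals stop at some
  \<open>r < 1\<close>. At the origin the radial equation degenerates and the integral in the kernel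
  diverges; there the powers of \<rho> must be shown to win.\<close>

definition cball_n :: "nat \<Rightarrow> real \<Rightarrow> (nat \<Rightarrow> real) set" where
  "cball_n n r = {x \<in> Rn n. norm_n n x \<le> r}"

lemma norm_n_nonneg [simp]: "0 \<le> norm_n n x"
  by (simp add: norm_n_def)

lemma norm_n_sq: "(norm_n n x)\<^sup>2 = (\<Sum>i<n. (x i)\<^sup>2)"
  by (simp add: norm_n_def L2_set_def sum_nonneg)

lemma abs_component_le_norm_n: "i < n \<Longrightarrow> \<bar>x i\<bar> \<le> norm_n n x"
  using member_le_L2_set[of "{..<n}" i "\<lambda>i. \<bar>x i\<bar>"] by (simp add: norm_n_def L2_set_def)

lemma scale_in_Rn [simp]: "scale n c x \<in> Rn n"
  by (simp add: scale_def)

lemma origin_in_Rn [simp]: "origin n \<in> Rn n"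
  by (simp add: origin_def)

lemma norm_n_origin [simp]: "norm_n n (origin n) = 0"
  by (simp add: norm_n_def L2_set_def origin_def)

lemma norm_n_scale [simp]: "norm_n n (scale n c x) = \<bar>c\<bar> * norm_n n x"
proof -
  have "norm_n n (scale n c x) = L2_set (\<lambda>i. \<bar>c\<bar> * x i) {..<n}"
    by (simp add: norm_n_def L2_set_def scale_def power_mult_distrib)
  also have "\<dots> = \<bar>c\<bar> * L2_set x {..<n}"
    by (rule L2_set_right_distrib[symmetric]) simp
  finally show ?thesis by (simp add: norm_n_def)
qed

lemma norm_n_eq_0_iff:
  assumes "x \<in> Rn n"
  shows "norm_n n x = 0 \<longleftrightarrow> x = origin n"
proof
  assume "norm_n n x = 0"
  then have "x i = origin n i" if "i \<in> {..<n}" for i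
    using that by (simp add: norm_n_def origin_def L2_set_eq_0_iff)
  then show "x = origin n"
    using assms by (intro PiE_ext[OF assms origin_in_Rn]) auto
qed simp

lemma scale_scale [simp]: "scale n a (scale n b x) = scale n (a * b) x"
  by (auto simp: scale_def)

lemma scale_one [simp]: "x \<in> Rn n \<Longrightarrow> scale n 1 x = x"
  by (simp add: scale_def extensional_restrict PiE_def)

lemma scale_zero [simp]: "scale n 0 x = origin n"
  by (auto simp: scale_def origin_def)

lemma space_lborel_n [simp]: "space (lborel_n n) = Rn n"
  by (simp add: space_PiM)

section \<open>Topology and measurability on the carrier\<close>

lemma continuous_on_component: "continuous_on S (\<lambda>x::nat \<Rightarrow> real. x i)"
  by (rule continuous_on_subset[OF continuous_on_product_coordinates subset_UNIV])

lemma continuous_on_norm_n: "continuous_on S (norm_n n)"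
  unfolding norm_n_def L2_set_def
  by (intro continuous_on_real_sqrt continuous_on_sum continuous_on_power continuous_on_component)

lemma continuous_on_scale_fst: "continuous_on S (\<lambda>c. scale n c x)"
proof (rule continuous_on_coordinatewise_then_product)
  fix i
  show "continuous_on S (\<lambda>c. scale n c x i)"
    by (cases "i < n") (simp_all add: scale_def continuous_on_mult continuous_on_id)
qed

text \<open>This links the sigma algebra of the finite product with the Borel sets of
  \<open>nat \<Rightarrow> real\<close>, so that continuity yields measurability for
  \<open>lborel_n n\<close>. Coordinates from \<open>n\<close> on are constantly
  \<open>undefined\<close> on the carrier.\<close>

lemma id_measurable_lborel_n: "(\<lambda>x. x) \<in> lborel_n n \<rightarrow>\<^sub>M borel"
proof -
  have "(\<lambda>x i. x i) \<in> lborel_n n \<rightarrow>\<^sub>M PiM UNIV (\<lambda>_. borel :: real measure)"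
  proof (rule measurable_PiM_single')
    fix i
    show "(\<lambda>x. x i) \<in> lborel_n n \<rightarrow>\<^sub>M borel"
    proof (cases "i < n")
      case True
      then have "(\<lambda>x. x i) \<in> lborel_n n \<rightarrow>\<^sub>M lborel"
        by (intro measurable_component_singleton) simp
      then show ?thesis by simp
    next
      case False
      have "(\<lambda>x. undefined) \<in> lborel_n n \<rightarrow>\<^sub>M (borel::real measure)" by simp
      moreover have "x i = undefined" if "x \<in> space (lborel_n n)" for x
        using that False by (auto simp: PiE_def extensional_def)
      ultimately show ?thesis
        using measurable_cong[of "lborel_n n" "\<lambda>x. x i" "\<lambda>x. undefined"] by blast
    qed
  qed auto
  then show ?thesis
    by (simp only: measurable_cong_sets[OF refl sets_PiM_equal_borel])
qed

lemma borel_measurable_lborel_n: "h \<in> borel_measurable borel \<Longrightarrow> h \<in> borel_measurable (lborel_n n)"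
  by (rule measurable_compose[OF id_measurable_lborel_n])

lemma norm_n_measurable: "norm_n n \<in> borel_measurable (lborel_n n)"
  by (rule borel_measurable_lborel_n[OF borel_measurable_continuous_onI[OF continuous_on_norm_n]])

lemma scale_measurable:
  assumes "f \<in> borel_measurable M" "g \<in> M \<rightarrow>\<^sub>M lborel_n n"
  shows "(\<lambda>x. scale n (f x) (g x)) \<in> M \<rightarrow>\<^sub>M lborel_n n"
proof -
  have "(\<lambda>x. g x i) \<in> borel_measurable M" if "i < n" for i
    using measurable_component_singleton[of i "{..<n}" "\<lambda>_. lborel"] that
    by (auto intro: measurable_compose[OF assms(2)])
  then show ?thesis using assms(1)
    unfolding scale_def by (intro measurable_restrict) auto
qed

lemma unit_ball_sets: "unit_ball n \<in> sets (lborel_n n)"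
proof -
  have "unit_ball n = norm_n n -` {..<1} \<inter> space (lborel_n n)"
    by (auto simp: unit_ball_def)
  also have "\<dots> \<in> sets (lborel_n n)"
    by (rule measurable_sets[OF norm_n_measurable]) simp
  finally show ?thesis .
qed

lemma unit_sphere_sets: "unit_sphere n \<in> sets (lborel_n n)"
proof -
  have "unit_sphere n = norm_n n -` {1} \<inter> space (lborel_n n)"
    by (auto simp: unit_sphere_def)
  also have "\<dots> \<in> sets (lborel_n n)"
    by (rule measurable_sets[OF norm_n_measurable]) simp
  finally show ?thesis .
qed

lemma mem_Rn_iff: "x \<in> Rn n \<longleftrightarrow> (\<forall>i. \<not> i < n \<longrightarrow> x i = undefined)"
  by (simp add: PiE_def extensional_def)

lemma closed_Rn: "closed (Rn n)"
proof -
  have "Rn n = (\<Inter>i\<in>{n..}. {x. x i = undefined})"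
    unfolding set_eq_iff mem_Rn_iff by (auto simp: not_less)
  also have "closed \<dots>"
    by (intro closed_INT ballI closed_Collect_eq continuous_on_component continuous_on_const)
  finally show ?thesis .
qed

lemma closed_cball_n: "closed (cball_n n r)"
proof -
  have "cball_n n r = Rn n \<inter> {x. norm_n n x \<le> r}" by (auto simp: cball_n_def)
  also have "closed \<dots>"
    by (intro closed_Int closed_Rn closed_Collect_le continuous_on_norm_n continuous_on_const)
  finally show ?thesis .
qed

lemma compact_cball_n: "compact (cball_n n r)"
proof -
  \<comment> \<open>Tychonoff: a cube in the first \<open>n\<close> coordinates, with every further
    coordinate pinned at \<open>undefined\<close>. The closed ball is a closed subset of this
    compact set.\<close>
  let ?K = "PiE UNIV (\<lambda>i. if i < n then {-r..r} else {undefined::real})"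
  have "compactin (product_topology (\<lambda>_. euclidean) UNIV) ?K"
    by (subst compactin_PiE) (auto simp: compact_Icc)
  then have "compact ?K" by (simp add: euclidean_product_topology)
  moreover have "cball_n n r \<subseteq> ?K"
  proof
    fix x assume x: "x \<in> cball_n n r"
    have "\<bar>x i\<bar> \<le> r" if "i < n" for i
      using abs_component_le_norm_n[OF that, of x] x by (auto simp: cball_n_def)
    then show "x \<in> ?K" using x
      by (simp add: cball_n_def mem_Rn_iff PiE_UNIV_domain Pi_iff abs_le_iff minus_le_iff)
  qed
  ultimately have "cball_n n r = ?K \<inter> cball_n n r" and "compact ?K" by blast+
  then show ?thesis
    using compact_Int_closed[OF \<open>compact ?K\<close> closed_cball_n[of n r]] by simp
qed

lemma unit_ball_borel: "unit_ball n \<in> sets borel"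
proof -
  have "unit_ball n = Rn n \<inter> {x. norm_n n x < 1}" by (auto simp: unit_ball_def)
  also have "\<dots> \<in> sets borel"
    by (rule sets.Int[OF borel_closed[OF closed_Rn]
          borel_open[OF open_Collect_less[OF continuous_on_norm_n continuous_on_const]]])
  finally show ?thesis .
qed

lemma continuous_on_ball_measurable:
  fixes h :: "(nat \<Rightarrow> real) \<Rightarrow> real"
  assumes "continuous_on (unit_ball n) h"
  shows "(\<lambda>x. indicator (unit_ball n) x * h x) \<in> borel_measurable (lborel_n n)"
proof -
  have "(\<lambda>x. indicator (unit_ball n) x *\<^sub>R h x) \<in> borel_measurable borel"
    by (rule borel_measurable_continuous_on_indicator[OF unit_ball_borel assms])
  then have "(\<lambda>x. indicator (unit_ball n) x * h x) \<in> borel_measurable borel"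
    unfolding real_scaleR_def .
  then show ?thesis by (rule borel_measurable_lborel_n)
qed

text \<open>Functions of the class may be unbounded near the unit sphere; every domination argument
  below draws its bound from a smaller concentric ball.\<close>

lemma continuous_on_ball_bounded:
  fixes h :: "(nat \<Rightarrow> real) \<Rightarrow> real"
  assumes "continuous_on (unit_ball n) h" "r < 1"
  obtains B where "0 \<le> B" "\<And>x. x \<in> Rn n \<Longrightarrow> norm_n n x \<le> r \<Longrightarrow> \<bar>h x\<bar> \<le> B"
proof -
  have "cball_n n r \<subseteq> unit_ball n"
    unfolding cball_n_def unit_ball_def using assms(2) by (intro Collect_mono) simp
  then have "compact (h ` cball_n n r)"
    by (intro compact_continuous_image compact_cball_n continuous_on_subset[OF assms(1)])
  then have "bounded (h ` cball_n n r)" by (rule compact_imp_bounded)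
  then obtain B where B: "\<And>y. y \<in> h ` cball_n n r \<Longrightarrow> norm y \<le> B"
    unfolding bounded_iff by blast
  show ?thesis
  proof (rule that)
    fix x assume "x \<in> Rn n" "norm_n n x \<le> r"
    then have "norm (h x) \<le> B" by (intro B imageI) (simp add: cball_n_def)
    then show "\<bar>h x\<bar> \<le> max 0 B" by simp
  qed simp
qed

section \<open>Lebesgue measure under dilation and the volume of the ball\<close>

interpretation lborel_n: product_sigma_finite "\<lambda>_::nat. lborel :: real measure"
  by standard

text \<open>A product measure is determined by its values on boxes, and the dilation acts on each of
  the \<open>n\<close> sides separately, each contributing a factor \<open>1 / c\<close>. This
  homogeneity of degree \<open>n\<close> is the source of the radial density.\<close>

lemma lborel_n_eq_scale:
  assumes c: "c > 0"
  shows "lborel_n n = scale_measure (ennreal (c ^ n)) (distr (lborel_n n) (lborel_n n) (scale n c))"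
proof (rule lborel_n.PiM_eqI[symmetric])
  fix A :: "nat \<Rightarrow> real set" assume A: "\<And>i. i \<in> {..<n} \<Longrightarrow> A i \<in> sets lborel"
  have m: "scale n c \<in> lborel_n n \<rightarrow>\<^sub>M lborel_n n" by (intro scale_measurable) simp_all
  have AB: "(*) c -` A i \<in> sets lborel" if "i < n" for i
  proof -
    have "(*) c \<in> lborel \<rightarrow>\<^sub>M lborel" by simp
    from measurable_sets[OF this A] that show ?thesis by simp
  qed
  have eq: "scale n c -` PiE {..<n} A \<inter> Rn n = PiE {..<n} (\<lambda>i. (*) c -` A i)"
    by (auto simp: scale_def PiE_def Pi_def)
  have e: "emeasure lborel ((*) c -` A i) = ennreal (1 / c) * emeasure lborel (A i)" if "i < n" for i
  proof -
    have "emeasure (distr lborel borel ((*) c)) (A i) = emeasure lborel ((*) c -` A i)"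
      using A that by (subst emeasure_distr) auto
    moreover have "emeasure (distr lborel borel ((*) c)) (A i) = ennreal (1 / c) * emeasure lborel (A i)"
      using A that c by (subst lborel_distr_mult) (auto simp: emeasure_density_const divide_simps)
    ultimately show ?thesis by simp
  qed
  have "emeasure (distr (lborel_n n) (lborel_n n) (scale n c)) (PiE {..<n} A)
        = (\<Prod>i<n. emeasure lborel ((*) c -` A i))"
  proof -
    have "emeasure (distr (lborel_n n) (lborel_n n) (scale n c)) (PiE {..<n} A)
      = emeasure (lborel_n n) (PiE {..<n} (\<lambda>i. (*) c -` A i))"
      using A by (subst emeasure_distr[OF m sets_PiM_I_finite]) (simp_all add: eq)
    then show ?thesis using AB by (subst (asm) lborel_n.emeasure_PiM) auto
  qed
  also have "\<dots> = (\<Prod>i<n. ennreal (1 / c) * emeasure lborel (A i))"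
    by (intro prod.cong) (auto simp: e)
  also have "\<dots> = ennreal (1 / c) ^ n * (\<Prod>i<n. emeasure lborel (A i))"
    by (simp add: prod.distrib)
  finally have d: "emeasure (distr (lborel_n n) (lborel_n n) (scale n c)) (PiE {..<n} A)
     = ennreal (1 / c) ^ n * (\<Prod>i<n. emeasure lborel (A i))" .
  have "ennreal (c ^ n) * ennreal (1 / c) ^ n = 1"
    using c by (simp add: ennreal_power ennreal_mult[symmetric] power_divide)
  then show "emeasure (scale_measure (ennreal (c ^ n)) (distr (lborel_n n) (lborel_n n) (scale n c)))
      (PiE {..<n} A) = (\<Prod>i\<in>{..<n}. emeasure lborel (A i))"
    by (simp add: d mult.assoc[symmetric])
qed simp_all

lemma emeasure_lborel_n_scale_image:
  assumes c: "c > 0" and A: "A \<in> sets (lborel_n n)"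
  shows "emeasure (lborel_n n) A = ennreal (c ^ n) * emeasure (lborel_n n) {x \<in> Rn n. scale n c x \<in> A}"
proof -
  have m: "scale n c \<in> lborel_n n \<rightarrow>\<^sub>M lborel_n n" by (intro scale_measurable) simp_all
  have "emeasure (lborel_n n) A
      = ennreal (c ^ n) * emeasure (distr (lborel_n n) (lborel_n n) (scale n c)) A"
    by (subst lborel_n_eq_scale[OF c]) simp
  also have "emeasure (distr (lborel_n n) (lborel_n n) (scale n c)) A
      = emeasure (lborel_n n) {x \<in> Rn n. scale n c x \<in> A}"
    by (subst emeasure_distr[OF m A]) (auto intro!: arg_cong[where f="emeasure (lborel_n n)"])
  finally show ?thesis .
qed

lemma emeasure_unit_ball_pos: "emeasure (lborel_n n) (unit_ball n) > 0"
proof -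
  \<comment> \<open>With this half side the sum of the \<open>n\<close> coordinate moduli stays
    below 1, so the cube fits into the ball; the \<open>+ 1\<close> keeps the quotient meaningful
    for \<open>n = 0\<close>.\<close>
  define e :: real where "e = 1 / (real n + 1)"
  have e: "e > 0" by (simp add: e_def)
  let ?Q = "PiE {..<n} (\<lambda>_. {-e<..<e})"
  have "x \<in> unit_ball n" if x: "x \<in> ?Q" for x
  proof -
    have "norm_n n x \<le> (\<Sum>i<n. \<bar>x i\<bar>)" unfolding norm_n_def by (rule L2_set_le_sum_abs)
    also have "\<dots> \<le> (\<Sum>i<n. e)" using x by (intro sum_mono) (auto simp: PiE_def Pi_def abs_if)
    also have "\<dots> < 1" by (simp add: e_def)
    finally show ?thesis using x by (auto simp: unit_ball_def PiE_def)
  qed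
  then have "emeasure (lborel_n n) ?Q \<le> emeasure (lborel_n n) (unit_ball n)"
    by (intro emeasure_mono unit_ball_sets) auto
  moreover have "emeasure (lborel_n n) ?Q = (\<Prod>i<n. ennreal (2 * e))"
    using e by (subst lborel_n.emeasure_PiM) auto
  moreover have "\<dots> = ennreal ((2 * e) ^ n)"
    using e by (simp add: ennreal_power)
  ultimately show ?thesis using e
    by (metis ennreal_less_zero_iff less_le_trans mult_pos_pos zero_less_numeral zero_less_power)
qed

lemma emeasure_unit_ball_finite: "emeasure (lborel_n n) (unit_ball n) < \<infinity>"
proof -
  let ?Q = "PiE {..<n} (\<lambda>_. {-1..1::real})"
  have "x \<in> ?Q" if x: "x \<in> unit_ball n" for x
  proof -
    have "\<bar>x i\<bar> \<le> 1" if "i < n" for i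
      using abs_component_le_norm_n[OF that, of x] x by (auto simp: unit_ball_def)
    then show ?thesis using x by (auto simp: unit_ball_def PiE_def abs_le_iff minus_le_iff)
  qed
  then have "emeasure (lborel_n n) (unit_ball n) \<le> emeasure (lborel_n n) ?Q"
    by (intro emeasure_mono sets_PiM_I_finite) auto
  also have "\<dots> = (\<Prod>i<n. ennreal 2)"
    by (subst lborel_n.emeasure_PiM) auto
  also have "\<dots> < \<infinity>" by (simp add: ennreal_power power_eq_top_ennreal less_top[symmetric])
  finally show ?thesis .
qed

section \<open>Polar coordinates and spherical means\<close>

abbreviation proj_n :: "nat \<Rightarrow> (nat \<Rightarrow> real) \<Rightarrow> nat \<Rightarrow> real" where
  "proj_n n x \<equiv> scale n (1 / norm_n n x) x"

abbreviation ball_measure :: "nat \<Rightarrow> (nat \<Rightarrow> real) measure" where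
  "ball_measure n \<equiv> uniform_measure (lborel_n n) (unit_ball n)"

text \<open>The law of \<open>norm_n n x\<close> when \<open>x\<close> is uniformly distributed in
  the unit ball.\<close>

definition radial_measure :: "nat \<Rightarrow> real measure" where
  "radial_measure n = density lborel (\<lambda>\<rho>. ennreal (real n * \<rho> ^ (n - 1)) * indicator {0..1} \<rho>)"

text \<open>Written as a set integral to match the shape of \<open>Mp\<close>, so that
  \<open>Mp n p r f\<close> unfolds to the power \<open>1 / p\<close> of such a mean.\<close>

definition sphere_avg :: "nat \<Rightarrow> ((nat \<Rightarrow> real) \<Rightarrow> real) \<Rightarrow> real \<Rightarrow> real" where
  "sphere_avg n h r = (LINT \<zeta>:unit_sphere n|sphere_measure n. h (scale n r \<zeta>))"

text \<open>Uniqueness from distribution functions. Open half-lines are the right generator here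
  because they pull back under the norm to open balls.\<close>

lemma measure_eqI_Iio:
  fixes M N :: "real measure"
  assumes sets: "sets M = sets borel" "sets N = sets borel"
  assumes fin: "\<And>x. emeasure M {..<x} < \<infinity>"
  assumes eq: "\<And>x. emeasure M {..<x} = emeasure N {..<x}"
  shows "M = N"
proof (rule measure_eqI_generator_eq[where E="range lessThan" and \<Omega>=UNIV and A="\<lambda>i. {..<real i}"])
  show "Int_stable (range lessThan :: real set set)"
  proof (rule Int_stableI_image)
    fix a b :: real
    have "{..<a} \<inter> {..<b} = {..<min a b}" by auto
    then show "\<exists>c\<in>UNIV. {..<a} \<inter> {..<b} = {..<c}" by blast
  qed
  show "sets M = sigma_sets UNIV (range lessThan)" "sets N = sigma_sets UNIV (range lessThan)"
    unfolding sets borel_Iio by simp_all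
  show "(\<Union>i. {..<real i}) = UNIV" by (auto intro: reals_Archimedean2)
  show "emeasure M {..<real i} \<noteq> \<infinity>" for i using fin[of "real i"] by simp
qed (auto simp: eq)

text \<open>The term \<open>0 ^ n\<close> makes the formula correct for \<open>n = 0\<close> as
  well: there it equals 1 and both sides vanish.\<close>

lemma nn_integral_radial_density:
  assumes "0 \<le> s"
  shows "(\<integral>\<^sup>+\<rho>. ennreal (real n * \<rho> ^ (n - 1)) * indicator {0..s} \<rho> \<partial>lborel) = ennreal (s ^ n - 0 ^ n)"
proof (rule nn_integral_FTC_Icc[where F="\<lambda>\<rho>. \<rho> ^ n" and f="\<lambda>\<rho>. real n * \<rho> ^ (n - 1)"])
  show "DERIV (\<lambda>\<rho>. \<rho> ^ n) x :> real n * x ^ (n - 1)" for x :: real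
    by (auto intro!: derivative_eq_intros)
qed (use assms in auto)

lemma emeasure_radial_measure_Iio:
  assumes "n \<ge> 1"
  shows "emeasure (radial_measure n) {..<t} = ennreal (max 0 (min 1 t) ^ n)"
proof -
  define s where "s = max 0 (min 1 t)"
  have s: "0 \<le> s" "s \<le> 1" by (auto simp: s_def)
  have "emeasure (radial_measure n) {..<t}
      = (\<integral>\<^sup>+\<rho>. ennreal (real n * \<rho> ^ (n - 1)) * indicator {0..1} \<rho> * indicator {..<t} \<rho> \<partial>lborel)"
    unfolding radial_measure_def by (subst emeasure_density) auto
  also have "\<dots> = (\<integral>\<^sup>+\<rho>. ennreal (real n * \<rho> ^ (n - 1)) * indicator {0..s} \<rho> \<partial>lborel)"
  proof (rule nn_integral_cong_AE)
    have "AE \<rho> in lborel. \<rho> \<noteq> s \<and> \<rho> \<noteq> 0" using AE_lborel_singleton[of s] AE_lborel_singleton[of 0] by eventually_elim auto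
    then show "AE \<rho> in lborel. ennreal (real n * \<rho> ^ (n - 1)) * indicator {0..1} \<rho> * indicator {..<t} \<rho>
        = ennreal (real n * \<rho> ^ (n - 1)) * indicator {0..s} \<rho>"
      by eventually_elim (auto simp: s_def indicator_def max_def min_def split: if_splits)
  qed
  also have "\<dots> = ennreal (s ^ n - 0 ^ n)"
    by (rule nn_integral_radial_density[OF s(1)])
  finally show ?thesis using assms by (simp add: s_def)
qed

lemma proj_n_measurable: "proj_n n \<in> lborel_n n \<rightarrow>\<^sub>M lborel_n n"
  by (intro scale_measurable borel_measurable_divide norm_n_measurable) simp_all

text \<open>The direction \<open>proj_n n x\<close> does not change under positive dilations, so the
  cone cut at radius \<open>t\<close> is the \<open>t\<close>-fold dilate of the cone cut at radius
  1.\<close>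

lemma emeasure_cone:
  assumes B: "B \<in> sets (lborel_n n)" and n: "n \<ge> 1"
  shows "emeasure (lborel_n n) {x \<in> Rn n. norm_n n x < t \<and> proj_n n x \<in> B}
    = ennreal (max 0 t ^ n) * emeasure (lborel_n n) {x \<in> unit_ball n. proj_n n x \<in> B}"
proof (cases "t > 0")
  case True
  have S: "{x \<in> Rn n. norm_n n x < t \<and> proj_n n x \<in> B} = (norm_n n -` {..<t} \<inter> space (lborel_n n)) \<inter> (proj_n n -` B \<inter> space (lborel_n n))"
    by auto
  have m: "{x \<in> Rn n. norm_n n x < t \<and> proj_n n x \<in> B} \<in> sets (lborel_n n)"
    unfolding S by (intro sets.Int measurable_sets[OF norm_n_measurable] measurable_sets[OF proj_n_measurable B]) simp
  have "{x \<in> Rn n. scale n t x \<in> {x \<in> Rn n. norm_n n x < t \<and> proj_n n x \<in> B}}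
     = {x \<in> unit_ball n. proj_n n x \<in> B}"
    using True by (auto simp: unit_ball_def)
  with emeasure_lborel_n_scale_image[OF True m] True show ?thesis by simp
next
  case False
  have "{x \<in> Rn n. norm_n n x < t \<and> proj_n n x \<in> B} = {}"
    using False norm_n_nonneg[of n] by (auto simp: not_less not_le dest: order.strict_trans1[rotated] intro: order_trans)
  then show ?thesis using False n by (simp only: ) (simp add: max_def)
qed

text \<open>Independence of length and direction. For fixed \<open>B\<close> both sides are measures
  in \<open>A\<close>, and by \<open>emeasure_cone\<close> they agree on open half-lines.\<close>

lemma emeasure_cone_radial:
  assumes B: "B \<in> sets (lborel_n n)" and n: "n \<ge> 1" and A: "A \<in> sets borel"
  shows "emeasure (lborel_n n) {x \<in> unit_ball n. norm_n n x \<in> A \<and> proj_n n x \<in> B}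
    = emeasure (radial_measure n) A * emeasure (lborel_n n) {x \<in> unit_ball n. proj_n n x \<in> B}"
proof -
  define S where "S = {x \<in> unit_ball n. proj_n n x \<in> B}"
  have "S = unit_ball n \<inter> (proj_n n -` B \<inter> space (lborel_n n))"
    by (auto simp: S_def unit_ball_def)
  then have S: "S \<in> sets (lborel_n n)"
    using unit_ball_sets measurable_sets[OF proj_n_measurable B] by auto
  define M where "M = distr (restrict_space (lborel_n n) S) borel (norm_n n)"
  define N where "N = scale_measure (emeasure (lborel_n n) S) (radial_measure n)"
  have SR: "S \<subseteq> Rn n" by (auto simp: S_def unit_ball_def)
  have eM: "emeasure M A = emeasure (lborel_n n) {x \<in> S. norm_n n x \<in> A}" if "A \<in> sets borel" for A
  proof -
    have "emeasure M A = emeasure (restrict_space (lborel_n n) S) (norm_n n -` A \<inter> space (restrict_space (lborel_n n) S))"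
      unfolding M_def using that by (intro emeasure_distr measurable_restrict_space1 norm_n_measurable)
    also have "\<dots> = emeasure (lborel_n n) (norm_n n -` A \<inter> space (restrict_space (lborel_n n) S))"
      by (rule emeasure_restrict_space) (use S SR in \<open>auto simp: space_restrict_space Int_absorb1\<close>)
    also have "norm_n n -` A \<inter> space (restrict_space (lborel_n n) S) = {x \<in> S. norm_n n x \<in> A}"
      using SR by (auto simp: space_restrict_space)
    finally show ?thesis .
  qed
  have "M = N"
  proof (rule measure_eqI_Iio)
    show "sets M = sets borel" "sets N = sets borel"
      by (simp_all add: M_def N_def radial_measure_def)
    have eq: "emeasure M {..<t} = ennreal (max 0 (min 1 t) ^ n) * emeasure (lborel_n n) S" for t
    proof -
      have "emeasure M {..<t} = emeasure (lborel_n n) {x \<in> Rn n. norm_n n x < min 1 t \<and> proj_n n x \<in> B}"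
        by (subst eM) (auto simp: S_def unit_ball_def intro!: arg_cong[where f="emeasure (lborel_n n)"])
      then show ?thesis unfolding S_def emeasure_cone[OF B n] .
    qed
    have "emeasure (lborel_n n) S \<le> emeasure (lborel_n n) (unit_ball n)"
      by (intro emeasure_mono unit_ball_sets) (auto simp: S_def)
    then have fin: "emeasure (lborel_n n) S < top"
      using emeasure_unit_ball_finite[of n] by (metis infinity_ennreal_def order.strict_trans1)
    show "emeasure M {..<t} < \<infinity>" for t
      unfolding eq infinity_ennreal_def by (intro ennreal_mult_less_top[THEN iffD2] disjI2) (use fin in auto)
    show "emeasure M {..<t} = emeasure N {..<t}" for t
      unfolding eq by (simp add: N_def emeasure_radial_measure_Iio[OF n] mult.commute)
  qed
  then have "emeasure M A = emeasure N A" by simp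
  then show ?thesis
    using A by (simp add: eM N_def S_def conj_ac mult.commute)
qed

lemma sets_sphere_measure [simp]: "sets (sphere_measure n) = sets (lborel_n n)"
  by (simp add: sphere_measure_def)

lemma space_sphere_measure [simp]: "space (sphere_measure n) = Rn n"
  by (simp add: sphere_measure_def)

lemma emeasure_sphere_measure:
  assumes B: "B \<in> sets (lborel_n n)"
  shows "emeasure (sphere_measure n) B
    = emeasure (lborel_n n) {x \<in> unit_ball n. proj_n n x \<in> B} / emeasure (lborel_n n) (unit_ball n)"
proof -
  have m: "proj_n n -` B \<inter> Rn n \<in> sets (lborel_n n)"
    using measurable_sets[OF proj_n_measurable B] by simp
  have "emeasure (sphere_measure n) B = emeasure (ball_measure n) (proj_n n -` B \<inter> Rn n)"
    unfolding sphere_measure_def using proj_n_measurable B by (subst emeasure_distr) auto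
  also have "\<dots> = emeasure (lborel_n n) (unit_ball n \<inter> (proj_n n -` B \<inter> Rn n)) / emeasure (lborel_n n) (unit_ball n)"
    by (rule emeasure_uniform_measure[OF unit_ball_sets m])
  also have "unit_ball n \<inter> (proj_n n -` B \<inter> Rn n) = {x \<in> unit_ball n. proj_n n x \<in> B}"
    by (auto simp: unit_ball_def)
  finally show ?thesis .
qed

lemma emeasure_unit_ball_ratio: "emeasure (lborel_n n) (unit_ball n) / emeasure (lborel_n n) (unit_ball n) = 1"
  using emeasure_unit_ball_pos[of n] emeasure_unit_ball_finite[of n]
  by (intro ennreal_divide_self) auto

lemma emeasure_sphere_measure_space: "emeasure (sphere_measure n) (Rn n) = 1"
proof -
  have "Rn n \<in> sets (lborel_n n)" using sets.top[of "lborel_n n"] by simp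
  then show ?thesis
    by (simp add: emeasure_sphere_measure emeasure_unit_ball_ratio)
qed

lemma finite_measure_sphere_measure: "finite_measure (sphere_measure n)"
  by standard (simp add: emeasure_sphere_measure_space)

lemma emeasure_origin:
  assumes "n \<ge> 1"
  shows "emeasure (lborel_n n) {origin n} = 0"
proof -
  have "{origin n} = PiE {..<n} (\<lambda>_. {0})"
    by (simp add: origin_def PiE_singleton[symmetric] restrict_extensional) 
  also have "emeasure (lborel_n n) \<dots> = (\<Prod>i<n. emeasure lborel {0::real})"
    by (rule lborel_n.emeasure_PiM) auto
  also have "\<dots> = 0" using assms by simp
  finally show ?thesis .
qed

text \<open>Since \<open>1 / 0 = 0\<close>, the projection fixes the origin. This is the only point
  of the ball that it sends off the sphere, and a single point is a null set.\<close>

lemma AE_unit_sphere: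
  assumes "n \<ge> 1"
  shows "AE \<zeta> in sphere_measure n. \<zeta> \<in> unit_sphere n"
proof (rule AE_I)
  let ?N = "Rn n - unit_sphere n"
  show N: "?N \<in> sets (sphere_measure n)"
    using sets.compl_sets[OF unit_sphere_sets[of n]] by simp
  show "{\<zeta> \<in> space (sphere_measure n). \<zeta> \<notin> unit_sphere n} \<subseteq> ?N" by auto
  have "{x \<in> unit_ball n. proj_n n x \<in> ?N} \<subseteq> {origin n}"
  proof
    fix x assume x: "x \<in> {x \<in> unit_ball n. proj_n n x \<in> ?N}"
    then have "x \<in> Rn n" "norm_n n (proj_n n x) \<noteq> 1"
      by (simp_all add: unit_ball_def unit_sphere_def)
    then have "norm_n n x = 0" by (cases "norm_n n x = 0") (simp_all add: abs_of_nonneg)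
    then show "x \<in> {origin n}" using norm_n_eq_0_iff[OF \<open>x \<in> Rn n\<close>] by simp
  qed
  moreover have "{origin n} \<in> sets (lborel_n n)"
  proof -
    have "norm_n n -` {0} \<inter> space (lborel_n n) \<in> sets (lborel_n n)"
      by (rule measurable_sets[OF norm_n_measurable]) simp
    moreover have "norm_n n -` {0} \<inter> space (lborel_n n) = {origin n}"
    proof (intro equalityI subsetI)
      fix x assume "x \<in> norm_n n -` {0} \<inter> space (lborel_n n)"
      then have "x \<in> Rn n" "norm_n n x = 0" by simp_all
      then show "x \<in> {origin n}" using norm_n_eq_0_iff[OF \<open>x \<in> Rn n\<close>] by simp
    qed simp
    ultimately show ?thesis by simp
  qed
  ultimately have "emeasure (lborel_n n) {x \<in> unit_ball n. proj_n n x \<in> ?N} \<le> emeasure (lborel_n n) {origin n}"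
    by (rule emeasure_mono)
  then have "emeasure (lborel_n n) {x \<in> unit_ball n. proj_n n x \<in> ?N} = 0"
    by (simp add: emeasure_origin[OF assms])
  then show "emeasure (sphere_measure n) ?N = 0"
    using N by (simp add: emeasure_sphere_measure)
qed

lemma sigma_finite_radial_measure: "sigma_finite_measure (radial_measure n)"
proof -
  interpret R: finite_measure "radial_measure n"
  proof
    have "emeasure (radial_measure n) UNIV = (\<integral>\<^sup>+\<rho>. ennreal (real n * \<rho> ^ (n - 1)) * indicator {0..1} \<rho> \<partial>lborel)"
      unfolding radial_measure_def by (subst emeasure_density) auto
    also have "\<dots> = ennreal (1 ^ n - 0 ^ n)"
      by (rule nn_integral_radial_density) simp
    finally show "emeasure (radial_measure n) (space (radial_measure n)) \<noteq> \<infinity>"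
      by (simp add: radial_measure_def)
  qed
  show ?thesis by unfold_locales
qed

text \<open>The independence proved for rectangles in \<open>emeasure_cone_radial\<close>, recast as
  an identity of measures so that Fubini applies.\<close>

lemma polar_measure:
  assumes n: "n \<ge> 1"
  shows "radial_measure n \<Otimes>\<^sub>M sphere_measure n
    = distr (ball_measure n) (borel \<Otimes>\<^sub>M lborel_n n) (\<lambda>x. (norm_n n x, proj_n n x))"
proof (rule pair_measure_eqI)
  show "sigma_finite_measure (radial_measure n)" by (rule sigma_finite_radial_measure)
  interpret S: finite_measure "sphere_measure n" by (rule finite_measure_sphere_measure)
  show "sigma_finite_measure (sphere_measure n)" by unfold_locales
  show "sets (radial_measure n \<Otimes>\<^sub>M sphere_measure n) =
    sets (distr (ball_measure n) (borel \<Otimes>\<^sub>M lborel_n n) (\<lambda>x. (norm_n n x, proj_n n x)))"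
    unfolding sets_distr by (intro sets_pair_measure_cong) (simp_all add: radial_measure_def)
  fix A B assume "A \<in> sets (radial_measure n)" "B \<in> sets (sphere_measure n)"
  then have A: "A \<in> sets borel" and B: "B \<in> sets (lborel_n n)" by (simp_all add: radial_measure_def)
  let ?T = "\<lambda>x. (norm_n n x, proj_n n x)"
  have T: "?T \<in> lborel_n n \<rightarrow>\<^sub>M borel \<Otimes>\<^sub>M lborel_n n"
    by (intro measurable_Pair norm_n_measurable proj_n_measurable)
  then have T': "?T \<in> ball_measure n \<rightarrow>\<^sub>M borel \<Otimes>\<^sub>M lborel_n n"
    by (simp cong: measurable_cong_sets)
  have AB: "A \<times> B \<in> sets (borel \<Otimes>\<^sub>M lborel_n n)" using A B by (rule pair_measureI)
  have "?T -` (A \<times> B) \<inter> Rn n \<in> sets (lborel_n n)"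
    using measurable_sets[OF T AB] by simp
  then have "emeasure (distr (ball_measure n) (borel \<Otimes>\<^sub>M lborel_n n) ?T) (A \<times> B)
     = emeasure (lborel_n n) (unit_ball n \<inter> (?T -` (A \<times> B) \<inter> Rn n)) / emeasure (lborel_n n) (unit_ball n)"
    by (subst emeasure_distr[OF T' AB]) (simp add: emeasure_uniform_measure[OF unit_ball_sets])
  also have "unit_ball n \<inter> (?T -` (A \<times> B) \<inter> Rn n) = {x \<in> unit_ball n. norm_n n x \<in> A \<and> proj_n n x \<in> B}"
    by (auto simp: unit_ball_def)
  also have "emeasure (lborel_n n) {x \<in> unit_ball n. norm_n n x \<in> A \<and> proj_n n x \<in> B} / emeasure (lborel_n n) (unit_ball n)
     = emeasure (radial_measure n) A * emeasure (sphere_measure n) B"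
    by (simp add: emeasure_cone_radial[OF B n A] emeasure_sphere_measure[OF B] ennreal_times_divide)
  finally show "emeasure (radial_measure n) A * emeasure (sphere_measure n) B
    = emeasure (distr (ball_measure n) (borel \<Otimes>\<^sub>M lborel_n n) ?T) (A \<times> B)" by simp
qed

lemma finite_measure_ball_measure: "finite_measure (ball_measure n)"
proof
  have "emeasure (ball_measure n) (Rn n) = emeasure (lborel_n n) (unit_ball n \<inter> Rn n) / emeasure (lborel_n n) (unit_ball n)"
    using sets.top[of "lborel_n n"] by (intro emeasure_uniform_measure[OF unit_ball_sets]) simp
  also have "unit_ball n \<inter> Rn n = unit_ball n" by (auto simp: unit_ball_def)
  finally show "emeasure (ball_measure n) (space (ball_measure n)) \<noteq> \<infinity>"
    by (simp add: emeasure_unit_ball_ratio)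
qed

lemma integral_ball_measure:
  fixes h :: "(nat \<Rightarrow> real) \<Rightarrow> real"
  assumes h: "h \<in> borel_measurable (lborel_n n)" and z: "\<And>x. x \<in> Rn n \<Longrightarrow> x \<notin> unit_ball n \<Longrightarrow> h x = 0"
  shows "(\<integral>x. h x \<partial>ball_measure n) = (\<integral>x. h x \<partial>lborel_n n) / measure (lborel_n n) (unit_ball n)"
proof -
  define v where "v = measure (lborel_n n) (unit_ball n)"
  have v: "emeasure (lborel_n n) (unit_ball n) = ennreal v"
    using emeasure_unit_ball_finite[of n] by (simp add: v_def emeasure_eq_ennreal_measure)
  then have v0: "v > 0" using emeasure_unit_ball_pos[of n] by simp
  have d: "indicator (unit_ball n) x / emeasure (lborel_n n) (unit_ball n) = ennreal (indicator (unit_ball n) x / v)" for x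
    unfolding v using v0 by (simp add: divide_ennreal flip: ennreal_indicator)
  have "(\<integral>x. h x \<partial>ball_measure n) = (\<integral>x. (indicator (unit_ball n) x / v) *\<^sub>R h x \<partial>lborel_n n)"
    unfolding uniform_measure_def d
    using h v0 unit_ball_sets by (intro integral_density) auto
  also have "\<dots> = (\<integral>x. h x / v \<partial>lborel_n n)"
  proof (rule Bochner_Integration.integral_cong[OF refl])
    fix x assume "x \<in> space (lborel_n n)"
    then have "x \<in> Rn n" by simp
    then show "(indicator (unit_ball n) x / v) *\<^sub>R h x = h x / v"
      using z[of x] by (cases "x \<in> unit_ball n") simp_all
  qed
  finally show ?thesis by (simp add: v_def)
qed

lemma measure_unit_ball_pos: "measure (lborel_n n) (unit_ball n) > 0"
  using emeasure_unit_ball_pos[of n] emeasure_unit_ball_finite[of n]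
  by (simp add: measure_def enn2real_positive_iff)

text \<open>A point is recovered from its length and direction, so the integral can be transported
  to the product of the radial and spherical measures and split by Fubini. The bound
  \<open>b\<close> supplies integrability because the normalized ball measure is finite.\<close>

lemma integral_polar:
  fixes h :: "(nat \<Rightarrow> real) \<Rightarrow> real"
  assumes n: "n \<ge> 1"
    and h: "h \<in> borel_measurable (lborel_n n)"
    and z: "\<And>x. x \<in> Rn n \<Longrightarrow> x \<notin> unit_ball n \<Longrightarrow> h x = 0"
    and b: "\<And>x. x \<in> Rn n \<Longrightarrow> \<bar>h x\<bar> \<le> b"
  shows "(\<integral>x. h x \<partial>lborel_n n) = measure (lborel_n n) (unit_ball n) *
    (LBINT \<rho>:{0..1}. real n * \<rho> ^ (n - 1) * (\<integral>\<zeta>. h (scale n \<rho> \<zeta>) \<partial>sphere_measure n))"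
proof -
  let ?T = "\<lambda>x. (norm_n n x, proj_n n x)"
  let ?R = "radial_measure n" and ?S = "sphere_measure n"
  interpret ps: pair_sigma_finite ?R ?S
    using sigma_finite_radial_measure finite_measure_sphere_measure
    by (simp add: pair_sigma_finite_def finite_measure_def)
  have setsP: "sets (?R \<Otimes>\<^sub>M ?S) = sets (borel \<Otimes>\<^sub>M lborel_n n)"
    by (intro sets_pair_measure_cong) (simp_all add: radial_measure_def)
  have T: "?T \<in> ball_measure n \<rightarrow>\<^sub>M borel \<Otimes>\<^sub>M lborel_n n"
    using measurable_Pair[OF norm_n_measurable proj_n_measurable]
    by (simp cong: measurable_cong_sets)
  have g: "(\<lambda>(\<rho>, \<zeta>). h (scale n \<rho> \<zeta>)) \<in> borel_measurable (borel \<Otimes>\<^sub>M lborel_n n)"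
    unfolding case_prod_beta
    by (rule measurable_compose[OF scale_measurable[OF measurable_fst measurable_snd] h])
  have gm: "(\<lambda>(\<rho>, \<zeta>). h (scale n \<rho> \<zeta>)) \<in> borel_measurable (?R \<Otimes>\<^sub>M ?S)"
    using g by (simp only: measurable_cong_sets[OF setsP refl])
  interpret B: finite_measure "ball_measure n" by (rule finite_measure_ball_measure)
  have hB: "h \<in> borel_measurable (ball_measure n)" using h by (simp cong: measurable_cong_sets)
  \<comment> \<open>At the origin the direction is degenerate, but scaling by the length 0 returns
    the origin all the same.\<close>
  have hT: "(case ?T x of (\<rho>, \<zeta>) \<Rightarrow> h (scale n \<rho> \<zeta>)) = h x" if "x \<in> Rn n" for x
    using that norm_n_eq_0_iff[OF that] by (cases "norm_n n x = 0") simp_all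
  have ihB: "integrable (ball_measure n) h"
    by (rule B.integrable_const_bound[OF _ hB, of b]) (use b in auto)
  have hT': "h x = (case ?T x of (\<rho>, \<zeta>) \<Rightarrow> h (scale n \<rho> \<zeta>))" if "x \<in> space (ball_measure n)" for x
    using hT[of x] that by simp
  have "integrable (ball_measure n) (\<lambda>x. case ?T x of (\<rho>, \<zeta>) \<Rightarrow> h (scale n \<rho> \<zeta>))"
    using iffD1[OF Bochner_Integration.integrable_cong[OF refl hT'] ihB] by simp
  then have int: "integrable (?R \<Otimes>\<^sub>M ?S) (\<lambda>(\<rho>, \<zeta>). h (scale n \<rho> \<zeta>))"
    unfolding polar_measure[OF n] by (simp only: integrable_distr_eq[OF T g])
  have "(\<integral>x. h x \<partial>ball_measure n) = (\<integral>x. (case ?T x of (\<rho>, \<zeta>) \<Rightarrow> h (scale n \<rho> \<zeta>)) \<partial>ball_measure n)"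
    by (rule Bochner_Integration.integral_cong[OF refl hT'])
  also have "\<dots> = (\<integral>z. (case z of (\<rho>, \<zeta>) \<Rightarrow> h (scale n \<rho> \<zeta>)) \<partial>(?R \<Otimes>\<^sub>M ?S))"
    unfolding polar_measure[OF n] by (rule integral_distr[OF T g, symmetric])
  also have "\<dots> = (\<integral>\<rho>. (\<integral>\<zeta>. h (scale n \<rho> \<zeta>) \<partial>?S) \<partial>?R)"
    using ps.integral_fst'[OF int] by simp
  also have "\<dots> = (\<integral>\<rho>. (indicator {0..1} \<rho> * (real n * \<rho> ^ (n - 1))) *\<^sub>R (\<integral>\<zeta>. h (scale n \<rho> \<zeta>) \<partial>?S) \<partial>lborel)"
  proof -
    have e: "ennreal (real n * \<rho> ^ (n - 1)) * indicator {0..1} \<rho> = ennreal (indicator {0..1} \<rho> * (real n * \<rho> ^ (n - 1)))" for \<rho>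
      by (simp add: indicator_def)
    have "(\<lambda>\<rho>. \<integral>\<zeta>. h (scale n \<rho> \<zeta>) \<partial>?S) \<in> borel_measurable ?R"
      using ps.M2.borel_measurable_lebesgue_integral[OF gm] by simp
    then have m: "(\<lambda>\<rho>. \<integral>\<zeta>. h (scale n \<rho> \<zeta>) \<partial>?S) \<in> borel_measurable lborel"
      by (simp add: radial_measure_def cong: measurable_cong_sets)
    show ?thesis unfolding radial_measure_def e
      by (rule integral_density[OF m]) (auto simp: indicator_def)
  qed
  also have "\<dots> = (LBINT \<rho>:{0..1}. real n * \<rho> ^ (n - 1) * (\<integral>\<zeta>. h (scale n \<rho> \<zeta>) \<partial>?S))"
    unfolding set_lebesgue_integral_def by (simp add: mult.assoc)
  finally show ?thesis
    using measure_unit_ball_pos[of n] by (simp add: integral_ball_measure[OF h z] field_simps)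
qed

section \<open>Elementary properties of spherical means\<close>

lemma sphere_avg_eq_integral:
  assumes "n \<ge> 1"
    and m: "(\<lambda>\<zeta>. h (scale n r \<zeta>)) \<in> borel_measurable (lborel_n n)"
  shows "sphere_avg n h r = (\<integral>\<zeta>. h (scale n r \<zeta>) \<partial>sphere_measure n)"
  unfolding sphere_avg_def set_lebesgue_integral_def
proof (rule integral_cong_AE)
  show "AE \<zeta> in sphere_measure n. indicat_real (unit_sphere n) \<zeta> *\<^sub>R h (scale n r \<zeta>) = h (scale n r \<zeta>)"
    using AE_unit_sphere[OF assms(1)] by eventually_elim simp
  have "(\<lambda>\<zeta>. indicator (unit_sphere n) \<zeta> * h (scale n r \<zeta>)) \<in> borel_measurable (lborel_n n)"
    by (rule borel_measurable_times[OF borel_measurable_indicator[OF unit_sphere_sets] m])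
  then show "(\<lambda>\<zeta>. indicat_real (unit_sphere n) \<zeta> *\<^sub>R h (scale n r \<zeta>)) \<in> borel_measurable (sphere_measure n)"
    by (simp cong: measurable_cong_sets)
qed (use m in \<open>simp cong: measurable_cong_sets\<close>)

lemma scale_in_unit_ball:
  assumes "\<zeta> \<in> unit_sphere n" "0 \<le> r" "r < 1"
  shows "scale n r \<zeta> \<in> unit_ball n" "norm_n n (scale n r \<zeta>) = r"
  using assms by (simp_all add: unit_sphere_def unit_ball_def)

lemma sphere_measurable:
  fixes h :: "(nat \<Rightarrow> real) \<Rightarrow> real"
  assumes h: "continuous_on (unit_ball n) h" and r: "0 \<le> r" "r < 1"
  shows "(\<lambda>\<zeta>. indicator (unit_sphere n) \<zeta> *\<^sub>R h (scale n r \<zeta>)) \<in> borel_measurable (sphere_measure n)"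
proof -
  have "(\<lambda>\<zeta>. scale n r \<zeta>) \<in> lborel_n n \<rightarrow>\<^sub>M lborel_n n"
    by (intro scale_measurable) simp_all
  from measurable_compose[OF this continuous_on_ball_measurable[OF h]]
  have "(\<lambda>\<zeta>. indicator (unit_ball n) (scale n r \<zeta>) * h (scale n r \<zeta>)) \<in> borel_measurable (lborel_n n)" .
  then have "(\<lambda>\<zeta>. indicator (unit_sphere n) \<zeta> * (indicator (unit_ball n) (scale n r \<zeta>) * h (scale n r \<zeta>)))
      \<in> borel_measurable (lborel_n n)"
    by (rule borel_measurable_times[OF borel_measurable_indicator[OF unit_sphere_sets]])
  moreover have "indicat_real (unit_sphere n) \<zeta> * (indicator (unit_ball n) (scale n r \<zeta>) * h (scale n r \<zeta>))
      = indicator (unit_sphere n) \<zeta> *\<^sub>R h (scale n r \<zeta>)" for \<zeta>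
    using scale_in_unit_ball(1)[OF _ r, of \<zeta> n] by (simp add: indicator_def)
  ultimately show ?thesis by (simp cong: measurable_cong_sets)
qed

lemma sphere_integrable:
  fixes h :: "(nat \<Rightarrow> real) \<Rightarrow> real"
  assumes h: "continuous_on (unit_ball n) h" and r: "0 \<le> r" "r < 1"
  shows "set_integrable (sphere_measure n) (unit_sphere n) (\<lambda>\<zeta>. h (scale n r \<zeta>))"
proof -
  obtain b where b: "0 \<le> b" "\<And>x. x \<in> Rn n \<Longrightarrow> norm_n n x \<le> r \<Longrightarrow> \<bar>h x\<bar> \<le> b"
    using continuous_on_ball_bounded[OF h r(2)] by blast
  interpret S: finite_measure "sphere_measure n" by (rule finite_measure_sphere_measure)
  show ?thesis unfolding set_integrable_def
  proof (rule S.integrable_const_bound[OF _ sphere_measurable[OF h r], of b])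
    show "AE \<zeta> in sphere_measure n. norm (indicat_real (unit_sphere n) \<zeta> *\<^sub>R h (scale n r \<zeta>)) \<le> b"
      using b r by (intro AE_I2) (auto simp: indicator_def unit_sphere_def)
  qed
qed

lemma sphere_avg_const [simp]:
  assumes "n \<ge> 1"
  shows "sphere_avg n (\<lambda>_. c) r = c"
proof -
  interpret S: finite_measure "sphere_measure n" by (rule finite_measure_sphere_measure)
  have "sphere_avg n (\<lambda>_. c) r = (\<integral>\<zeta>. c \<partial>sphere_measure n)"
    by (rule sphere_avg_eq_integral[OF assms]) simp
  also have "\<dots> = c" using emeasure_sphere_measure_space[of n] by (simp add: measure_def)
  finally show ?thesis .
qed

lemma sphere_avg_origin:
  assumes "n \<ge> 1"
  shows "sphere_avg n h 0 = h (origin n)"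
  using sphere_avg_const[OF assms, of "h (origin n)" 0] by (simp add: sphere_avg_def)

lemma sphere_avg_mono:
  assumes "continuous_on (unit_ball n) h" "continuous_on (unit_ball n) k" "0 \<le> r" "r < 1"
    and "\<And>x. x \<in> unit_ball n \<Longrightarrow> norm_n n x = r \<Longrightarrow> h x \<le> k x"
  shows "sphere_avg n h r \<le> sphere_avg n k r"
  unfolding sphere_avg_def
  by (rule set_integral_mono) (use assms in \<open>auto intro!: sphere_integrable scale_in_unit_ball\<close>)

lemma sphere_avg_cong:
  assumes "0 \<le> r" "r < 1" "\<And>x. x \<in> unit_ball n \<Longrightarrow> norm_n n x = r \<Longrightarrow> h x = k x"
  shows "sphere_avg n h r = sphere_avg n k r"
  unfolding sphere_avg_def set_lebesgue_integral_def
  by (rule Bochner_Integration.integral_cong[OF refl])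
     (use assms in \<open>auto simp: indicator_def intro!: scale_in_unit_ball\<close>)

lemma sphere_avg_add:
  assumes "continuous_on (unit_ball n) h" "continuous_on (unit_ball n) k" "0 \<le> r" "r < 1"
  shows "sphere_avg n (\<lambda>x. h x + k x) r = sphere_avg n h r + sphere_avg n k r"
  unfolding sphere_avg_def
  by (rule set_integral_add(2)) (use assms in \<open>auto intro: sphere_integrable\<close>)

lemma sphere_avg_cmult: "sphere_avg n (\<lambda>x. c * h x) r = c * sphere_avg n h r"
  unfolding sphere_avg_def by simp

lemma sphere_avg_continuous:
  fixes h :: "(nat \<Rightarrow> real) \<Rightarrow> real"
  assumes h: "continuous_on (unit_ball n) h"
  shows "continuous_on {0..<1} (sphere_avg n h)"
  unfolding continuous_on_sequentially
proof (intro ballI allI impI)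
  fix x :: "nat \<Rightarrow> real" and a :: real
  assume a: "a \<in> {0..<1}" and x: "(\<forall>k. x k \<in> {0..<1}) \<and> x \<longlonglongrightarrow> a"
  interpret S: finite_measure "sphere_measure n" by (rule finite_measure_sphere_measure)
  \<comment> \<open>A radius strictly between the limit and 1: a tail of the sequence stays below
    it, and \<open>h\<close> is bounded on that smaller ball, which gives a constant dominating
    function.\<close>
  define c where "c = (a + 1) / 2"
  have c: "a < c" "c < 1" using a by (simp_all add: c_def)
  have "eventually (\<lambda>k. x k < c) sequentially"
    using x c(1) by (auto dest: order_tendstoD(2))
  then obtain K where K: "\<And>k. k \<ge> K \<Longrightarrow> x k < c" by (auto simp: eventually_sequentially)
  obtain b where b: "0 \<le> b" "\<And>y. y \<in> Rn n \<Longrightarrow> norm_n n y \<le> c \<Longrightarrow> \<bar>h y\<bar> \<le> b"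
    using continuous_on_ball_bounded[OF h c(2)] by blast
  have xk: "0 \<le> x k" "x k < 1" for k using x by auto
  have "(\<lambda>k. \<integral>\<zeta>. indicat_real (unit_sphere n) \<zeta> *\<^sub>R h (scale n (x (k + K)) \<zeta>) \<partial>sphere_measure n)
    \<longlonglongrightarrow> (\<integral>\<zeta>. indicat_real (unit_sphere n) \<zeta> *\<^sub>R h (scale n a \<zeta>) \<partial>sphere_measure n)"
  proof (rule integral_dominated_convergence[where w="\<lambda>_. b"])
    show "(\<lambda>\<zeta>. indicat_real (unit_sphere n) \<zeta> *\<^sub>R h (scale n a \<zeta>)) \<in> borel_measurable (sphere_measure n)"
      using a by (intro sphere_measurable[OF h]) auto
    show "(\<lambda>\<zeta>. indicat_real (unit_sphere n) \<zeta> *\<^sub>R h (scale n (x (k + K)) \<zeta>)) \<in> borel_measurable (sphere_measure n)" for k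
      by (intro sphere_measurable[OF h] xk)
    show "integrable (sphere_measure n) (\<lambda>_. b)" by simp
    show "AE \<zeta> in sphere_measure n. norm (indicat_real (unit_sphere n) \<zeta> *\<^sub>R h (scale n (x (k + K)) \<zeta>)) \<le> b" for k
      using b K[of "k + K"] xk[of "k + K"]
      by (intro AE_I2) (auto simp: indicator_def unit_sphere_def intro!: b(2) less_imp_le)
    show "AE \<zeta> in sphere_measure n. (\<lambda>k. indicat_real (unit_sphere n) \<zeta> *\<^sub>R h (scale n (x (k + K)) \<zeta>))
        \<longlonglongrightarrow> indicat_real (unit_sphere n) \<zeta> *\<^sub>R h (scale n a \<zeta>)"
    proof (intro AE_I2)
      fix \<zeta> assume "\<zeta> \<in> space (sphere_measure n)"
      show "(\<lambda>k. indicat_real (unit_sphere n) \<zeta> *\<^sub>R h (scale n (x (k + K)) \<zeta>))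
        \<longlonglongrightarrow> indicat_real (unit_sphere n) \<zeta> *\<^sub>R h (scale n a \<zeta>)"
      proof (cases "\<zeta> \<in> unit_sphere n")
        case True
        have "continuous_on {0..<1} (\<lambda>c. h (scale n c \<zeta>))"
          by (rule continuous_on_compose2[OF h continuous_on_scale_fst])
             (use True in \<open>auto intro: scale_in_unit_ball\<close>)
        moreover have "(\<lambda>k. x (k + K)) \<longlonglongrightarrow> a" using x by (simp add: LIMSEQ_ignore_initial_segment)
        ultimately have "(\<lambda>k. h (scale n (x (k + K)) \<zeta>)) \<longlonglongrightarrow> h (scale n a \<zeta>)"
          using a x by (auto intro: continuous_on_tendsto_compose)
        then show ?thesis using True by simp
      qed simp
    qed
  qed
  then have "(\<lambda>k. sphere_avg n h (x (k + K))) \<longlonglongrightarrow> sphere_avg n h a"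
    by (simp add: sphere_avg_def set_lebesgue_integral_def)
  then show "(sphere_avg n h \<circ> x) \<longlonglongrightarrow> sphere_avg n h a"
    using LIMSEQ_offset[of "sphere_avg n h \<circ> x" K] by (simp add: o_def)
qed

section \<open>Radial test functions\<close>

text \<open>Test functions are radial, \<open>x \<mapsto> \<psi>(|x|\<^sup>2)\<close>: the square keeps them \<open>C\<^sup>1\<close> at the origin, so
  that nothing has to be assumed about \<open>\<psi>\<close> near \<open>0\<close>.\<close>

definition radial_test :: "(real \<Rightarrow> real) \<Rightarrow> (real \<Rightarrow> real) \<Rightarrow> real \<Rightarrow> bool" where
  "radial_test \<psi> \<psi>' b \<longleftrightarrow> 0 < b \<and> b < 1 \<and> continuous_on {-1..1} \<psi>' \<and>
     (\<forall>s\<in>{-1<..<1}. (\<psi> has_real_derivative \<psi>' s) (at s)) \<and> (\<forall>s\<in>{b..1}. \<psi> s = 0 \<and> \<psi>' s = 0)"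

lemma radial_testD:
  assumes "radial_test \<psi> \<psi>' b"
  shows "0 < b" "b < 1" "continuous_on {-1..1} \<psi>'"
    "\<And>s. -1 < s \<Longrightarrow> s < 1 \<Longrightarrow> (\<psi> has_real_derivative \<psi>' s) (at s)"
    "\<And>s. b \<le> s \<Longrightarrow> s \<le> 1 \<Longrightarrow> \<psi> s = 0" "\<And>s. b \<le> s \<Longrightarrow> s \<le> 1 \<Longrightarrow> \<psi>' s = 0"
  using assms by (auto simp: radial_test_def)

lemma radial_test_isCont:
  assumes "radial_test \<psi> \<psi>' b" "-1 < s" "s < 1"
  shows "isCont \<psi> s" "isCont \<psi>' s"
proof -
  show "isCont \<psi> s" using radial_testD(4)[OF assms] by (rule DERIV_isCont)
  show "isCont \<psi>' s"
    by (rule continuous_on_interior[OF radial_testD(3)[OF assms(1)]]) (use assms in simp)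
qed

lemma integral_line_zero:
  fixes v dv :: "real \<Rightarrow> real"
  assumes T: "radial_test \<psi> \<psi>' b" and c: "0 \<le> c"
    and v: "\<And>t. t\<^sup>2 + c < 1 \<Longrightarrow> (v has_real_derivative dv t) (at t)"
    and dv: "\<And>t. t\<^sup>2 + c < 1 \<Longrightarrow> isCont dv t"
  shows "(\<integral>t. (if t\<^sup>2 + c < 1 then \<psi> (t\<^sup>2 + c) * dv t + \<psi>' (t\<^sup>2 + c) * (2 * t * v t) else 0) \<partial>lborel) = 0"
proof -
  define f where "f = (\<lambda>t. if t\<^sup>2 + c < 1 then \<psi> (t\<^sup>2 + c) * dv t + \<psi>' (t\<^sup>2 + c) * (2 * t * v t) else 0)"
  define F where "F = (\<lambda>t. if t\<^sup>2 + c < 1 then \<psi> (t\<^sup>2 + c) * v t else 0)"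
  have cont_q: "((\<lambda>t. t\<^sup>2 + c) \<longlongrightarrow> t\<^sup>2 + c) (nhds t)" for t
    by (intro tendsto_intros) (simp add: filterlim_ident)
  have *: "(F has_real_derivative f t) (at t) \<and> isCont f t" for t
  proof (cases "t\<^sup>2 + c < 1")
    case True
    then have ev: "\<forall>\<^sub>F s in nhds t. s\<^sup>2 + c < 1" using order_tendstoD(2)[OF cont_q] by blast
    have q1: "-1 < t\<^sup>2 + c" using c zero_le_power2[of t] by linarith
    have d: "((\<lambda>t. t\<^sup>2 + c) has_real_derivative 2 * t) (at t)" by (auto intro!: derivative_eq_intros)
    have d2: "((\<lambda>t. \<psi> (t\<^sup>2 + c)) has_real_derivative \<psi>' (t\<^sup>2 + c) * (2 * t)) (at t)"
      by (rule DERIV_chain2[OF radial_testD(4)[OF T q1 True] d])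
    have "((\<lambda>t. \<psi> (t\<^sup>2 + c) * v t) has_real_derivative f t) (at t)"
      using DERIV_mult[OF d2 v[OF True]] True by (simp add: f_def algebra_simps)
    moreover have "\<forall>\<^sub>F s in nhds t. F s = \<psi> (s\<^sup>2 + c) * v s"
      using ev by eventually_elim (simp add: F_def)
    ultimately have "(F has_real_derivative f t) (at t)"
      by (simp add: DERIV_cong_ev[where f=F and g="\<lambda>s. \<psi> (s\<^sup>2 + c) * v s", OF refl _ refl])
    moreover have "isCont f t"
    proof -
      have iq: "isCont (\<lambda>t. t\<^sup>2 + c) t" by (intro continuous_intros)
      have "isCont (\<lambda>t. \<psi> (t\<^sup>2 + c) * dv t + \<psi>' (t\<^sup>2 + c) * (2 * t * v t)) t"
        using isCont_o2[OF iq radial_test_isCont(1)[OF T q1 True]]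
          isCont_o2[OF iq radial_test_isCont(2)[OF T q1 True]] dv[OF True] DERIV_isCont[OF v[OF True]]
        by (intro continuous_intros)
      moreover have "\<forall>\<^sub>F s in nhds t. f s = \<psi> (s\<^sup>2 + c) * dv s + \<psi>' (s\<^sup>2 + c) * (2 * s * v s)"
        using ev by eventually_elim (simp add: f_def)
      ultimately show ?thesis by (simp add: isCont_cong[of f "\<lambda>s. \<psi> (s\<^sup>2 + c) * dv s + \<psi>' (s\<^sup>2 + c) * (2 * s * v s)" t])
    qed
    ultimately show ?thesis by simp
  next
    case False
    \<comment> \<open>Off the chord, and even slightly inside it, the test function already
      vanishes, so extension by zero is smooth across the endpoints where \<open>v\<close> may be
      singular.\<close>
    then have "b < t\<^sup>2 + c" using radial_testD(2)[OF T] by simp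
    then have ev: "\<forall>\<^sub>F s in nhds t. b < s\<^sup>2 + c" using order_tendstoD(1)[OF cont_q] by blast
    have F0: "\<forall>\<^sub>F s in nhds t. F s = 0"
      using ev by eventually_elim (simp add: F_def radial_testD[OF T])
    have f0: "\<forall>\<^sub>F s in nhds t. f s = 0"
      using ev by eventually_elim (simp add: f_def radial_testD[OF T])
    have "f t = 0" using False by (simp add: f_def)
    then have "(F has_real_derivative f t) (at t)"
      by (simp add: DERIV_cong_ev[OF refl F0 refl])
    moreover have "isCont f t" using isCont_cong[OF f0] by simp
    ultimately show ?thesis by simp
  qed
  \<comment> \<open>The chord lies in \<open>{-1..1}\<close> because \<open>c\<close> is
    nonnegative, and the primitive is zero at both ends.\<close>
  have "(\<integral>t. f t * indicator {-1..1} t \<partial>lborel) = F 1 - F (-1)"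
    by (rule integral_FTC_Icc_real) (use * in auto)
  moreover have "f t * indicator {-1..1} t = f t" for t
  proof (cases "t\<^sup>2 + c < 1")
    case True
    then have "t\<^sup>2 \<le> 1" using c by linarith
    then have "\<bar>t\<bar> \<le> 1" by (simp add: abs_square_le_1)
    then show ?thesis by (simp add: abs_le_iff indicator_def)
  qed (simp add: f_def)
  ultimately have "(\<integral>t. f t \<partial>lborel) = F 1 - F (-1)" by (simp only:)
  then show ?thesis using c by (simp add: f_def F_def)
qed

lemma norm_n_upd_sq:
  assumes "i < n"
  shows "(norm_n n (x(i := t)))\<^sup>2 = t\<^sup>2 + (\<Sum>j\<in>{..<n} - {i}. (x j)\<^sup>2)"
proof -
  have "(norm_n n (x(i := t)))\<^sup>2 = (\<Sum>j\<in>insert i ({..<n} - {i}). ((x(i := t)) j)\<^sup>2)"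
    unfolding norm_n_sq using assms by (intro sum.cong) auto
  also have "\<dots> = t\<^sup>2 + (\<Sum>j\<in>{..<n} - {i}. ((x(i := t)) j)\<^sup>2)"
    by (subst sum.insert) auto
  also have "(\<Sum>j\<in>{..<n} - {i}. ((x(i := t)) j)\<^sup>2) = (\<Sum>j\<in>{..<n} - {i}. (x j)\<^sup>2)"
    by (intro sum.cong) auto
  finally show ?thesis .
qed

lemma unit_ball_iff_sq: "x \<in> unit_ball n \<longleftrightarrow> x \<in> Rn n \<and> (norm_n n x)\<^sup>2 < 1"
  by (auto simp: unit_ball_def abs_square_less_1)

lemma continuous_on_upd: "continuous_on S (\<lambda>t. x(i := t))" for x :: "nat \<Rightarrow> real"
proof (rule continuous_on_coordinatewise_then_product)
  fix j show "continuous_on S (\<lambda>t. (x(i := t)) j)"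
    by (cases "j = i") (simp_all add: continuous_on_id)
qed

lemma continuous_on_norm_n_sq_test:
  assumes T: "radial_test \<psi> \<psi>' b"
  shows "continuous_on (unit_ball n) (\<lambda>x. \<psi> ((norm_n n x)\<^sup>2))"
    "continuous_on (unit_ball n) (\<lambda>x. \<psi>' ((norm_n n x)\<^sup>2))"
proof -
  have q: "continuous_on (unit_ball n) (\<lambda>x. (norm_n n x)\<^sup>2)"
    by (intro continuous_on_power continuous_on_norm_n)
  have im: "(norm_n n x)\<^sup>2 \<in> {-1<..<1}" if "x \<in> unit_ball n" for x
    using that by (simp add: unit_ball_iff_sq order_less_le_trans[OF _ zero_le_power2])
  have "continuous_on {-1<..<1} \<psi>"
    using radial_test_isCont(1)[OF T] by (intro continuous_at_imp_continuous_on) auto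
  then show "continuous_on (unit_ball n) (\<lambda>x. \<psi> ((norm_n n x)\<^sup>2))"
    by (rule continuous_on_compose2[OF _ q]) (use im in blast)
  have "continuous_on {-1<..<1} \<psi>'"
    using radial_test_isCont(2)[OF T] by (intro continuous_at_imp_continuous_on) auto
  then show "continuous_on (unit_ball n) (\<lambda>x. \<psi>' ((norm_n n x)\<^sup>2))"
    by (rule continuous_on_compose2[OF _ q]) (use im in blast)
qed

text \<open>\<open>K1\<close> and \<open>K2\<close> may blow up at the unit sphere, but the test
  function vanishes once the squared norm reaches \<open>b\<close>. Only the compact ball of radius
  \<open>sqrt b\<close> matters, where everything is bounded.\<close>

lemma test_integrand:
  fixes K1 K2 :: "(nat \<Rightarrow> real) \<Rightarrow> real"
  assumes T: "radial_test \<psi> \<psi>' b"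
    and K: "continuous_on (unit_ball n) K1" "continuous_on (unit_ball n) K2"
  defines "h \<equiv> \<lambda>x. indicator (unit_ball n) x * (\<psi> ((norm_n n x)\<^sup>2) * K1 x + \<psi>' ((norm_n n x)\<^sup>2) * K2 x)"
  shows "h \<in> borel_measurable (lborel_n n)" "integrable (lborel_n n) h"
    "\<exists>B. \<forall>x\<in>Rn n. \<bar>h x\<bar> \<le> B"
proof -
  have c: "continuous_on (unit_ball n) (\<lambda>x. \<psi> ((norm_n n x)\<^sup>2) * K1 x + \<psi>' ((norm_n n x)\<^sup>2) * K2 x)"
    by (intro continuous_on_add continuous_on_mult continuous_on_norm_n_sq_test[OF T] K)
  show m: "h \<in> borel_measurable (lborel_n n)"
    unfolding h_def by (rule continuous_on_ball_measurable[OF c])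
  have sb: "sqrt b < 1" "0 \<le> sqrt b" using radial_testD(1,2)[OF T] by (simp_all add: less_imp_le)
  obtain B where B: "0 \<le> B" "\<And>x. x \<in> Rn n \<Longrightarrow> norm_n n x \<le> sqrt b \<Longrightarrow>
      \<bar>\<psi> ((norm_n n x)\<^sup>2) * K1 x + \<psi>' ((norm_n n x)\<^sup>2) * K2 x\<bar> \<le> B"
    using continuous_on_ball_bounded[OF c sb(1)] by blast
  have bd: "\<bar>h x\<bar> \<le> B" if x: "x \<in> Rn n" for x
  proof (cases "x \<in> unit_ball n \<and> norm_n n x > sqrt b")
    case True
    then have "(norm_n n x)\<^sup>2 < 1" by (simp add: unit_ball_iff_sq)
    moreover have "b \<le> (norm_n n x)\<^sup>2"
      using True by (intro sqrt_le_D) simp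
    ultimately show ?thesis using B(1) radial_testD(5,6)[OF T] by (simp add: h_def)
  next
    case False
    then show ?thesis using B x by (auto simp: h_def indicator_def not_less)
  qed
  then show "\<exists>B. \<forall>x\<in>Rn n. \<bar>h x\<bar> \<le> B" by blast
  show "integrable (lborel_n n) h"
  proof (rule Bochner_Integration.integrable_bound[OF _ m])
    show "integrable (lborel_n n) (\<lambda>x. B * indicator (unit_ball n) x)"
      using emeasure_unit_ball_finite[of n] unit_ball_sets by (intro integrable_mult_right integrable_real_indicator) auto
    show "AE x in lborel_n n. norm (h x) \<le> norm (B * indicator (unit_ball n) x)"
    proof (rule AE_I2)
      fix x assume "x \<in> space (lborel_n n)"
      then have "\<bar>h x\<bar> \<le> B" by (intro bd) simp
      moreover have "h x = 0" if "x \<notin> unit_ball n" using that by (simp add: h_def)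
      ultimately show "norm (h x) \<le> norm (B * indicator (unit_ball n) x)"
        using B(1) by (cases "x \<in> unit_ball n") auto
    qed
  qed
qed

text \<open>Fubini singles out the coordinate \<open>i\<close>, and each inner integral vanishes by
  \<open>integral_line_zero\<close>. The factor \<open>2 * x i\<close> is the partial derivative of
  the squared norm.\<close>

lemma ball_integral_by_parts:
  fixes V DV :: "(nat \<Rightarrow> real) \<Rightarrow> real"
  assumes T: "radial_test \<psi> \<psi>' b" and i: "i < n"
    and V: "continuous_on (unit_ball n) V" and DV: "continuous_on (unit_ball n) DV"
    and d: "\<And>x. x \<in> unit_ball n \<Longrightarrow> ((\<lambda>t. V (x(i := t))) has_real_derivative DV x) (at (x i))"
  shows "(\<integral>x. indicator (unit_ball n) x * (\<psi> ((norm_n n x)\<^sup>2) * DV x + \<psi>' ((norm_n n x)\<^sup>2) * (2 * x i * V x)) \<partial>lborel_n n) = 0"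
proof -
  define h where "h = (\<lambda>x. indicator (unit_ball n) x * (\<psi> ((norm_n n x)\<^sup>2) * DV x + \<psi>' ((norm_n n x)\<^sup>2) * (2 * x i * V x)))"
  let ?I = "{..<n} - {i}"
  have ins: "insert i ?I = {..<n}" using i by auto
  have "continuous_on (unit_ball n) (\<lambda>x. 2 * x i * V x)"
    by (intro continuous_on_mult continuous_on_const continuous_on_component V)
  then have "integrable (lborel_n n) h"
    unfolding h_def by (rule test_integrand(2)[OF T DV])
  then have "integral\<^sup>L (PiM (insert i ?I) (\<lambda>_. lborel)) h
     = (\<integral>x. (\<integral>y. h (x(i := y)) \<partial>lborel) \<partial>PiM ?I (\<lambda>_. lborel))"
    by (intro lborel_n.product_integral_insert) (simp_all only: ins, simp_all)
  also have "\<dots> = (\<integral>x. 0 \<partial>PiM ?I (\<lambda>_. lborel :: real measure))"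
  proof (rule Bochner_Integration.integral_cong[OF refl])
    fix x assume "x \<in> space (PiM ?I (\<lambda>_. lborel :: real measure))"
    then have "\<forall>j. j \<notin> ?I \<longrightarrow> x j = undefined" by (simp add: space_PiM PiE_def extensional_def)
    then have xR: "x(i := t) \<in> Rn n" for t using i by (simp add: mem_Rn_iff)
    define c where "c = (\<Sum>j\<in>?I. (x j)\<^sup>2)"
    have nq: "(norm_n n (x(i := t)))\<^sup>2 = t\<^sup>2 + c" for t
      unfolding c_def by (rule norm_n_upd_sq[OF i])
    have B: "x(i := t) \<in> unit_ball n \<longleftrightarrow> t\<^sup>2 + c < 1" for t
      by (simp add: unit_ball_iff_sq xR nq)
    have "(\<integral>t. (if t\<^sup>2 + c < 1 then \<psi> (t\<^sup>2 + c) * DV (x(i := t)) + \<psi>' (t\<^sup>2 + c) * (2 * t * V (x(i := t))) else 0) \<partial>lborel) = 0"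
    proof (rule integral_line_zero[OF T])
      show "0 \<le> c" unfolding c_def by (intro sum_nonneg) simp
      fix t assume t: "t\<^sup>2 + c < 1"
      show "((\<lambda>t. V (x(i := t))) has_real_derivative DV (x(i := t))) (at t)"
        using d[of "x(i := t)"] t B by simp
      have "open {t. t\<^sup>2 + c < 1}"
        by (intro open_Collect_less continuous_on_add continuous_on_power continuous_on_id continuous_on_const)
      moreover have "continuous_on {t. t\<^sup>2 + c < 1} (\<lambda>t. DV (x(i := t)))"
        by (rule continuous_on_compose2[OF DV continuous_on_upd]) (use B in auto)
      ultimately show "isCont (\<lambda>t. DV (x(i := t))) t"
        using t by (simp add: continuous_on_eq_continuous_at)
    qed
    moreover have "h (x(i := t)) = (if t\<^sup>2 + c < 1 then \<psi> (t\<^sup>2 + c) * DV (x(i := t)) + \<psi>' (t\<^sup>2 + c) * (2 * t * V (x(i := t))) else 0)" for t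
      unfolding h_def nq indicator_def B by simp
    ultimately show "(\<integral>y. h (x(i := y)) \<partial>lborel) = 0" by simp
  qed
  finally show ?thesis unfolding ins h_def by simp
qed

text \<open>The radial factors are constant on every sphere and can be taken out of the spherical
  integral.\<close>

lemma test_integral_polar:
  fixes K1 K2 :: "(nat \<Rightarrow> real) \<Rightarrow> real"
  assumes n: "n \<ge> 1" and T: "radial_test \<psi> \<psi>' b"
    and K: "continuous_on (unit_ball n) K1" "continuous_on (unit_ball n) K2"
  shows "(\<integral>x. indicator (unit_ball n) x * (\<psi> ((norm_n n x)\<^sup>2) * K1 x + \<psi>' ((norm_n n x)\<^sup>2) * K2 x) \<partial>lborel_n n)
    = measure (lborel_n n) (unit_ball n) * (LBINT \<rho>:{0..1}. real n * \<rho> ^ (n - 1) *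
        (\<psi> (\<rho>\<^sup>2) * sphere_avg n K1 \<rho> + \<psi>' (\<rho>\<^sup>2) * sphere_avg n K2 \<rho>))"
proof -
  define h where "h = (\<lambda>x. indicator (unit_ball n) x * (\<psi> ((norm_n n x)\<^sup>2) * K1 x + \<psi>' ((norm_n n x)\<^sup>2) * K2 x))"
  have hm: "h \<in> borel_measurable (lborel_n n)"
    unfolding h_def by (rule test_integrand(1)[OF T K])
  obtain B where B: "\<And>x. x \<in> Rn n \<Longrightarrow> \<bar>h x\<bar> \<le> B"
    using test_integrand(3)[OF T K] unfolding h_def by blast
  have inner: "(\<integral>\<zeta>. h (scale n \<rho> \<zeta>) \<partial>sphere_measure n) = \<psi> (\<rho>\<^sup>2) * sphere_avg n K1 \<rho> + \<psi>' (\<rho>\<^sup>2) * sphere_avg n K2 \<rho>"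
    if \<rho>: "\<rho> \<in> {0..1}" for \<rho>
  proof -
    have "scale n \<rho> \<in> lborel_n n \<rightarrow>\<^sub>M lborel_n n" by (intro scale_measurable) simp_all
    from measurable_compose[OF this hm] have m: "(\<lambda>\<zeta>. h (scale n \<rho> \<zeta>)) \<in> borel_measurable (lborel_n n)" .
    have "(\<integral>\<zeta>. h (scale n \<rho> \<zeta>) \<partial>sphere_measure n) = sphere_avg n h \<rho>"
      by (rule sphere_avg_eq_integral[OF n m, symmetric])
    also have "\<dots> = \<psi> (\<rho>\<^sup>2) * sphere_avg n K1 \<rho> + \<psi>' (\<rho>\<^sup>2) * sphere_avg n K2 \<rho>"
    proof (cases "\<rho> < 1")
      case True
      have "sphere_avg n h \<rho> = sphere_avg n (\<lambda>x. \<psi> (\<rho>\<^sup>2) * K1 x + \<psi>' (\<rho>\<^sup>2) * K2 x) \<rho>"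
        by (rule sphere_avg_cong) (use True \<rho> in \<open>auto simp: h_def\<close>)
      also have "\<dots> = \<psi> (\<rho>\<^sup>2) * sphere_avg n K1 \<rho> + \<psi>' (\<rho>\<^sup>2) * sphere_avg n K2 \<rho>"
        using True \<rho> by (subst sphere_avg_add) (auto simp: sphere_avg_cmult intro!: continuous_on_mult continuous_on_const K)
      finally show ?thesis .
    next
      case False
      \<comment> \<open>The closed interval includes the sphere itself, where the ball indicator
        kills the left side and \<open>\<psi>\<close>, \<open>\<psi>'\<close> kill the right
        side.\<close>
      then have r1: "\<rho> = 1" using \<rho> by simp
      have "scale n 1 \<zeta> \<notin> unit_ball n" if "\<zeta> \<in> unit_sphere n" for \<zeta>
        using that by (simp add: unit_sphere_def unit_ball_def)
      then have "indicator (unit_sphere n) \<zeta> *\<^sub>R h (scale n 1 \<zeta>) = 0" for \<zeta>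
        by (cases "\<zeta> \<in> unit_sphere n") (simp_all add: h_def)
      then have "sphere_avg n h \<rho> = 0"
        unfolding sphere_avg_def set_lebesgue_integral_def r1 by (simp only: Bochner_Integration.integral_zero)
      then show ?thesis using radial_testD(5,6)[OF T, of 1] radial_testD(2)[OF T] by (simp add: r1)
    qed
    finally show ?thesis .
  qed
  have "(\<integral>x. h x \<partial>lborel_n n) = measure (lborel_n n) (unit_ball n) *
    (LBINT \<rho>:{0..1}. real n * \<rho> ^ (n - 1) * (\<integral>\<zeta>. h (scale n \<rho> \<zeta>) \<partial>sphere_measure n))"
    by (rule integral_polar[OF n hm _ B]) (simp_all add: h_def)
  also have "(LBINT \<rho>:{0..1}. real n * \<rho> ^ (n - 1) * (\<integral>\<zeta>. h (scale n \<rho> \<zeta>) \<partial>sphere_measure n))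
    = (LBINT \<rho>:{0..1}. real n * \<rho> ^ (n - 1) *
        (\<psi> (\<rho>\<^sup>2) * sphere_avg n K1 \<rho> + \<psi>' (\<rho>\<^sup>2) * sphere_avg n K2 \<rho>))"
    by (rule set_lebesgue_integral_cong) (simp_all add: inner)
  finally show ?thesis unfolding h_def .
qed

text \<open>A du Bois-Reymond lemma with test functions of the squared radius. Since
  \<open>\<psi>\<close> need not vanish at 0, the derivative of a test function is not constrained
  to have mean zero. Hence the defect \<open>W\<close> between \<open>P\<close> and the primitive of
  \<open>Q\<close> is zero and not merely constant.\<close>

lemma weak_derivative_imp_integral:
  fixes P Q :: "real \<Rightarrow> real"
  assumes P: "continuous_on {0..<1} P" "P 0 = 0" and Q: "continuous_on {0..<1} Q"
    and weak: "\<And>\<psi> \<psi>' b. radial_test \<psi> \<psi>' b \<Longrightarrow>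
        (LBINT \<rho>:{0..1}. \<psi> (\<rho>\<^sup>2) * Q \<rho> + \<psi>' (\<rho>\<^sup>2) * (2 * \<rho> * P \<rho>)) = 0"
    and r: "0 \<le> r" "r < 1"
  shows "P r = integral {0..r} Q"
proof (cases "r = 0")
  case True
  then show ?thesis using P(2) by simp
next
  case False
  \<comment> \<open>Taking \<open>c\<close> strictly beyond \<open>r\<close> makes the factor
    \<open>c\<^sup>2 - r\<^sup>2\<close> positive at the end, where \<open>W r = 0\<close> is read
    off.\<close>
  define c where "c = (r + 1) / 2"
  have c: "0 < c" "r < c" "c < 1" using r False by (simp_all add: c_def)
  have sub: "{0..c} \<subseteq> {0..<1}" using c by auto
  have Pc: "continuous_on {0..c} P" and Qc: "continuous_on {0..c} Q"
    using continuous_on_subset[OF P(1) sub] continuous_on_subset[OF Q sub] by auto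
  define J where "J = (\<lambda>\<rho>. integral {0..\<rho>} Q)"
  have J: "continuous_on {0..c} J"
    unfolding J_def by (intro indefinite_integral_continuous_1 integrable_continuous_interval Qc)
  have dJ: "(J has_real_derivative Q \<rho>) (at \<rho> within {0..c})" if "\<rho> \<in> {0..c}" for \<rho>
    unfolding J_def using Qc that by (rule integral_has_real_derivative)
  define W where "W = (\<lambda>\<rho>. P \<rho> - J \<rho>)"
  have W: "continuous_on {0..c} W" unfolding W_def by (intro continuous_on_diff Pc J)
  \<comment> \<open>Tested against a primitive of \<open>k\<close>, the hypothesis reads \<open>\<integral> 2\<rho> W(\<rho>)\<^sup>2 (c\<^sup>2 - \<rho>\<^sup>2) d\<rho> = 0\<close>, so \<open>W\<close>
    vanishes. The inner \<open>min\<close> and \<open>abs\<close> only extend \<open>k\<close> continuously to the whole line.\<close>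
  define k where "k = (\<lambda>s. W (min (sqrt \<bar>s\<bar>) c) * max 0 (c\<^sup>2 - s))"
  have k: "continuous_on UNIV k"
  proof -
    have m: "continuous_on UNIV (\<lambda>s. min (sqrt \<bar>s\<bar>) c)"
      by (intro continuous_on_min continuous_on_real_sqrt continuous_on_rabs continuous_on_id continuous_on_const)
    have "continuous_on UNIV (\<lambda>s. W (min (sqrt \<bar>s\<bar>) c))"
      by (rule continuous_on_compose2[OF W m]) (use c in auto)
    then show ?thesis unfolding k_def
      by (intro continuous_on_mult continuous_on_max continuous_on_diff continuous_on_id continuous_on_const)
  qed
  \<comment> \<open>Normalized to vanish at \<open>c\<^sup>2\<close>, hence from there on, since
    \<open>k\<close> does. The base point lies to the left of -1 so that the derivatives on the open
    interval from -1 to 1 are two-sided.\<close>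
  define \<psi> where "\<psi> = (\<lambda>s. integral {-2..s} k - integral {-2..c\<^sup>2} k)"
  have dk: "(\<psi> has_real_derivative k s) (at s)" if "-2 < s" "s < 2" for s
  proof -
    have "((\<lambda>s. integral {-2..s} k) has_real_derivative k s) (at s within {-2..2})"
      using that by (intro integral_has_real_derivative continuous_on_subset[OF k]) auto
    then have "((\<lambda>s. integral {-2..s} k) has_real_derivative k s) (at s)"
      using that at_within_interior[of s "{-2..2}"] by simp
    then show ?thesis unfolding \<psi>_def by (auto intro!: derivative_eq_intros)
  qed
  have c2: "0 < c\<^sup>2" "c\<^sup>2 < 1" using c by (simp_all add: abs_square_less_1)
  have k0: "k s = 0" if "c\<^sup>2 \<le> s" for s using that by (simp add: k_def)
  have \<psi>0: "\<psi> s = 0" if "c\<^sup>2 \<le> s" "s \<le> 1" for s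
  proof -
    have "-2 \<le> c\<^sup>2" "c\<^sup>2 \<le> s" using c2 that by linarith+
    then have "integral {-2..c\<^sup>2} k + integral {c\<^sup>2..s} k = integral {-2..s} k"
      by (intro Henstock_Kurzweil_Integration.integral_combine integrable_continuous_interval continuous_on_subset[OF k] subset_UNIV)
    moreover have "integral {c\<^sup>2..s} k = 0"
      using k0 by (subst Henstock_Kurzweil_Integration.integral_cong[of _ _ "\<lambda>_. 0"]) auto
    ultimately show ?thesis by (simp add: \<psi>_def)
  qed
  have T: "radial_test \<psi> k (c\<^sup>2)"
    unfolding radial_test_def using c2 dk k0 \<psi>0 continuous_on_subset[OF k] by auto
  have sq: "continuous_on {0..c} (\<lambda>\<rho>. \<rho>\<^sup>2)" by (intro continuous_on_power continuous_on_id)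
  have \<psi>c: "continuous_on {0..c} (\<lambda>\<rho>. \<psi> (\<rho>\<^sup>2))"
  proof (rule continuous_on_compose2[OF _ sq])
    show "continuous_on {-1<..<1} \<psi>"
      using radial_test_isCont(1)[OF T] by (intro continuous_at_imp_continuous_on) auto
    have "-1 < \<rho>\<^sup>2" for \<rho> :: real using zero_le_power2[of \<rho>] by linarith
    then show "(\<lambda>\<rho>. \<rho>\<^sup>2) ` {0..c} \<subseteq> {-1<..<1}"
      using c by (auto simp: abs_square_less_1)
  qed
  have kc: "continuous_on {0..c} (\<lambda>\<rho>. k (\<rho>\<^sup>2))"
    by (rule continuous_on_compose2[OF k sq]) simp
  define G where "G = (\<lambda>\<rho>. \<psi> (\<rho>\<^sup>2) * Q \<rho> + k (\<rho>\<^sup>2) * (2 * \<rho> * P \<rho>))"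
  have G: "continuous_on {0..c} G"
    unfolding G_def by (intro continuous_on_add continuous_on_mult continuous_on_const continuous_on_id \<psi>c kc Qc Pc)
  have "0 = (LBINT \<rho>:{0..1}. G \<rho>)" using weak[OF T] by (simp add: G_def)
  also have "\<dots> = (LBINT \<rho>:{0..c}. G \<rho>)"
  proof -
    have "G \<rho> = 0" if "c < \<rho>" "\<rho> \<le> 1" for \<rho>
    proof -
      have "c\<^sup>2 \<le> \<rho>\<^sup>2" "\<rho>\<^sup>2 \<le> 1" using that c by (auto simp: abs_square_le_1 intro!: power_mono)
      then show ?thesis using k0 \<psi>0 by (simp add: G_def)
    qed
    then have "indicator {0..1} \<rho> *\<^sub>R G \<rho> = indicator {0..c} \<rho> *\<^sub>R G \<rho>" for \<rho>
      using c by (auto simp: indicator_def)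
    then show ?thesis unfolding set_lebesgue_integral_def by (simp only:)
  qed
  also have "\<dots> = integral {0..c} G"
    by (rule set_borel_integral_eq_integral(2)[OF borel_integrable_atLeastAtMost'[OF G]])
  finally have G0: "integral {0..c} G = 0" by simp
  \<comment> \<open>\<open>J\<close> satisfies the weak equation too, since the boundary terms
    vanish by \<open>J 0 = 0\<close> and \<open>\<psi> (c\<^sup>2) = 0\<close>. Subtracting the two
    equations eliminates \<open>Q\<close> and replaces \<open>P\<close> by \<open>W\<close>.\<close>
  have D: "((\<lambda>\<rho>. \<psi> (\<rho>\<^sup>2) * J \<rho>) has_vector_derivative (\<psi> (\<rho>\<^sup>2) * Q \<rho> + k (\<rho>\<^sup>2) * (2 * \<rho> * J \<rho>))) (at \<rho> within {0..c})"
    if \<rho>: "\<rho> \<in> {0..c}" for \<rho>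
  proof -
    have "\<rho>\<^sup>2 < 1" using \<rho> c by (simp add: abs_square_less_1)
    then have "((\<lambda>\<rho>. \<psi> (\<rho>\<^sup>2)) has_real_derivative k (\<rho>\<^sup>2) * (2 * \<rho>)) (at \<rho>)"
      by (intro DERIV_chain2[OF dk])
         (auto intro!: derivative_eq_intros intro: order_less_le_trans[OF _ zero_le_power2])
    from DERIV_mult[OF DERIV_subset[OF this subset_UNIV] dJ[OF \<rho>]]
    show ?thesis
      unfolding has_real_derivative_iff_has_vector_derivative[symmetric] by (simp add: algebra_simps)
  qed
  have "((\<lambda>\<rho>. \<psi> (\<rho>\<^sup>2) * Q \<rho> + k (\<rho>\<^sup>2) * (2 * \<rho> * J \<rho>)) has_integral \<psi> (c\<^sup>2) * J c - \<psi> (0\<^sup>2) * J 0) {0..c}"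
    by (rule fundamental_theorem_of_calculus) (use c D in auto)
  moreover have "\<psi> (c\<^sup>2) * J c - \<psi> (0\<^sup>2) * J 0 = 0" by (simp add: \<psi>_def J_def)
  moreover have "(G has_integral 0) {0..c}"
    using G0 integrable_integral[OF integrable_continuous_interval[OF G]] by simp
  ultimately have diff0: "((\<lambda>\<rho>. G \<rho> - (\<psi> (\<rho>\<^sup>2) * Q \<rho> + k (\<rho>\<^sup>2) * (2 * \<rho> * J \<rho>))) has_integral 0 - 0) {0..c}"
    by (intro has_integral_diff) simp_all
  have diff: "G \<rho> - (\<psi> (\<rho>\<^sup>2) * Q \<rho> + k (\<rho>\<^sup>2) * (2 * \<rho> * J \<rho>)) = 2 * \<rho> * ((W \<rho>)\<^sup>2 * (c\<^sup>2 - \<rho>\<^sup>2))"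
    if "\<rho> \<in> {0..c}" for \<rho>
  proof -
    have "\<rho>\<^sup>2 \<le> c\<^sup>2" using that by (intro power_mono) auto
    then have "k (\<rho>\<^sup>2) = W \<rho> * (c\<^sup>2 - \<rho>\<^sup>2)" using that by (simp add: k_def)
    moreover have "G \<rho> - (\<psi> (\<rho>\<^sup>2) * Q \<rho> + k (\<rho>\<^sup>2) * (2 * \<rho> * J \<rho>)) = 2 * \<rho> * (k (\<rho>\<^sup>2) * W \<rho>)"
      by (simp add: G_def W_def algebra_simps)
    ultimately show ?thesis by (simp add: power2_eq_square ac_simps)
  qed
  have I0: "((\<lambda>\<rho>. 2 * \<rho> * ((W \<rho>)\<^sup>2 * (c\<^sup>2 - \<rho>\<^sup>2))) has_integral 0) {0..c}"
    using has_integral_cong[THEN iffD1, OF diff diff0] by simp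
  have "\<forall>\<rho>\<in>{0..c}. 2 * \<rho> * ((W \<rho>)\<^sup>2 * (c\<^sup>2 - \<rho>\<^sup>2)) = 0"
  proof (subst integral_eq_0_iff[symmetric])
    show "continuous_on {0..c} (\<lambda>\<rho>. 2 * \<rho> * ((W \<rho>)\<^sup>2 * (c\<^sup>2 - \<rho>\<^sup>2)))"
      by (intro continuous_on_mult continuous_on_const continuous_on_id continuous_on_diff continuous_on_power W)
    show "0 < c" by fact
    show "integral {0..c} (\<lambda>\<rho>. 2 * \<rho> * ((W \<rho>)\<^sup>2 * (c\<^sup>2 - \<rho>\<^sup>2))) = 0" using I0 by (rule integral_unique)
    fix \<rho> assume "\<rho> \<in> {0..c}"
    then show "0 \<le> 2 * \<rho> * ((W \<rho>)\<^sup>2 * (c\<^sup>2 - \<rho>\<^sup>2))"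
      by (intro mult_nonneg_nonneg) (auto intro!: power_mono)
  qed
  from bspec[OF this, of r] have "2 * r * ((W r)\<^sup>2 * (c\<^sup>2 - r\<^sup>2)) = 0" using r c by simp
  moreover have "r\<^sup>2 < c\<^sup>2" using r c by (intro power_strict_mono) auto
  ultimately have "W r = 0" using False by simp
  then show ?thesis by (simp add: W_def J_def)
qed

section \<open>Differential equations for spherical means\<close>

lemma continuous_on_sum_Rn:
  fixes F :: "nat \<Rightarrow> (nat \<Rightarrow> real) \<Rightarrow> real"
  shows "(\<And>i. i < n \<Longrightarrow> continuous_on S (F i)) \<Longrightarrow> continuous_on S (\<lambda>x. \<Sum>i<n. F i x)"
  by (intro continuous_on_sum) auto

lemma power_minus_one_eq: "n \<ge> 2 \<Longrightarrow> x ^ (n - 1) = x * x ^ (n - 2)" for x :: real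
  by (simp add: Suc_diff_le numeral_2_eq_2 Suc_diff_Suc flip: power_Suc)

text \<open>The divergence theorem on concentric balls, divided by the area of the unit sphere: the
  outer normal at radius \<open>r\<close> is \<open>x / r\<close>, which explains the exponent
  \<open>n - 2\<close>. It is obtained weakly by summing the coordinatewise integrations by parts;
  the factor \<rho> split off from \<open>\<rho> ^ (n - 1)\<close> is the one that the chain rule
  for the squared radius provides.\<close>

lemma sphere_avg_divergence:
  fixes V DV :: "nat \<Rightarrow> (nat \<Rightarrow> real) \<Rightarrow> real"
  assumes n: "n \<ge> 2"
    and V: "\<And>i. i < n \<Longrightarrow> continuous_on (unit_ball n) (V i)"
    and DV: "\<And>i. i < n \<Longrightarrow> continuous_on (unit_ball n) (DV i)"
    and d: "\<And>i x. i < n \<Longrightarrow> x \<in> unit_ball n \<Longrightarrow> ((\<lambda>t. V i (x(i := t))) has_real_derivative DV i x) (at (x i))"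
    and r: "0 \<le> r" "r < 1"
  shows "r ^ (n - 2) * sphere_avg n (\<lambda>x. \<Sum>i<n. x i * V i x) r
    = integral {0..r} (\<lambda>\<rho>. \<rho> ^ (n - 1) * sphere_avg n (\<lambda>x. \<Sum>i<n. DV i x) \<rho>)"
proof (rule weak_derivative_imp_integral[OF _ _ _ _ r])
  have n1: "n \<ge> 1" using n by simp
  define xV where "xV = (\<lambda>x. \<Sum>i<n. x i * V i x)"
  define dV where "dV = (\<lambda>x. \<Sum>i<n. DV i x)"
  have cV: "continuous_on (unit_ball n) xV" and cD: "continuous_on (unit_ball n) dV"
    unfolding xV_def dV_def
    by (intro continuous_on_sum_Rn continuous_on_mult continuous_on_component V DV; simp)+
  show "continuous_on {0..<1} (\<lambda>\<rho>. \<rho> ^ (n - 2) * sphere_avg n (\<lambda>x. \<Sum>i<n. x i * V i x) \<rho>)"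
    using sphere_avg_continuous[OF cV] unfolding xV_def
    by (intro continuous_on_mult continuous_on_power continuous_on_id)
  show "continuous_on {0..<1} (\<lambda>\<rho>. \<rho> ^ (n - 1) * sphere_avg n (\<lambda>x. \<Sum>i<n. DV i x) \<rho>)"
    using sphere_avg_continuous[OF cD] unfolding dV_def
    by (intro continuous_on_mult continuous_on_power continuous_on_id)
  show "0 ^ (n - 2) * sphere_avg n (\<lambda>x. \<Sum>i<n. x i * V i x) 0 = 0"
    by (simp add: sphere_avg_origin[OF n1] origin_def)
  fix \<psi> \<psi>' b assume T: "radial_test \<psi> \<psi>' b"
  define h where "h = (\<lambda>i x. indicator (unit_ball n) x * (\<psi> ((norm_n n x)\<^sup>2) * DV i x + \<psi>' ((norm_n n x)\<^sup>2) * (2 * x i * V i x)))"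
  have h0: "(\<integral>x. h i x \<partial>lborel_n n) = 0" and hi: "integrable (lborel_n n) (h i)" if i: "i < n" for i
  proof -
    show "(\<integral>x. h i x \<partial>lborel_n n) = 0" unfolding h_def
      by (rule ball_integral_by_parts[OF T i V[OF i] DV[OF i] d[OF i]])
    show "integrable (lborel_n n) (h i)" unfolding h_def
      by (rule test_integrand(2)[OF T DV[OF i]])
         (intro continuous_on_mult continuous_on_const continuous_on_component V i)
  qed
  have s: "(\<Sum>i<n. h i x) = indicator (unit_ball n) x * (\<psi> ((norm_n n x)\<^sup>2) * dV x + \<psi>' ((norm_n n x)\<^sup>2) * (2 * xV x))" for x
    unfolding h_def dV_def xV_def sum_distrib_left sum.distrib[symmetric]
    by (intro sum.cong refl) (simp add: algebra_simps)
  have "0 = (\<Sum>i<n. \<integral>x. h i x \<partial>lborel_n n)" by (simp add: h0)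
  also have "\<dots> = (\<integral>x. (\<Sum>i<n. h i x) \<partial>lborel_n n)"
    by (rule Bochner_Integration.integral_sum[symmetric]) (simp add: hi)
  also have "\<dots> = measure (lborel_n n) (unit_ball n) * (LBINT \<rho>:{0..1}. real n * \<rho> ^ (n - 1) *
        (\<psi> (\<rho>\<^sup>2) * sphere_avg n dV \<rho> + \<psi>' (\<rho>\<^sup>2) * sphere_avg n (\<lambda>x. 2 * xV x) \<rho>))"
    unfolding s by (rule test_integral_polar[OF n1 T cD]) (intro continuous_on_mult continuous_on_const cV)
  finally have I: "(LBINT \<rho>:{0..1}. real n * \<rho> ^ (n - 1) *
        (\<psi> (\<rho>\<^sup>2) * sphere_avg n dV \<rho> + \<psi>' (\<rho>\<^sup>2) * sphere_avg n (\<lambda>x. 2 * xV x) \<rho>)) = 0"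
    using measure_unit_ball_pos[of n] by simp
  have eq: "real n * \<rho> ^ (n - 1) * (\<psi> (\<rho>\<^sup>2) * sphere_avg n dV \<rho> + \<psi>' (\<rho>\<^sup>2) * sphere_avg n (\<lambda>x. 2 * xV x) \<rho>)
    = real n * (\<psi> (\<rho>\<^sup>2) * (\<rho> ^ (n - 1) * sphere_avg n dV \<rho>) + \<psi>' (\<rho>\<^sup>2) * (2 * \<rho> * (\<rho> ^ (n - 2) * sphere_avg n xV \<rho>)))" for \<rho>
    unfolding sphere_avg_cmult power_minus_one_eq[OF n] by (simp add: algebra_simps)
  show "(LBINT \<rho>:{0..1}. \<psi> (\<rho>\<^sup>2) * (\<rho> ^ (n - 1) * sphere_avg n (\<lambda>x. \<Sum>i<n. DV i x) \<rho>) +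
       \<psi>' (\<rho>\<^sup>2) * (2 * \<rho> * (\<rho> ^ (n - 2) * sphere_avg n (\<lambda>x. \<Sum>i<n. x i * V i x) \<rho>))) = 0"
    using I[unfolded eq set_integral_mult_right] n unfolding xV_def dV_def by simp
qed

text \<open>The divergence identity is used for two fields. The gradient gives the second equation.
  The field \<open>x u(x)\<close> has flux \<open>r ^ n U(r)\<close> and divergence
  \<open>n u + x . grad u\<close>, which gives the first without differentiating under the
  integral.\<close>

lemma sphere_avg_ode:
  fixes u :: "(nat \<Rightarrow> real) \<Rightarrow> real" and u1 u2 :: "nat \<Rightarrow> (nat \<Rightarrow> real) \<Rightarrow> real"
  assumes n: "n \<ge> 2"
    and u: "continuous_on (unit_ball n) u"
    and u1: "\<And>i. i < n \<Longrightarrow> continuous_on (unit_ball n) (u1 i)"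
    and u2: "\<And>i. i < n \<Longrightarrow> continuous_on (unit_ball n) (u2 i)"
    and d1: "\<And>i x. i < n \<Longrightarrow> x \<in> unit_ball n \<Longrightarrow> ((\<lambda>t. u (x(i := t))) has_real_derivative u1 i x) (at (x i))"
    and d2: "\<And>i x. i < n \<Longrightarrow> x \<in> unit_ball n \<Longrightarrow> ((\<lambda>t. u1 i (x(i := t))) has_real_derivative u2 i x) (at (x i))"
  defines "E \<equiv> sphere_avg n (\<lambda>x. \<Sum>i<n. x i * u1 i x)" and "L \<equiv> sphere_avg n (\<lambda>x. \<Sum>i<n. u2 i x)"
  assumes r: "0 < r" "r < 1"
  shows "(sphere_avg n u has_real_derivative E r / r) (at r)"
    and "((\<lambda>r. r ^ (n - 2) * E r) has_real_derivative r ^ (n - 1) * L r) (at r)"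
proof -
  have nn: "n = Suc (Suc (n - 2))" "n - 1 = Suc (n - 2)" using n by simp_all
  define U where "U = sphere_avg n u"
  have ftc: "(P has_real_derivative Q r) (at r)"
    \<comment> \<open>An integral identity on the whole of \<open>{0..<1}\<close> with continuous
      integrand is differentiated at the interior point \<open>r\<close>.\<close>
    if Q: "continuous_on {0..<1} Q" and P: "\<And>s. 0 \<le> s \<Longrightarrow> s < 1 \<Longrightarrow> P s = integral {0..s} Q" for P Q :: "real \<Rightarrow> real"
  proof -
    define c where "c = (r + 1) / 2"
    have c: "r < c" "c < 1" using r by (simp_all add: c_def)
    have "((\<lambda>s. integral {0..s} Q) has_real_derivative Q r) (at r within {0..c})"
      using r c by (intro integral_has_real_derivative continuous_on_subset[OF Q]) auto
    then have "((\<lambda>s. integral {0..s} Q) has_real_derivative Q r) (at r)"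
      using r c at_within_interior[of r "{0..c}"] by simp
    moreover have "\<forall>\<^sub>F s in nhds r. P s = integral {0..s} Q"
    proof -
      have "\<forall>\<^sub>F s in nhds r. s \<in> {0<..<1}" using r by (intro eventually_nhds_in_open) auto
      then show ?thesis by eventually_elim (simp add: P)
    qed
    ultimately show ?thesis by (simp add: DERIV_cong_ev[OF refl _ refl])
  qed
  have cE: "continuous_on (unit_ball n) (\<lambda>x. \<Sum>i<n. x i * u1 i x)"
    and cL: "continuous_on (unit_ball n) (\<lambda>x. \<Sum>i<n. u2 i x)"
    by (intro continuous_on_sum_Rn continuous_on_mult continuous_on_component u1 u2; simp)+
  have c: "continuous_on {0..<1} E" "continuous_on {0..<1} L" "continuous_on {0..<1} U"
    unfolding E_def L_def U_def by (intro sphere_avg_continuous cE cL u)+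
  show "((\<lambda>r. r ^ (n - 2) * E r) has_real_derivative r ^ (n - 1) * L r) (at r)"
  proof (rule ftc)
    show "continuous_on {0..<1} (\<lambda>\<rho>. \<rho> ^ (n - 1) * L \<rho>)"
      by (intro continuous_on_mult continuous_on_power continuous_on_id c)
    show "s ^ (n - 2) * E s = integral {0..s} (\<lambda>\<rho>. \<rho> ^ (n - 1) * L \<rho>)" if "0 \<le> s" "s < 1" for s
      unfolding E_def L_def by (rule sphere_avg_divergence[OF n u1 u2 d2 that])
  qed
  have "((\<lambda>r. r ^ n * U r) has_real_derivative r ^ (n - 1) * (real n * U r + E r)) (at r)"
  proof (rule ftc)
    show "continuous_on {0..<1} (\<lambda>\<rho>. \<rho> ^ (n - 1) * (real n * U \<rho> + E \<rho>))"
      by (intro continuous_on_mult continuous_on_add continuous_on_const continuous_on_power continuous_on_id c)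
    show "s ^ n * U s = integral {0..s} (\<lambda>\<rho>. \<rho> ^ (n - 1) * (real n * U \<rho> + E \<rho>))" if s: "0 \<le> s" "s < 1" for s
    proof -
      have "s ^ (n - 2) * sphere_avg n (\<lambda>x. \<Sum>i<n. x i * (x i * u x)) s
        = integral {0..s} (\<lambda>\<rho>. \<rho> ^ (n - 1) * sphere_avg n (\<lambda>x. \<Sum>i<n. u x + x i * u1 i x) \<rho>)"
      proof (rule sphere_avg_divergence[OF n _ _ _ s])
        fix i x assume ix: "i < n" "x \<in> unit_ball n"
        have "((\<lambda>t. t * u (x(i := t))) has_real_derivative 1 * u (x(i := x i)) + u1 i x * x i) (at (x i))"
          by (rule DERIV_mult[OF DERIV_ident d1[OF ix]])
        then show "((\<lambda>t. (x(i := t)) i * u (x(i := t))) has_real_derivative u x + x i * u1 i x) (at (x i))"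
          by (simp add: mult.commute)
      qed (intro continuous_on_add continuous_on_mult continuous_on_component u u1; simp)+
      also have "sphere_avg n (\<lambda>x. \<Sum>i<n. x i * (x i * u x)) s = sphere_avg n (\<lambda>x. s\<^sup>2 * u x) s"
      proof (rule sphere_avg_cong[OF s])
        fix x assume "norm_n n x = s"
        then have "s\<^sup>2 = (\<Sum>i<n. x i * x i)" using norm_n_sq[of n x] by (simp add: power2_eq_square)
        then show "(\<Sum>i<n. x i * (x i * u x)) = s\<^sup>2 * u x"
          by (simp add: sum_distrib_right mult.assoc)
      qed
      also have "\<dots> = s\<^sup>2 * U s" unfolding U_def by (rule sphere_avg_cmult)
      also have "s ^ (n - 2) * (s\<^sup>2 * U s) = s ^ n * U s"
        using nn(1) by (metis (no_types) mult.assoc power_add add_2_eq_Suc')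
      also have "integral {0..s} (\<lambda>\<rho>. \<rho> ^ (n - 1) * sphere_avg n (\<lambda>x. \<Sum>i<n. u x + x i * u1 i x) \<rho>)
        = integral {0..s} (\<lambda>\<rho>. \<rho> ^ (n - 1) * (real n * U \<rho> + E \<rho>))"
      proof (rule Henstock_Kurzweil_Integration.integral_cong)
        fix \<rho> assume "\<rho> \<in> {0..s}"
        then have \<rho>: "0 \<le> \<rho>" "\<rho> < 1" using s by auto
        have "sphere_avg n (\<lambda>x. \<Sum>i<n. u x + x i * u1 i x) \<rho>
          = sphere_avg n (\<lambda>x. real n * u x + (\<Sum>i<n. x i * u1 i x)) \<rho>"
          by (simp add: sum.distrib)
        also have "\<dots> = real n * U \<rho> + E \<rho>"
          unfolding U_def E_def sphere_avg_cmult[symmetric]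
          by (rule sphere_avg_add[OF _ cE \<rho>]) (intro continuous_on_mult continuous_on_const u)
        finally show "\<rho> ^ (n - 1) * sphere_avg n (\<lambda>x. \<Sum>i<n. u x + x i * u1 i x) \<rho> = \<rho> ^ (n - 1) * (real n * U \<rho> + E \<rho>)"
          by simp
      qed
      finally show ?thesis .
    qed
  qed
  \<comment> \<open>Multiplying by this factor isolates \<open>U\<close>: the contribution of
    \<open>real n * U r\<close> cancels and only \<open>E r / r\<close> remains.\<close>
  moreover have "((\<lambda>r. 1 / r ^ n) has_real_derivative - (real n * r ^ (n - 1)) / (r ^ n * r ^ n)) (at r)"
    using r by (auto intro!: derivative_eq_intros simp: divide_simps)
  ultimately have "((\<lambda>r. 1 / r ^ n * (r ^ n * U r)) has_real_derivative
      - (real n * r ^ (n - 1)) / (r ^ n * r ^ n) * (r ^ n * U r) + r ^ (n - 1) * (real n * U r + E r) * (1 / r ^ n)) (at r)"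
    by (intro DERIV_mult)
  moreover have "- (real n * r ^ (n - 1)) / (r ^ n * r ^ n) * (r ^ n * U r) + r ^ (n - 1) * (real n * U r + E r) * (1 / r ^ n) = E r / r"
  proof -
    have "r ^ n = r * r ^ (n - 1)" using n by (metis power_eq_if not_numeral_le_zero)
    then show ?thesis using r by (simp add: field_simps)
  qed
  moreover have "\<forall>\<^sub>F s in nhds r. sphere_avg n u s = 1 / s ^ n * (s ^ n * U s)"
  proof -
    have "\<forall>\<^sub>F s in nhds r. s \<in> {0<..}" using r by (intro eventually_nhds_in_open) auto
    then show ?thesis by eventually_elim (simp add: U_def)
  qed
  ultimately show "(sphere_avg n u has_real_derivative E r / r) (at r)"
    by (simp add: DERIV_cong_ev[OF refl _ refl])
qed

section \<open>The hyperbolic Green kernel\<close>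

text \<open>The derivative of a radial solution of the hyperbolic Laplace equation away from the
  origin: it solves \<open>(1 - s\<^sup>2) * (w' + (n - 1) / s * w) + 2 * (n - 2) * s * w =
  0\<close>.\<close>

definition green_weight :: "nat \<Rightarrow> real \<Rightarrow> real" where
  "green_weight n s = (1 - s\<^sup>2) ^ (n - 2) / s ^ (n - 1)"

text \<open>The value of \<open>green_kernel n r \<rho>\<close> is \<open>n \<rho>\<^bsup>n-1\<^esup> g\<^sub>n(\<rho>,r)\<close>.\<close>

definition green_kernel :: "nat \<Rightarrow> real \<Rightarrow> real \<Rightarrow> real" where
  "green_kernel n r \<rho> = \<rho> ^ (n - 1) * integral {\<rho>..r} (green_weight n)"

lemma green_weight_nonneg: "0 \<le> s \<Longrightarrow> s \<le> 1 \<Longrightarrow> 0 \<le> green_weight n s"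
  by (simp add: green_weight_def abs_square_le_1)

lemma continuous_on_green_weight: "a > 0 \<Longrightarrow> continuous_on {a..b} (green_weight n)"
  unfolding green_weight_def by (intro continuous_intros) auto

lemma green_weight_integrable: "a > 0 \<Longrightarrow> green_weight n integrable_on {a..b}"
  by (intro integrable_continuous_interval continuous_on_green_weight)

lemma integral_green_weight_nonneg: "0 < a \<Longrightarrow> b < 1 \<Longrightarrow> 0 \<le> integral {a..b} (green_weight n)"
  by (intro integral_nonneg green_weight_integrable green_weight_nonneg) auto

lemma green_kernel_0:
  assumes "n \<ge> 2"
  shows "green_kernel n r 0 = 0"
proof -
  have "(0::real) ^ (n - 1) = 0" using assms by (intro zero_power) simp
  then show ?thesis unfolding green_kernel_def by (simp only: mult_zero_left)
qed

lemma green_kernel_nonneg: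
  assumes "n \<ge> 2" "0 \<le> \<rho>" "r < 1"
  shows "0 \<le> green_kernel n r \<rho>"
proof (cases "\<rho> = 0")
  case False
  then show ?thesis using assms
    by (auto simp: green_kernel_def intro!: mult_nonneg_nonneg integral_green_weight_nonneg)
qed (use assms in \<open>simp add: green_kernel_0\<close>)

lemma green_kernel_mono:
  assumes "n \<ge> 2" "0 \<le> \<rho>" "\<rho> \<le> r" "r \<le> r'" "r' < 1"
  shows "green_kernel n r \<rho> \<le> green_kernel n r' \<rho>"
proof (cases "\<rho> = 0")
  case False
  then have "integral {\<rho>..r} (green_weight n) \<le> integral {\<rho>..r'} (green_weight n)"
    using assms by (intro integral_subset_le green_weight_integrable ballI green_weight_nonneg) auto
  then show ?thesis unfolding green_kernel_def using assms by (intro mult_left_mono) auto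
qed (use assms in \<open>simp add: green_kernel_0\<close>)

text \<open>This gives continuity of the kernel at 0. On the range of integration
  \<open>\<rho> / s\<close> is at most 1, so its power \<open>n - 1\<close> is at most its square
  root. The square root, unlike \<open>\<rho> / s\<close> itself, yields no logarithm when
  integrated, so one bound covers \<open>n = 2\<close> too.\<close>

lemma green_kernel_le_sqrt:
  assumes n: "n \<ge> 2" and \<rho>: "0 \<le> \<rho>" "\<rho> \<le> r" and r: "r < 1"
  shows "green_kernel n r \<rho> \<le> 2 * sqrt \<rho>"
proof (cases "\<rho> = 0")
  case False
  then have p: "\<rho> > 0" using \<rho> by simp
  have "((\<lambda>s. sqrt \<rho> * (1 / sqrt s)) has_integral sqrt \<rho> * (2 * sqrt r - 2 * sqrt \<rho>)) {\<rho>..r}"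
  proof (intro has_integral_mult_right fundamental_theorem_of_calculus \<rho>)
    fix s assume "s \<in> {\<rho>..r}"
    then have "s > 0" using p by simp
    then have "((\<lambda>s. 2 * sqrt s) has_real_derivative 1 / sqrt s) (at s)"
      by (auto intro!: derivative_eq_intros simp: field_simps)
    then show "((\<lambda>s. 2 * sqrt s) has_vector_derivative 1 / sqrt s) (at s within {\<rho>..r})"
      by (simp add: has_real_derivative_iff_has_vector_derivative has_vector_derivative_at_within)
  qed
  moreover have "((\<lambda>s. \<rho> ^ (n - 1) * green_weight n s) has_integral green_kernel n r \<rho>) {\<rho>..r}"
    unfolding green_kernel_def by (intro has_integral_mult_right integrable_integral green_weight_integrable p)
  moreover have "\<rho> ^ (n - 1) * green_weight n s \<le> sqrt \<rho> * (1 / sqrt s)" if "s \<in> {\<rho>..r}" for s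
  proof -
    have s: "0 < s" "\<rho> \<le> s" "s < 1" using that p r by auto
    define t where "t = \<rho> / s"
    have t: "0 < t" "t \<le> 1" using s p by (simp_all add: t_def)
    have "(1 - s\<^sup>2) ^ (n - 2) \<le> 1" using s by (intro power_le_one) (auto simp: abs_square_le_1)
    then have "\<rho> ^ (n - 1) * green_weight n s \<le> t ^ (n - 1)"
      unfolding green_weight_def t_def using p s by (simp add: power_divide divide_simps)
    also have "\<dots> \<le> t ^ 1" using t n by (intro power_decreasing) auto
    also have "t ^ 1 \<le> sqrt t" using t by (simp add: real_le_rsqrt power2_eq_square mult_left_le)
    finally show ?thesis by (simp add: t_def real_sqrt_divide)
  qed
  ultimately have "green_kernel n r \<rho> \<le> sqrt \<rho> * (2 * sqrt r - 2 * sqrt \<rho>)"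
    using has_integral_le by blast
  also have "\<dots> \<le> sqrt \<rho> * 2"
  proof (rule mult_left_mono)
    have "sqrt r \<le> 1" using r by simp
    then show "2 * sqrt r - 2 * sqrt \<rho> \<le> 2" using p by (smt (verit) real_sqrt_ge_zero)
  qed (use p in simp)
  finally show ?thesis by simp
qed (use n in \<open>simp add: green_kernel_0\<close>)

text \<open>The origin of \<open>2 ^ (n - 2) / (n - 1)\<close>. From
  \<open>1 + s \<le> 2 * (1 + \<rho>)\<close> one gets
  \<open>1 - s\<^sup>2 \<le> 2 * (1 + \<rho>) * (1 - s)\<close>, and the integral of
  \<open>(1 - s) ^ (n - 2)\<close> contributes
  \<open>(1 - \<rho>) ^ (n - 1) / (n - 1)\<close>.\<close>

lemma green_kernel_le:
  assumes n: "n \<ge> 2" and \<rho>: "0 \<le> \<rho>" "\<rho> \<le> r" and r: "r < 1"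
  shows "green_kernel n r \<rho> \<le> 2 ^ (n - 2) * (1 - \<rho>\<^sup>2) ^ (n - 2) * (1 - \<rho>) / (real n - 1)"
proof (cases "\<rho> = 0")
  case True
  then show ?thesis using n by (simp add: green_kernel_0)
next
  case False
  then have p: "\<rho> > 0" using \<rho> by simp
  \<comment> \<open>This is \<open>(2 * (1 + \<rho>)) ^ (n - 2)\<close>, written so that the power
    of \<open>1 - \<rho>\<^sup>2\<close> appears that will cancel against the hyperbolic volume
    density.\<close>
  define c where "c = 2 ^ (n - 2) * (1 - \<rho>\<^sup>2) ^ (n - 2) / (1 - \<rho>) ^ (n - 2)"
  have n1: "real n - 1 > 0" "real (n - 1) = real n - 1" "n - 1 - 1 = n - 2" "n - 1 = Suc (n - 2)" using n by auto
  have \<rho>1: "\<rho> < 1" using \<rho> r by simp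
  have "((\<lambda>s. c * (1 - s) ^ (n - 2)) has_integral c * (- ((1 - r) ^ (n - 1) / (real n - 1)) - - ((1 - \<rho>) ^ (n - 1) / (real n - 1)))) {\<rho>..r}"
  proof (intro has_integral_mult_right fundamental_theorem_of_calculus \<rho>)
    fix s :: real
    have "((\<lambda>s. (1 - s) ^ (n - 1)) has_real_derivative real (n - 1) * (-1 * (1 - s) ^ (n - 1 - Suc 0))) (at s)"
      by (rule DERIV_power) (auto intro!: derivative_eq_intros)
    from DERIV_minus[OF DERIV_cdivide[OF this, of "real n - 1"]]
    have "((\<lambda>s. - ((1 - s) ^ (n - 1) / (real n - 1))) has_real_derivative
        - (real (n - 1) * (-1 * (1 - s) ^ (n - 1 - Suc 0)) / (real n - 1))) (at s)" .
    also have "- (real (n - 1) * (-1 * (1 - s) ^ (n - 1 - Suc 0)) / (real n - 1)) = (1 - s) ^ (n - 2)"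
      unfolding n1(2) using n1(1,3) by simp
    finally have "((\<lambda>s. - ((1 - s) ^ (n - 1) / (real n - 1))) has_real_derivative (1 - s) ^ (n - 2)) (at s)" .
    then show "((\<lambda>s. - ((1 - s) ^ (n - 1) / (real n - 1))) has_vector_derivative (1 - s) ^ (n - 2)) (at s within {\<rho>..r})"
      by (simp add: has_real_derivative_iff_has_vector_derivative has_vector_derivative_at_within)
  qed
  moreover have "((\<lambda>s. \<rho> ^ (n - 1) * green_weight n s) has_integral green_kernel n r \<rho>) {\<rho>..r}"
    unfolding green_kernel_def by (intro has_integral_mult_right integrable_integral green_weight_integrable p)
  moreover have "\<rho> ^ (n - 1) * green_weight n s \<le> c * (1 - s) ^ (n - 2)" if "s \<in> {\<rho>..r}" for s
  proof -
    have s: "0 < s" "\<rho> \<le> s" "s < 1" using that p r by auto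
    have s2: "0 \<le> 1 - s\<^sup>2" using s by (simp add: abs_square_le_1)
    have "\<rho> ^ (n - 1) / s ^ (n - 1) \<le> 1" using s p by (simp add: power_mono)
    then have "\<rho> ^ (n - 1) / s ^ (n - 1) * (1 - s\<^sup>2) ^ (n - 2) \<le> 1 * (1 - s\<^sup>2) ^ (n - 2)"
      using s2 by (intro mult_right_mono) auto
    then have "\<rho> ^ (n - 1) * green_weight n s \<le> (1 - s\<^sup>2) ^ (n - 2)"
      by (simp add: green_weight_def)
    also have "\<dots> \<le> (2 * (1 - \<rho>\<^sup>2) / (1 - \<rho>) * (1 - s)) ^ (n - 2)"
    proof (rule power_mono[OF _ s2])
      have "2 * (1 - \<rho>\<^sup>2) / (1 - \<rho>) = 2 * (1 + \<rho>)" using \<rho>1 by (simp add: field_simps power2_eq_square)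
      moreover have "(1 + s) * (1 - s) \<le> (2 * (1 + \<rho>)) * (1 - s)"
        using s p by (intro mult_right_mono) auto
      ultimately show "1 - s\<^sup>2 \<le> 2 * (1 - \<rho>\<^sup>2) / (1 - \<rho>) * (1 - s)"
        by (simp add: algebra_simps power2_eq_square)
    qed
    also have "\<dots> = c * (1 - s) ^ (n - 2)"
      by (simp only: c_def power_mult_distrib power_divide)
    finally show ?thesis .
  qed
  ultimately have "green_kernel n r \<rho> \<le> c * (- ((1 - r) ^ (n - 1) / (real n - 1)) - - ((1 - \<rho>) ^ (n - 1) / (real n - 1)))"
    using has_integral_le by blast
  also have "\<dots> \<le> c * ((1 - \<rho>) ^ (n - 1) / (real n - 1))"
  proof (rule mult_left_mono)
    have "0 \<le> (1 - r) ^ (n - 1) / (real n - 1)" using r n1 by simp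
    then show "- ((1 - r) ^ (n - 1) / (real n - 1)) - - ((1 - \<rho>) ^ (n - 1) / (real n - 1)) \<le> (1 - \<rho>) ^ (n - 1) / (real n - 1)"
      by simp
    show "0 \<le> c" using \<rho>1 p by (simp add: c_def abs_square_le_1)
  qed
  also have "\<dots> = 2 ^ (n - 2) * (1 - \<rho>\<^sup>2) ^ (n - 2) * (1 - \<rho>) / (real n - 1)"
    using \<rho>1 n1 by (simp add: c_def)
  finally show ?thesis .
qed

text \<open>Meant for products whose one factor diverges at 0, so that the value there is a
  convention and continuity must come from a majorant.\<close>

lemma continuous_on_squeeze_0:
  fixes f g :: "real \<Rightarrow> real"
  assumes f: "continuous_on {0<..r} f" "f 0 = 0" and g: "continuous_on {0..r} g" "g 0 = 0"
    and b: "\<And>x. 0 < x \<Longrightarrow> x \<le> r \<Longrightarrow> \<bar>f x\<bar> \<le> g x"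
  shows "continuous_on {0..r} f"
  unfolding continuous_on_eq_continuous_within
proof
  fix x assume x: "x \<in> {0..r}"
  show "continuous (at x within {0..r}) f"
  proof (cases "x = 0")
    case True
    have "(g \<longlongrightarrow> 0) (at 0 within {0..r})"
      using g x True unfolding continuous_on_def by metis
    moreover have "\<forall>\<^sub>F y in at 0 within {0..r}. norm (f y) \<le> g y"
      using b by (auto simp: eventually_at_filter intro!: always_eventually)
    ultimately have "(f \<longlongrightarrow> 0) (at 0 within {0..r})" by (rule Lim_null_comparison[rotated])
    then show ?thesis using True f by (simp add: continuous_within)
  next
    case False
    then have "at x within {0..r} = at x within {0<..r}"
      using x by (intro at_within_nhd[of x "{0<..}"]) auto
    moreover have "continuous (at x within {0<..r}) f"
      using f(1) x False by (auto simp: continuous_on_eq_continuous_within)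
    ultimately show ?thesis by simp
  qed
qed

lemma continuous_on_integral_green_weight:
  "continuous_on {0<..r} (\<lambda>\<rho>. integral {\<rho>..r} (green_weight n))"
  unfolding continuous_on_eq_continuous_within
proof
  fix x assume x: "x \<in> {0<..r}"
  \<comment> \<open>Continuity is local, so each point may be treated on an interval that stays away
    from the singularity at 0.\<close>
  have "continuous_on {x/2..r} (\<lambda>\<rho>. integral {\<rho>..r} (green_weight n))"
    using x by (intro indefinite_integral_continuous_1' green_weight_integrable) auto
  then have "continuous (at x within {x/2..r}) (\<lambda>\<rho>. integral {\<rho>..r} (green_weight n))"
    using x by (auto simp: continuous_on_eq_continuous_within)
  moreover have "at x within {x/2..r} = at x within {0<..r}"
    using x by (intro at_within_nhd[of x "{x/2<..}"]) auto
  ultimately show "continuous (at x within {0<..r}) (\<lambda>\<rho>. integral {\<rho>..r} (green_weight n))" by simp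
qed

lemma continuous_on_green_kernel:
  assumes n: "n \<ge> 2" and r: "r < 1"
  shows "continuous_on {0..r} (green_kernel n r)"
proof (rule continuous_on_squeeze_0[where g="\<lambda>\<rho>. 2 * sqrt \<rho>"])
  show "continuous_on {0<..r} (green_kernel n r)"
    unfolding green_kernel_def
    by (intro continuous_on_mult continuous_on_power continuous_on_id continuous_on_integral_green_weight)
  show "green_kernel n r 0 = 0" using n by (simp add: green_kernel_0)
  show "continuous_on {0..r} (\<lambda>\<rho>. 2 * sqrt \<rho>)" by (intro continuous_intros)
  show "\<bar>green_kernel n r x\<bar> \<le> 2 * sqrt x" if "0 < x" "x \<le> r" for x
    using that green_kernel_nonneg[OF n _ r, of x] green_kernel_le_sqrt[OF n _ that(2) r] by simp
qed simp

lemma one_minus_sq_pos: "0 \<le> \<rho> \<Longrightarrow> \<rho> < 1 \<Longrightarrow> 0 < 1 - \<rho>\<^sup>2" for \<rho> :: real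
  by (simp add: abs_square_less_1)

lemma continuous_on_div_one_minus_sq:
  fixes F :: "real \<Rightarrow> real"
  assumes "continuous_on S F" "S \<subseteq> {0..<1}"
  shows "continuous_on S (\<lambda>\<rho>. F \<rho> / (1 - \<rho>\<^sup>2) ^ m)"
proof (intro continuous_on_divide assms(1) continuous_on_power continuous_on_diff continuous_on_const continuous_on_id ballI)
  fix \<rho> assume "\<rho> \<in> S"
  then have "0 < 1 - \<rho>\<^sup>2" using assms(2) by (intro one_minus_sq_pos) auto
  then show "(1 - \<rho>\<^sup>2) ^ m \<noteq> 0" by simp
qed

text \<open>In radial form the hyperbolic Laplacian has an integrating factor: with \<open>q\<close>
  below, \<open>q'\<close> is \<open>\<rho> ^ (n - 1) * A \<rho> / (1 - \<rho>\<^sup>2) ^ n\<close>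
  and the derivative of \<open>U\<close> is \<open>green_weight n \<rho> * q \<rho>\<close>.
  Exchanging the two integrations produces the Green kernel; here this is done by differentiating
  \<open>U + q * G\<close>.\<close>

lemma sphere_avg_green:
  fixes u :: "(nat \<Rightarrow> real) \<Rightarrow> real" and u1 u2 :: "nat \<Rightarrow> (nat \<Rightarrow> real) \<Rightarrow> real"
  assumes n: "n \<ge> 2"
    and u: "continuous_on (unit_ball n) u"
    and u1: "\<And>i. i < n \<Longrightarrow> continuous_on (unit_ball n) (u1 i)"
    and u2: "\<And>i. i < n \<Longrightarrow> continuous_on (unit_ball n) (u2 i)"
    and d1: "\<And>i x. i < n \<Longrightarrow> x \<in> unit_ball n \<Longrightarrow> ((\<lambda>t. u (x(i := t))) has_real_derivative u1 i x) (at (x i))"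
    and d2: "\<And>i x. i < n \<Longrightarrow> x \<in> unit_ball n \<Longrightarrow> ((\<lambda>t. u1 i (x(i := t))) has_real_derivative u2 i x) (at (x i))"
  defines "A \<equiv> sphere_avg n (\<lambda>x. (1 - (norm_n n x)\<^sup>2) *
      ((1 - (norm_n n x)\<^sup>2) * (\<Sum>i<n. u2 i x) + 2 * (real n - 2) * (\<Sum>i<n. x i * u1 i x)))"
  assumes r: "0 \<le> r" "r < 1"
  shows "((\<lambda>\<rho>. green_kernel n r \<rho> * A \<rho> / (1 - \<rho>\<^sup>2) ^ n) has_integral sphere_avg n u r - u (origin n)) {0..r}"
proof -
  have n1: "n \<ge> 1" using n by simp
  define E where "E = sphere_avg n (\<lambda>x. \<Sum>i<n. x i * u1 i x)"
  define L where "L = sphere_avg n (\<lambda>x. \<Sum>i<n. u2 i x)"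
  define N where "N = sphere_avg n (\<lambda>x. \<Sum>i<n. \<bar>u1 i x\<bar>)"
  define U where "U = sphere_avg n u"
  define G where "G = (\<lambda>\<rho>. integral {\<rho>..r} (green_weight n))"
  define q where "q = (\<lambda>\<rho>. \<rho> ^ (n - 2) * E \<rho> / (1 - \<rho>\<^sup>2) ^ (n - 2))"
  have cE: "continuous_on (unit_ball n) (\<lambda>x. \<Sum>i<n. x i * u1 i x)"
    and cL: "continuous_on (unit_ball n) (\<lambda>x. \<Sum>i<n. u2 i x)"
    and cN: "continuous_on (unit_ball n) (\<lambda>x. \<Sum>i<n. \<bar>u1 i x\<bar>)"
    by (intro continuous_on_sum_Rn continuous_on_mult continuous_on_component continuous_on_rabs u1 u2; simp)+
  have c: "continuous_on {0..<1} E" "continuous_on {0..<1} L" "continuous_on {0..<1} U" "continuous_on {0..<1} N"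
    unfolding E_def L_def U_def N_def by (intro sphere_avg_continuous cE cL cN u)+
  have A: "A \<rho> = (1 - \<rho>\<^sup>2) * ((1 - \<rho>\<^sup>2) * L \<rho> + 2 * (real n - 2) * E \<rho>)" if \<rho>: "0 \<le> \<rho>" "\<rho> < 1" for \<rho>
  proof -
    have "A \<rho> = sphere_avg n (\<lambda>x. (1 - \<rho>\<^sup>2) *
      ((1 - \<rho>\<^sup>2) * (\<Sum>i<n. u2 i x) + 2 * (real n - 2) * (\<Sum>i<n. x i * u1 i x))) \<rho>"
      unfolding A_def by (rule sphere_avg_cong[OF \<rho>]) simp
    also have "\<dots> = (1 - \<rho>\<^sup>2) * sphere_avg n (\<lambda>x.
      (1 - \<rho>\<^sup>2) * (\<Sum>i<n. u2 i x) + 2 * (real n - 2) * (\<Sum>i<n. x i * u1 i x)) \<rho>"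
      by (rule sphere_avg_cmult)
    also have "sphere_avg n (\<lambda>x.
      (1 - \<rho>\<^sup>2) * (\<Sum>i<n. u2 i x) + 2 * (real n - 2) * (\<Sum>i<n. x i * u1 i x)) \<rho>
      = (1 - \<rho>\<^sup>2) * L \<rho> + 2 * (real n - 2) * E \<rho>"
      unfolding L_def E_def sphere_avg_cmult[symmetric]
      by (rule sphere_avg_add[OF _ _ \<rho>]; intro continuous_on_mult continuous_on_const cL cE)
    finally show ?thesis .
  qed
  have E0: "E 0 = 0" by (simp add: E_def sphere_avg_origin[OF n1] origin_def)
  \<comment> \<open>The radial derivative term carries an extra factor \<rho>. It raises
    \<open>\<rho> ^ (n - 2)\<close> in \<open>q\<close> to the power that tames the divergent
    \<open>G\<close>, namely the one in \<open>green_kernel\<close>.\<close>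
  have EN: "\<bar>E \<rho>\<bar> \<le> \<rho> * N \<rho>" if \<rho>: "0 \<le> \<rho>" "\<rho> < 1" for \<rho>
  proof -
    have b: "\<bar>\<Sum>i<n. x i * u1 i x\<bar> \<le> \<rho> * (\<Sum>i<n. \<bar>u1 i x\<bar>)" if "norm_n n x = \<rho>" for x
    proof -
      have "\<bar>\<Sum>i<n. x i * u1 i x\<bar> \<le> (\<Sum>i<n. \<bar>x i * u1 i x\<bar>)" by (rule sum_abs)
      also have "\<dots> \<le> (\<Sum>i<n. \<rho> * \<bar>u1 i x\<bar>)"
        unfolding abs_mult using abs_component_le_norm_n[of _ n x] that
        by (intro sum_mono mult_right_mono) auto
      finally show ?thesis by (simp add: sum_distrib_left)
    qed
    have "E \<rho> \<le> sphere_avg n (\<lambda>x. \<rho> * (\<Sum>i<n. \<bar>u1 i x\<bar>)) \<rho>"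
      unfolding E_def using b
      by (intro sphere_avg_mono cE continuous_on_mult continuous_on_const cN \<rho>) (auto simp: abs_le_iff)
    moreover have "sphere_avg n (\<lambda>x. (-\<rho>) * (\<Sum>i<n. \<bar>u1 i x\<bar>)) \<rho> \<le> E \<rho>"
      unfolding E_def using b
      by (intro sphere_avg_mono cE continuous_on_mult continuous_on_const cN \<rho>) (use b in \<open>fastforce simp: abs_le_iff\<close>)
    ultimately show ?thesis unfolding sphere_avg_cmult N_def by (simp add: abs_le_iff)
  qed
  have sub: "{0..r} \<subseteq> {0..<1}" "{0<..r} \<subseteq> {0..<1}" using r by auto
  have qG: "continuous_on {0..r} (\<lambda>\<rho>. q \<rho> * G \<rho>)"
  proof (rule continuous_on_squeeze_0[where g="\<lambda>\<rho>. green_kernel n r \<rho> * N \<rho> / (1 - \<rho>\<^sup>2) ^ (n - 2)"])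
    show "continuous_on {0<..r} (\<lambda>\<rho>. q \<rho> * G \<rho>)"
      unfolding q_def G_def
      by (intro continuous_on_mult continuous_on_integral_green_weight continuous_on_div_one_minus_sq sub
          continuous_on_power continuous_on_id continuous_on_subset[OF c(1)])
    show "continuous_on {0..r} (\<lambda>\<rho>. green_kernel n r \<rho> * N \<rho> / (1 - \<rho>\<^sup>2) ^ (n - 2))"
      by (intro continuous_on_mult continuous_on_div_one_minus_sq sub continuous_on_green_kernel n r
          continuous_on_subset[OF c(4)])
    show "q 0 * G 0 = 0" by (simp add: q_def E0)
    show "green_kernel n r 0 * N 0 / (1 - 0\<^sup>2) ^ (n - 2) = 0" using n by (simp add: green_kernel_0)
    fix \<rho> assume \<rho>: "0 < \<rho>" "\<rho> \<le> r"
    have p: "0 < 1 - \<rho>\<^sup>2" using \<rho> r by (intro one_minus_sq_pos) auto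
    have G0: "0 \<le> G \<rho>" unfolding G_def by (rule integral_green_weight_nonneg[OF \<rho>(1) r(2)])
    have "\<bar>q \<rho> * G \<rho>\<bar> = \<rho> ^ (n - 2) * \<bar>E \<rho>\<bar> * G \<rho> / (1 - \<rho>\<^sup>2) ^ (n - 2)"
      using \<rho> p G0 by (simp add: q_def abs_mult)
    also have "\<dots> \<le> \<rho> ^ (n - 2) * (\<rho> * N \<rho>) * G \<rho> / (1 - \<rho>\<^sup>2) ^ (n - 2)"
      using \<rho> p G0 r EN[of \<rho>] by (intro divide_right_mono mult_right_mono mult_left_mono) auto
    also have "\<dots> = green_kernel n r \<rho> * N \<rho> / (1 - \<rho>\<^sup>2) ^ (n - 2)"
      unfolding green_kernel_def G_def power_minus_one_eq[OF n] by simp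
    finally show "\<bar>q \<rho> * G \<rho>\<bar> \<le> green_kernel n r \<rho> * N \<rho> / (1 - \<rho>\<^sup>2) ^ (n - 2)" .
  qed
  \<comment> \<open>Since \<open>U' = q w\<close> for the weight \<open>w = -G'\<close>, the derivative of \<open>U + q G\<close> is \<open>q' G\<close>.\<close>
  have "((\<lambda>\<rho>. green_kernel n r \<rho> * A \<rho> / (1 - \<rho>\<^sup>2) ^ n) has_integral (U r + q r * G r) - (U 0 + q 0 * G 0)) {0..r}"
  proof (rule fundamental_theorem_of_calculus_interior[OF r(1)])
    show "continuous_on {0..r} (\<lambda>\<rho>. U \<rho> + q \<rho> * G \<rho>)"
      by (intro continuous_on_add qG continuous_on_subset[OF c(3) sub(1)])
    \<comment> \<open>The differential equations are available only at positive radii; at the end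
      points the fundamental theorem asks for no more than continuity.\<close>
    fix \<rho> assume "\<rho> \<in> {0<..<r}"
    then have \<rho>: "0 < \<rho>" "\<rho> < r" "\<rho> < 1" using r by auto
    have p: "0 < 1 - \<rho>\<^sup>2" using \<rho> by (intro one_minus_sq_pos) auto
    note ode = sphere_avg_ode[OF n u u1 u2 d1 d2 \<rho>(1,3), folded E_def L_def U_def]
    have "(G has_real_derivative - green_weight n \<rho>) (at \<rho> within {\<rho>/2..r})"
      unfolding G_def using \<rho> by (intro integral_has_real_derivative' continuous_on_green_weight) auto
    then have dG: "(G has_real_derivative - green_weight n \<rho>) (at \<rho>)"
      using \<rho> at_within_interior[of \<rho> "{\<rho>/2..r}"] by simp
    \<comment> \<open>For \<open>n = 2\<close> this factor is constant and the exponent after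
      differentiation would be truncated, hence the case distinction.\<close>
    have dw: "((\<lambda>\<rho>. 1 / (1 - \<rho>\<^sup>2) ^ (n - 2)) has_real_derivative 2 * (real n - 2) * \<rho> / (1 - \<rho>\<^sup>2) ^ (n - 1)) (at \<rho>)"
    proof (cases "n = 2")
      case False
      then have m: "n - 2 = Suc (n - 3)" "n - 1 = Suc (Suc (n - 3))" "real (n - 2) = real n - 2" using n by auto
      have "((\<lambda>\<rho>. 1 / (1 - \<rho>\<^sup>2) ^ (n - 2)) has_real_derivative
          (0 * (1 - \<rho>\<^sup>2) ^ (n - 2) - 1 * (real (n - 2) * (1 - \<rho>\<^sup>2) ^ (n - 2 - 1) * (0 - 2 * \<rho>))) / ((1 - \<rho>\<^sup>2) ^ (n - 2) * (1 - \<rho>\<^sup>2) ^ (n - 2))) (at \<rho>)"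
        using p by (auto intro!: derivative_eq_intros)
      also have "(0 * (1 - \<rho>\<^sup>2) ^ (n - 2) - 1 * (real (n - 2) * (1 - \<rho>\<^sup>2) ^ (n - 2 - 1) * (0 - 2 * \<rho>))) / ((1 - \<rho>\<^sup>2) ^ (n - 2) * (1 - \<rho>\<^sup>2) ^ (n - 2))
        = 2 * (real n - 2) * \<rho> / (1 - \<rho>\<^sup>2) ^ (n - 1)"
      proof -
        have "(0 * w ^ Suc k - 1 * (a * w ^ (Suc k - 1) * (0 - 2 * \<rho>))) / (w ^ Suc k * w ^ Suc k)
          = 2 * a * \<rho> / w ^ Suc (Suc k)" if "0 < w" for w a :: real and k
          using that by (simp add: divide_simps)
        from this[OF p] show ?thesis unfolding m(3) unfolding m(1,2) .
      qed
      finally show ?thesis .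
    qed simp
    have dq: "(q has_real_derivative \<rho> ^ (n - 1) * A \<rho> / (1 - \<rho>\<^sup>2) ^ n) (at \<rho>)"
    proof -
      have "((\<lambda>\<rho>. \<rho> ^ (n - 2) * E \<rho> * (1 / (1 - \<rho>\<^sup>2) ^ (n - 2))) has_real_derivative
        \<rho> ^ (n - 1) * L \<rho> * (1 / (1 - \<rho>\<^sup>2) ^ (n - 2)) + 2 * (real n - 2) * \<rho> / (1 - \<rho>\<^sup>2) ^ (n - 1) * (\<rho> ^ (n - 2) * E \<rho>)) (at \<rho>)"
        by (rule DERIV_mult[OF ode(2) dw])
      moreover have "\<rho> ^ (n - 1) * L \<rho> * (1 / (1 - \<rho>\<^sup>2) ^ (n - 2)) + 2 * (real n - 2) * \<rho> / (1 - \<rho>\<^sup>2) ^ (n - 1) * (\<rho> ^ (n - 2) * E \<rho>)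
         = \<rho> ^ (n - 1) * A \<rho> / (1 - \<rho>\<^sup>2) ^ n"
      proof -
        obtain m where m: "n = Suc (Suc m)" using n by (metis add_2_eq_Suc le_Suc_ex)
        have "x * P * l * (1 / w ^ m) + 2 * a * x / w ^ Suc m * (P * e) = x * P * (w * (w * l + 2 * a * e)) / w ^ Suc (Suc m)"
          if "0 < w" for w a x P l e :: real
          using that by (simp add: field_simps)
        from this[OF p, of \<rho> "\<rho> ^ m" "L \<rho>" "real n - 2" "E \<rho>"] show ?thesis
          using A[of \<rho>] \<rho> by (simp add: m)
      qed
      ultimately show ?thesis by (simp add: q_def)
    qed
    have "((\<lambda>\<rho>. U \<rho> + q \<rho> * G \<rho>) has_real_derivative
        E \<rho> / \<rho> + (\<rho> ^ (n - 1) * A \<rho> / (1 - \<rho>\<^sup>2) ^ n * G \<rho> + - green_weight n \<rho> * q \<rho>)) (at \<rho>)"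
      by (intro DERIV_add DERIV_mult ode(1) dq dG)
    moreover have "E \<rho> / \<rho> = green_weight n \<rho> * q \<rho>"
      unfolding green_weight_def q_def power_minus_one_eq[OF n] using \<rho> p by (simp add: field_simps)
    ultimately have "((\<lambda>\<rho>. U \<rho> + q \<rho> * G \<rho>) has_real_derivative green_kernel n r \<rho> * A \<rho> / (1 - \<rho>\<^sup>2) ^ n) (at \<rho>)"
      by (simp add: green_kernel_def G_def ac_simps)
    then show "((\<lambda>\<rho>. U \<rho> + q \<rho> * G \<rho>) has_vector_derivative green_kernel n r \<rho> * A \<rho> / (1 - \<rho>\<^sup>2) ^ n) (at \<rho>)"
      by (simp add: has_real_derivative_iff_has_vector_derivative)
  qed
  \<comment> \<open>The boundary terms drop out: at \<open>r\<close> through \<open>G\<close>, and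
    at 0 through \<open>q\<close>, whatever default value the divergent integral \<open>G 0\<close>
    has.\<close>
  moreover have "G r = 0" by (simp add: G_def)
  moreover have "q 0 = 0" by (simp add: q_def E0)
  moreover have "U 0 = u (origin n)" by (simp add: U_def sphere_avg_origin[OF n1])
  ultimately show ?thesis by (simp add: U_def)
qed

section \<open>Powers of the absolute value\<close>

text \<open>This is \<open>|t|\<^bsup>p-2\<^esup>\<close>; the case \<open>p = 2\<close> is singled out because of the junk value \<open>0 powr 0 = 0\<close>.\<close>

definition powr_weight :: "real \<Rightarrow> real \<Rightarrow> real" where
  "powr_weight p t = (if p = 2 then 1 else \<bar>t\<bar> powr (p - 2))"

lemma powr_weight_nonneg [simp]: "0 \<le> powr_weight p t"
  by (simp add: powr_weight_def)

lemma powr_weight_mult: "powr_weight p t * t = \<bar>t\<bar> powr (p - 2) * t"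
  by (cases "t = 0") (auto simp: powr_weight_def)

lemma powr_weight_mult_sq: "powr_weight p t * t\<^sup>2 = \<bar>t\<bar> powr p"
proof (cases "t = 0")
  case False
  then have "\<bar>t\<bar> powr (p - 2) * t\<^sup>2 = \<bar>t\<bar> powr p"
    using powr_add[of "\<bar>t\<bar>" "p - 2" 2] by simp
  then show ?thesis using False by (auto simp: powr_weight_def)
qed simp

lemma abs_powr_tendsto_0:
  assumes "a > (0::real)"
  shows "((\<lambda>t. \<bar>t\<bar> powr a) \<longlongrightarrow> 0) (at 0)"
proof -
  have "((\<lambda>t::real. \<bar>t\<bar>) \<longlongrightarrow> 0) (at 0)" by (intro tendsto_rabs_zero tendsto_ident_at)
  then show ?thesis by (rule tendsto_zero_powrI[OF _ tendsto_const]) (use assms in auto)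
qed

lemma DERIV_abs_powr_nonzero:
  assumes t: "t \<noteq> (0::real)"
  shows "((\<lambda>t. \<bar>t\<bar> powr a) has_real_derivative a * (\<bar>t\<bar> powr (a - 2) * t)) (at t)"
proof -
  have e: "\<bar>t\<bar> powr (a - 1) = \<bar>t\<bar> powr (a - 2) * \<bar>t\<bar>"
    using t powr_add[of "\<bar>t\<bar>" "a - 2" 1] by simp
  consider "t > 0" | "t < 0" using t by linarith
  then show ?thesis
  proof cases
    case 1
    have "((\<lambda>t. t powr a) has_real_derivative a * t powr (a - 1)) (at t)"
      using 1 by (rule has_real_derivative_powr)
    then have "((\<lambda>t. \<bar>t\<bar> powr a) has_real_derivative a * t powr (a - 1)) (at t)"
      by (rule has_field_derivative_transform_within_open[where S="{0<..}"]) (use 1 in auto)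
    then show ?thesis using 1 e by simp
  next
    case 2
    have "((\<lambda>t. (- t) powr a) has_real_derivative a * (- t) powr (a - 1) * (- 1)) (at t)"
      by (rule DERIV_chain2[OF has_real_derivative_powr]) (use 2 in \<open>auto intro!: derivative_eq_intros\<close>)
    then have "((\<lambda>t. \<bar>t\<bar> powr a) has_real_derivative a * (- t) powr (a - 1) * (- 1)) (at t)"
      by (rule has_field_derivative_transform_within_open[where S="{..<0}"]) (use 2 in auto)
    then show ?thesis using 2 e by simp
  qed
qed

text \<open>At 0 the difference quotient has modulus \<open>\<bar>h\<bar> powr (a - 1)\<close>,
  which tends to 0 exactly because \<open>a\<close> exceeds 1.\<close>

lemma DERIV_abs_powr:
  assumes a: "a > (1::real)"
  shows "((\<lambda>t. \<bar>t\<bar> powr a) has_real_derivative a * (\<bar>t\<bar> powr (a - 2) * t)) (at t)"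
proof (cases "t = 0")
  case True
  have "((\<lambda>h. (\<bar>0 + h\<bar> powr a - \<bar>0\<bar> powr a) / h) \<longlongrightarrow> 0) (at (0::real))"
  proof (rule Lim_null_comparison[OF _ abs_powr_tendsto_0])
    show "\<forall>\<^sub>F h in at (0::real). norm ((\<bar>0 + h\<bar> powr a - \<bar>0\<bar> powr a) / h) \<le> \<bar>h\<bar> powr (a - 1)"
      by (auto simp: eventually_at_filter powr_diff intro!: always_eventually)
    show "0 < a - 1" using a by simp
  qed
  then show ?thesis using True by (simp add: DERIV_def)
next
  case False
  then show ?thesis by (rule DERIV_abs_powr_nonzero)
qed

text \<open>With \<open>DERIV_abs_powr\<close> this gives \<open>|t|^p\<close> two derivatives for
  every \<open>p \<ge> 2\<close>, also at zeros. For \<open>p = 2\<close> the derivative at 0 is 1,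
  which is why \<open>powr_weight\<close> must be 1 there.\<close>

lemma DERIV_powr_weight_mult:
  assumes p: "p \<ge> (2::real)"
  shows "((\<lambda>t. powr_weight p t * t) has_real_derivative (p - 1) * powr_weight p t) (at t)"
proof (cases "p = 2")
  case True
  then show ?thesis by (simp add: powr_weight_def)
next
  case False
  then have a: "p - 2 > 0" using p by simp
  have w: "powr_weight p t = \<bar>t\<bar> powr (p - 2)" for t using False by (simp add: powr_weight_def)
  show ?thesis
  proof (cases "t = 0")
    case True
    have "((\<lambda>h. (powr_weight p (0 + h) * (0 + h) - powr_weight p 0 * 0) / h) \<longlongrightarrow> 0) (at (0::real))"
    proof (rule Lim_null_comparison[OF _ abs_powr_tendsto_0[OF a]])
      show "\<forall>\<^sub>F h in at (0::real). norm ((powr_weight p (0 + h) * (0 + h) - powr_weight p 0 * 0) / h) \<le> \<bar>h\<bar> powr (p - 2)"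
        by (auto simp: eventually_at_filter w intro!: always_eventually)
    qed
    then show ?thesis using True a by (simp add: DERIV_def w)
  next
    case False
    have e: "\<bar>t\<bar> powr (p - 2) = \<bar>t\<bar> powr (p - 2 - 2) * t * t"
      using False powr_add[of "\<bar>t\<bar>" "p - 2 - 2" 2] by (simp add: power2_eq_square mult.assoc)
    have "((\<lambda>t. \<bar>t\<bar> powr (p - 2)) has_real_derivative (p - 2) * (\<bar>t\<bar> powr (p - 2 - 2) * t)) (at t)"
      by (rule DERIV_abs_powr_nonzero[OF False])
    from DERIV_mult[OF this DERIV_ident]
    show ?thesis unfolding w by (rule DERIV_cong) (simp add: e algebra_simps)
  qed
qed

lemma continuous_on_powr_weight:
  fixes f :: "'a::topological_space \<Rightarrow> real"
  assumes "p \<ge> 2" "continuous_on S f"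
  shows "continuous_on S (\<lambda>x. powr_weight p (f x))"
proof (cases "p = 2")
  case False
  then show ?thesis unfolding powr_weight_def using assms
    by (simp, intro continuous_on_powr' continuous_on_rabs continuous_on_const) auto
qed (simp add: powr_weight_def)

text \<open>A pointwise substitute for Hoelder. If the mean of \<open>|t|^p\<close> is at most
  \<open>T\<close> and that of \<open>g^p\<close> at most \<open>m^p\<close>, averaging the bracket
  gives at most \<open>(1 - 2/p) + 2/p = 1\<close>, so the prefactor is exactly the Hoelder
  bound.\<close>

lemma powr_weight_Young:
  assumes p: "p \<ge> 2" and T: "T > 0" and m: "m > 0" and g: "g \<ge> 0"
  shows "powr_weight p t * g\<^sup>2 \<le> T powr (1 - 2 / p) * m\<^sup>2 *
    ((1 - 2 / p) / T * \<bar>t\<bar> powr p + 2 / p / m powr p * g powr p)"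
proof (cases "p = 2")
  case True
  then show ?thesis using assms by (simp add: powr_weight_def)
next
  case False
  then have p2: "p > 2" using p by simp
  have c: "0 \<le> T powr (1 - 2 / p) * m\<^sup>2" by simp
  have nn: "0 \<le> (1 - 2 / p) / T * \<bar>t\<bar> powr p + 2 / p / m powr p * g powr p"
    using T p2 by (intro add_nonneg_nonneg mult_nonneg_nonneg) auto
  show ?thesis
  proof (cases "t = 0 \<or> g = 0")
    case True
    then have "powr_weight p t * g\<^sup>2 = 0" using p2 by (auto simp: powr_weight_def)
    then show ?thesis using mult_nonneg_nonneg[OF c nn] by (simp only:)
  next
    case False
    then have tg: "\<bar>t\<bar> > 0" "g > 0" using g by auto
    \<comment> \<open>Weighted Young for the two normalized powers; the weights are the reciprocals
      of the conjugate exponents \<open>p/(p-2)\<close> and \<open>p/2\<close>.\<close>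
    have "(\<bar>t\<bar> powr p / T) powr (1 - 2 / p) * (g powr p / m powr p) powr (2 / p)
      \<le> (1 - 2 / p) * (\<bar>t\<bar> powr p / T) + 2 / p * (g powr p / m powr p)"
      using tg T m p2 by (intro Youngs_inequality_0) auto
    moreover have "(\<bar>t\<bar> powr p / T) powr (1 - 2 / p) = powr_weight p t / T powr (1 - 2 / p)"
    proof -
      have "p * (1 - 2 / p) = p - 2" using p2 by (simp add: field_simps)
      then show ?thesis using T p2 by (simp add: powr_divide powr_powr powr_weight_def)
    qed
    moreover have "(g powr p / m powr p) powr (2 / p) = g\<^sup>2 / m\<^sup>2"
      using tg m p2 by (simp add: powr_divide powr_powr)
    ultimately have "powr_weight p t * g\<^sup>2 / (T powr (1 - 2 / p) * m\<^sup>2)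
      \<le> (1 - 2 / p) / T * \<bar>t\<bar> powr p + 2 / p / m powr p * g powr p"
      by simp
    then show ?thesis using T m by (simp add: pos_divide_le_eq mult.commute)
  qed
qed

section \<open>Growth of the means\<close>

lemma has_partialD:
  assumes "has_partial i f x"
  shows "((\<lambda>t. f (x(i := t))) has_real_derivative partial i f x) (at (x i))"
  using assms unfolding has_partial_def partial_def by (simp add: DERIV_deriv_iff_real_differentiable)

lemma C2_onD:
  assumes "C2_on n U f"
  shows "continuous_on U f"
    "\<And>i. i < n \<Longrightarrow> continuous_on U (partial i f)"
    "\<And>i. i < n \<Longrightarrow> continuous_on U (partial i (partial i f))"
    "\<And>i x. i < n \<Longrightarrow> x \<in> U \<Longrightarrow> ((\<lambda>t. f (x(i := t))) has_real_derivative partial i f x) (at (x i))"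
    "\<And>i x. i < n \<Longrightarrow> x \<in> U \<Longrightarrow> ((\<lambda>t. partial i f (x(i := t))) has_real_derivative partial i (partial i f) x) (at (x i))"
  using assms by (auto simp: C2_on_def C1_on_def intro!: has_partialD)

lemma norm_n_grad_sq: "(norm_n n (grad n f x))\<^sup>2 = (\<Sum>i<n. (partial i f x)\<^sup>2)"
  unfolding norm_n_sq by (intro sum.cong) (auto simp: grad_def)

lemma inner_n_grad: "inner_n n (grad n f x) x = (\<Sum>i<n. x i * partial i f x)"
  unfolding inner_n_def by (intro sum.cong) (auto simp: grad_def mult.commute)

lemma continuous_on_norm_n_grad:
  assumes "C2_on n U f"
  shows "continuous_on U (\<lambda>x. norm_n n (grad n f x))"
proof -
  have "continuous_on U (\<lambda>x. sqrt (\<Sum>i<n. (partial i f x)\<^sup>2))"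
    using C2_onD(2)[OF assms]
    by (intro continuous_on_real_sqrt continuous_on_sum_Rn continuous_on_power)
  moreover have "sqrt (\<Sum>i<n. (partial i f x)\<^sup>2) = norm_n n (grad n f x)" for x
    by (simp flip: norm_n_grad_sq)
  ultimately show ?thesis by simp
qed

text \<open>The sums on the left are the chain-rule derivatives of \<open>|f|^p\<close>. Only the
  second derivatives create a squared gradient; the remaining terms, including the first-order part
  of the operator, reassemble into \<open>f x * hyp_laplacian n f x\<close>.\<close>

lemma hyp_laplacian_powr:
  fixes f :: "(nat \<Rightarrow> real) \<Rightarrow> real" and p :: real
  assumes "(1 - (norm_n n x)\<^sup>2) = w"
  defines "k \<equiv> powr_weight p (f x)"
  shows "w * (w * (\<Sum>i<n. p * ((p - 1) * k * partial i f x * partial i f x + k * f x * partial i (partial i f) x))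
      + 2 * (real n - 2) * (\<Sum>i<n. x i * (p * (k * f x) * partial i f x)))
    = p * (p - 1) * k * hyp_grad_norm_sq n f x + p * k * (f x * hyp_laplacian n f x)"
proof -
  have 1: "(\<Sum>i<n. p * ((p - 1) * k * partial i f x * partial i f x + k * f x * partial i (partial i f) x))
     = p * ((p - 1) * k * (\<Sum>i<n. (partial i f x)\<^sup>2) + k * f x * laplacian n f x)"
    unfolding laplacian_def sum_distrib_left sum.distrib[symmetric]
    by (intro sum.cong refl) (simp add: algebra_simps power2_eq_square)
  have 2: "(\<Sum>i<n. x i * (p * (k * f x) * partial i f x)) = p * (k * f x) * (\<Sum>i<n. x i * partial i f x)"
    by (simp add: sum_distrib_left algebra_simps)
  show ?thesis
    unfolding 1 2 hyp_grad_norm_sq_def hyp_laplacian_def inner_n_grad norm_n_grad_sq assms(1)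
    by (simp add: algebra_simps power2_eq_square)
qed

lemma majorant_le:
  assumes "majorant \<omega>" "t \<ge> 1"
  shows "\<omega> t \<le> t * \<omega> 1"
proof -
  have "antimono_on {0<..} (\<lambda>t. \<omega> t / t)" using assms by (simp add: majorant_def)
  then have "\<omega> t / t \<le> \<omega> 1 / 1" using assms(2) by (elim monotone_onD) auto
  then show ?thesis using assms(2) by (simp add: divide_simps mult.commute split: if_splits)
qed

lemma green_int_eq:
  "n \<ge> 1 \<Longrightarrow> real n * green_int n l2 r = integral {0..r} (\<lambda>\<rho>. green_kernel n r \<rho> * l2 \<rho> / (1 - \<rho>\<^sup>2) ^ n)"
  unfolding green_int_def integral_mult_right[symmetric]
  by (simp add: green_g_def green_kernel_def green_weight_def[abs_def])

section \<open>Estimates for a fixed function of the class\<close>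

context
  fixes n :: nat and p :: real and \<omega> l1 l2 :: "real \<Rightarrow> real" and f :: "(nat \<Rightarrow> real) \<Rightarrow> real" and C :: real
  assumes n: "n \<ge> 2" and p: "p \<ge> 2" and \<omega>: "majorant \<omega>" and C: "C > 0"
    and l1: "continuous_on {0..<1} l1" "\<And>\<rho>. 0 \<le> \<rho> \<Longrightarrow> \<rho> < 1 \<Longrightarrow> 0 \<le> l1 \<rho>"
    and l2: "continuous_on {0..<1} l2" "\<And>\<rho>. 0 \<le> \<rho> \<Longrightarrow> \<rho> < 1 \<Longrightarrow> 0 \<le> l2 \<rho>"
    and f: "f \<in> H_class n l1 l2"
    and M: "\<And>r. 0 \<le> r \<Longrightarrow> r < 1 \<Longrightarrow> Mp n p r (\<lambda>x. norm_n n (grad n f x)) \<le> C * \<omega> (1 / (1 - r))"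
begin

text \<open>By \<open>hyp_laplacian_powr\<close>, \<open>pow_lap\<close> is \<open>\<Delta>\<^sub>h(|f|\<^sup>p)\<close> on the unit ball.\<close>

definition pow_lap :: "(nat \<Rightarrow> real) \<Rightarrow> real" where
  "pow_lap x = p * (p - 1) * powr_weight p (f x) * hyp_grad_norm_sq n f x + p * powr_weight p (f x) * (f x * hyp_laplacian n f x)"

definition pow_mean :: "real \<Rightarrow> real" where
  "pow_mean = sphere_avg n (\<lambda>x. \<bar>f x\<bar> powr p)"

lemma C2_f: "C2_on n (unit_ball n) f"
  using f by (simp add: H_class_def)

text \<open>The lower inequality of the class enters here: it makes \<open>|f|^p\<close> subharmonic
  for the hyperbolic Laplacian.\<close>

lemma pow_lap_nonneg: "x \<in> unit_ball n \<Longrightarrow> 0 \<le> pow_lap x"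
  using f p unfolding pow_lap_def hyp_grad_norm_sq_def H_class_def
  by (auto intro!: add_nonneg_nonneg mult_nonneg_nonneg)

lemma continuous_on_pow: "continuous_on (unit_ball n) (\<lambda>x. \<bar>f x\<bar> powr p)"
  using p by (intro continuous_on_powr' continuous_on_rabs continuous_on_const C2_onD(1)[OF C2_f]) auto

lemma pow_mean_green:
  assumes r: "0 \<le> r" "r < 1"
  shows "((\<lambda>\<rho>. green_kernel n r \<rho> * sphere_avg n pow_lap \<rho> / (1 - \<rho>\<^sup>2) ^ n) has_integral
      pow_mean r - \<bar>f (origin n)\<bar> powr p) {0..r}"
    and "continuous_on (unit_ball n) pow_lap"
proof -
  let ?k = "\<lambda>x. powr_weight p (f x)"
  let ?u1 = "\<lambda>i x. p * (?k x * f x) * partial i f x"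
  let ?u2 = "\<lambda>i x. p * ((p - 1) * ?k x * partial i f x * partial i f x + ?k x * f x * partial i (partial i f) x)"
  note C2 = C2_onD[OF C2_f]
  have ck: "continuous_on (unit_ball n) ?k" by (rule continuous_on_powr_weight[OF p C2(1)])
  have cu1: "continuous_on (unit_ball n) (?u1 i)" if "i < n" for i
    by (intro continuous_on_mult continuous_on_const ck C2(1,2) that)
  have cu2: "continuous_on (unit_ball n) (?u2 i)" if "i < n" for i
    by (intro continuous_on_add continuous_on_mult continuous_on_const ck C2(1,2,3) that)
  have d1: "((\<lambda>t. \<bar>f (x(i := t))\<bar> powr p) has_real_derivative ?u1 i x) (at (x i))"
    if ix: "i < n" "x \<in> unit_ball n" for i x
  proof -
    have "((\<lambda>t. \<bar>f (x(i := t))\<bar> powr p) has_real_derivative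
        p * (\<bar>f (x(i := x i))\<bar> powr (p - 2) * f (x(i := x i))) * partial i f x) (at (x i))"
      by (rule DERIV_chain2[OF DERIV_abs_powr C2(4)[OF ix]]) (use p in simp)
    then show ?thesis by (simp add: powr_weight_mult)
  qed
  have d2: "((\<lambda>t. ?u1 i (x(i := t))) has_real_derivative ?u2 i x) (at (x i))"
    if ix: "i < n" "x \<in> unit_ball n" for i x
  proof -
    have "((\<lambda>t. powr_weight p (f (x(i := t))) * f (x(i := t))) has_real_derivative
        (p - 1) * powr_weight p (f (x(i := x i))) * partial i f x) (at (x i))"
      by (rule DERIV_chain2[OF DERIV_powr_weight_mult[OF p] C2(4)[OF ix]])
    from DERIV_cmult[OF DERIV_mult[OF this C2(5)[OF ix]], of p]
    show ?thesis by (simp add: algebra_simps)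
  qed
  have eq: "(1 - (norm_n n x)\<^sup>2) * ((1 - (norm_n n x)\<^sup>2) * (\<Sum>i<n. ?u2 i x) + 2 * (real n - 2) * (\<Sum>i<n. x i * ?u1 i x)) = pow_lap x" for x
    unfolding pow_lap_def by (rule hyp_laplacian_powr[OF refl])
  show "((\<lambda>\<rho>. green_kernel n r \<rho> * sphere_avg n pow_lap \<rho> / (1 - \<rho>\<^sup>2) ^ n) has_integral
      pow_mean r - \<bar>f (origin n)\<bar> powr p) {0..r}"
    unfolding pow_mean_def
    using sphere_avg_green[OF n continuous_on_pow cu1 cu2 d1 d2 r] unfolding eq .
  have "continuous_on (unit_ball n) (\<lambda>x. (1 - (norm_n n x)\<^sup>2) * ((1 - (norm_n n x)\<^sup>2) * (\<Sum>i<n. ?u2 i x) + 2 * (real n - 2) * (\<Sum>i<n. x i * ?u1 i x)))"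
    by (intro continuous_on_add continuous_on_mult continuous_on_diff continuous_on_power continuous_on_norm_n
        continuous_on_const continuous_on_sum_Rn continuous_on_component cu1 cu2)
  then show "continuous_on (unit_ball n) pow_lap" unfolding eq .
qed

lemma continuous_on_pow_lap: "continuous_on (unit_ball n) pow_lap"
  by (rule pow_mean_green(2)[of 0]) simp_all

lemma sphere_avg_pow_lap_nonneg:
  assumes r: "0 \<le> r" "r < 1"
  shows "0 \<le> sphere_avg n pow_lap r"
proof -
  have "sphere_avg n (\<lambda>_. 0) r \<le> sphere_avg n pow_lap r"
    using r pow_lap_nonneg by (intro sphere_avg_mono continuous_on_const continuous_on_pow_lap)
  then show ?thesis using n by simp
qed

lemma green_integrand_nonneg:
  assumes "0 \<le> \<rho>" "\<rho> \<le> r" "r < 1"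
  shows "0 \<le> green_kernel n r \<rho> * sphere_avg n pow_lap \<rho> / (1 - \<rho>\<^sup>2) ^ n"
  using assms one_minus_sq_pos[of \<rho>]
  by (intro divide_nonneg_nonneg mult_nonneg_nonneg green_kernel_nonneg n sphere_avg_pow_lap_nonneg) auto

lemma pow_mean_ge_origin:
  assumes r: "0 \<le> r" "r < 1"
  shows "\<bar>f (origin n)\<bar> powr p \<le> pow_mean r"
  using has_integral_nonneg[OF pow_mean_green(1)[OF r]] green_integrand_nonneg r by auto

text \<open>In the Green formula the integrand is nonnegative, and enlarging the outer radius
  enlarges both the kernel and the interval.\<close>

lemma pow_mean_mono:
  assumes s: "0 \<le> s" "s \<le> r" "r < 1"
  shows "pow_mean s \<le> pow_mean r"
proof -
  have s1: "s < 1" and r0: "0 \<le> r" using s by auto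
  let ?h = "\<lambda>r \<rho>. green_kernel n r \<rho> * sphere_avg n pow_lap \<rho> / (1 - \<rho>\<^sup>2) ^ n"
  note Is = pow_mean_green(1)[OF s(1) s1] and Ir = pow_mean_green(1)[OF r0 s(3)]
  have r_int: "?h r integrable_on {0..s}"
    by (rule integrable_on_subinterval[OF has_integral_integrable[OF Ir]]) (use s in auto)
  have "integral {0..s} (?h s) \<le> integral {0..s} (?h r)"
  proof (rule integral_le[OF has_integral_integrable[OF Is] r_int])
    fix \<rho> assume \<rho>: "\<rho> \<in> {0..s}"
    then have "0 < 1 - \<rho>\<^sup>2" using s1 by (intro one_minus_sq_pos) auto
    then show "?h s \<rho> \<le> ?h r \<rho>"
      using \<rho> s s1 by (intro divide_right_mono mult_right_mono green_kernel_mono n sphere_avg_pow_lap_nonneg) auto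
  qed
  also have "\<dots> \<le> integral {0..r} (?h r)"
    by (rule integral_subset_le[OF _ r_int has_integral_integrable[OF Ir]])
       (use s green_integrand_nonneg in auto)
  finally show ?thesis
    using integral_unique[OF Is] integral_unique[OF Ir] by simp
qed

text \<open>The upper inequality of the class enters here; the factor \<open>|f|^(p-2)\<close> turns
  its last term back into a multiple of \<open>|f|^p\<close>.\<close>

lemma pow_lap_le:
  assumes x: "x \<in> unit_ball n"
  shows "pow_lap x \<le> p * (p - 1 + l1 (norm_n n x)) * (1 - (norm_n n x)\<^sup>2)\<^sup>2
      * (powr_weight p (f x) * (norm_n n (grad n f x))\<^sup>2) + p * l2 (norm_n n x) * \<bar>f x\<bar> powr p"
proof -
  let ?k = "powr_weight p (f x)"
  have "f x * hyp_laplacian n f x \<le> l1 (norm_n n x) * hyp_grad_norm_sq n f x + l2 (norm_n n x) * \<bar>f x\<bar>\<^sup>2"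
    using f x by (simp add: H_class_def)
  then have "p * ?k * (f x * hyp_laplacian n f x) \<le> p * ?k * (l1 (norm_n n x) * hyp_grad_norm_sq n f x + l2 (norm_n n x) * \<bar>f x\<bar>\<^sup>2)"
    using p by (intro mult_left_mono) auto
  then have "pow_lap x \<le> p * (p - 1 + l1 (norm_n n x)) * (?k * hyp_grad_norm_sq n f x) + p * l2 (norm_n n x) * (?k * (f x)\<^sup>2)"
    unfolding pow_lap_def by (simp add: algebra_simps)
  then show ?thesis
    unfolding powr_weight_mult_sq hyp_grad_norm_sq_def by (simp add: ac_simps)
qed

text \<open>Hoelder on the sphere of radius \<rho>, carried out by averaging
  \<open>powr_weight_Young\<close> with \<open>T\<close> taken at the outer radius.\<close>

lemma sphere_avg_pow_lap_le:
  assumes r: "0 \<le> \<rho>" "\<rho> \<le> r" "r < 1" and T: "pow_mean r > 0"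
  defines "m \<equiv> C * \<omega> (1 / (1 - \<rho>))"
  shows "sphere_avg n pow_lap \<rho> \<le> p * (p - 1 + l1 \<rho>) * (1 - \<rho>\<^sup>2)\<^sup>2 * (pow_mean r powr (1 - 2 / p) * m\<^sup>2)
    + p * l2 \<rho> * pow_mean r"
proof -
  define c1 where "c1 = p * (p - 1 + l1 \<rho>) * (1 - \<rho>\<^sup>2)\<^sup>2"
  define c2 where "c2 = p * l2 \<rho>"
  define T where "T = pow_mean r"
  define S where "S = sphere_avg n (\<lambda>x. \<bar>norm_n n (grad n f x)\<bar> powr p) \<rho>"
  define U where "U = pow_mean \<rho>"
  have \<rho>: "0 \<le> \<rho>" "\<rho> < 1" using r by auto
  have c: "0 \<le> c1" "0 \<le> c2" using p l1(2)[OF \<rho>] l2(2)[OF \<rho>] by (simp_all add: c1_def c2_def)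
  have UT: "U \<le> T" unfolding U_def T_def by (rule pow_mean_mono[OF r])
  have T0: "T > 0" using T by (simp add: T_def)
  have cg: "continuous_on (unit_ball n) (\<lambda>x. \<bar>norm_n n (grad n f x)\<bar> powr p)"
    using p by (intro continuous_on_powr' continuous_on_rabs continuous_on_const continuous_on_norm_n_grad[OF C2_f]) auto
  have S0: "0 \<le> S"
  proof -
    have "sphere_avg n (\<lambda>_. 0) \<rho> \<le> S"
      unfolding S_def by (intro sphere_avg_mono continuous_on_const cg \<rho>) simp
    then show ?thesis using n by simp
  qed
  have m0: "0 \<le> m"
    using \<omega> C \<rho> by (simp add: m_def majorant_def)
  have SM: "S powr (1 / p) \<le> m"
    using M[OF \<rho>] unfolding Mp_def S_def sphere_avg_def m_def .
  \<comment> \<open>The gradient bound \<open>m\<close> can be 0 when the majorant vanishes, whereas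
    Young divides by it; so the estimate is first proved for positive \<open>m'\<close> above
    \<open>m\<close>.\<close>
  have main: "sphere_avg n pow_lap \<rho> \<le> c1 * (T powr (1 - 2 / p) * m'\<^sup>2) + c2 * T" if m': "0 < m'" "m \<le> m'" for m'
  proof -
    define B where "B = T powr (1 - 2 / p) * m'\<^sup>2"
    define a1 where "a1 = c1 * B * ((1 - 2 / p) / T) + c2"
    define a2 where "a2 = c1 * B * (2 / p / m' powr p)"
    have B: "0 \<le> B" by (simp add: B_def)
    have Sm: "S \<le> m' powr p"
    proof -
      have "S = (S powr (1 / p)) powr p" using p S0 by (simp add: powr_powr)
      also have "\<dots> \<le> m' powr p" using SM m' p by (intro powr_mono2) auto
      finally show ?thesis .
    qed
    have "sphere_avg n pow_lap \<rho> \<le> sphere_avg n (\<lambda>x. a1 * \<bar>f x\<bar> powr p + a2 * \<bar>norm_n n (grad n f x)\<bar> powr p) \<rho>"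
    proof (intro sphere_avg_mono continuous_on_pow_lap continuous_on_add continuous_on_mult continuous_on_const continuous_on_pow cg \<rho>)
      fix x assume x: "x \<in> unit_ball n" "norm_n n x = \<rho>"
      have "pow_lap x \<le> c1 * (powr_weight p (f x) * (norm_n n (grad n f x))\<^sup>2) + c2 * \<bar>f x\<bar> powr p"
        using pow_lap_le[OF x(1)] by (simp add: x(2) c1_def c2_def)
      also have "\<dots> \<le> c1 * (B * ((1 - 2 / p) / T * \<bar>f x\<bar> powr p + 2 / p / m' powr p * norm_n n (grad n f x) powr p)) + c2 * \<bar>f x\<bar> powr p"
        unfolding B_def by (intro add_right_mono mult_left_mono powr_weight_Young p T0 m' norm_n_nonneg c)
      also have "\<dots> = a1 * \<bar>f x\<bar> powr p + a2 * \<bar>norm_n n (grad n f x)\<bar> powr p"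
        by (simp add: a1_def a2_def algebra_simps)
      finally show "pow_lap x \<le> a1 * \<bar>f x\<bar> powr p + a2 * \<bar>norm_n n (grad n f x)\<bar> powr p" .
    qed
    also have "\<dots> = a1 * U + a2 * S"
      unfolding U_def S_def pow_mean_def sphere_avg_cmult[symmetric]
      by (intro sphere_avg_add continuous_on_mult continuous_on_const continuous_on_pow cg \<rho>)
    also have "\<dots> \<le> a1 * T + a2 * m' powr p"
    proof (intro add_mono mult_left_mono UT Sm)
      \<comment> \<open>Nonnegative coefficients are what allows the means \<open>U\<close> and
        \<open>S\<close> to be replaced by their upper bounds; for \<open>a1\<close> this rests on
        \<open>p \<ge> 2\<close>.\<close>
      have "0 \<le> 1 - 2 / p" using p by simp
      then show "0 \<le> a1" "0 \<le> a2" using c B T0 p by (auto simp: a1_def a2_def intro!: add_nonneg_nonneg mult_nonneg_nonneg)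
    qed
    also have "a1 * T = c1 * B * (1 - 2 / p) + c2 * T"
      using T0 by (simp add: a1_def distrib_right)
    also have "a2 * m' powr p = c1 * B * (2 / p)"
      using m' by (simp add: a2_def)
    also have "c1 * B * (1 - 2 / p) + c2 * T + c1 * B * (2 / p) = c1 * B + c2 * T"
      by (simp add: algebra_simps)
    finally show ?thesis unfolding B_def .
  qed
  \<comment> \<open>The right side is continuous in the gradient bound, so the excess
    \<open>e\<close> may tend to 0 from the right.\<close>
  have "sphere_avg n pow_lap \<rho> \<le> c1 * (T powr (1 - 2 / p) * m\<^sup>2) + c2 * T"
  proof (rule tendsto_lowerbound)
    show "((\<lambda>e. c1 * (T powr (1 - 2 / p) * (m + e)\<^sup>2) + c2 * T) \<longlongrightarrow> c1 * (T powr (1 - 2 / p) * m\<^sup>2) + c2 * T) (at_right 0)"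
      by (auto intro!: tendsto_eq_intros)
    show "\<forall>\<^sub>F e in at_right 0. sphere_avg n pow_lap \<rho> \<le> c1 * (T powr (1 - 2 / p) * (m + e)\<^sup>2) + c2 * T"
      using eventually_at_right_less[of "0::real"] by eventually_elim (use m0 main in auto)
  qed simp
  then show ?thesis by (simp add: c1_def c2_def T_def)
qed

text \<open>Inserting the spherical estimate into the Green formula gives an inequality in which
  \<open>U(r)\<close> occurs on both sides: linearly through \<open>l2\<close>, and with exponent
  \<open>1 - 2/p\<close> otherwise. Solving it leaves exponent \<open>2/p\<close>, the square of
  \<open>Mp\<close>.\<close>

lemma Mp_le:
  assumes gi: "\<And>r. 0 \<le> r \<Longrightarrow> r < 1 \<Longrightarrow> green_int n l2 r < 1 / (real n * p)"
    and r: "0 \<le> r" "r < 1"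
  shows "Mp n p r f \<le> 1 / sqrt (C_fun n p l2 r) *
      sqrt (\<bar>f (origin n)\<bar>\<^sup>2 + 2 ^ (n - 2) * p * C\<^sup>2 * \<omega> 1 / (real n - 1)
        * integral {0..r} (\<lambda>\<rho>. (p - 1 + l1 \<rho>) * \<omega> (1 / (1 - \<rho>))))"
proof -
  define T where "T = pow_mean r"
  define X where "X = 2 ^ (n - 2) * p * C\<^sup>2 * \<omega> 1 / (real n - 1)"
  define h where "h = (\<lambda>\<rho>. (p - 1 + l1 \<rho>) * \<omega> (1 / (1 - \<rho>)))"
  define R where "R = \<bar>f (origin n)\<bar>\<^sup>2 + X * integral {0..r} h"
  have Mp: "Mp n p r f = T powr (1 / p)"
    unfolding Mp_def T_def pow_mean_def sphere_avg_def ..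
  have sub: "{0..r} \<subseteq> {0..<1}" using r by auto
  have \<omega>0: "0 \<le> \<omega> t" if "0 \<le> t" for t using \<omega> that by (simp add: majorant_def)
  have n1: "real n - 1 > 0" using n by simp
  have Cf: "C_fun n p l2 r > 0"
    using gi[OF r] n p by (simp add: C_fun_def field_simps)
  have h: "continuous_on {0..r} h"
  proof -
    have "continuous_on {0..r} (\<lambda>\<rho>. \<omega> (1 / (1 - \<rho>)))"
    proof -
      have "continuous_on {0..} \<omega>" using \<omega> by (simp add: majorant_def)
      moreover have "continuous_on {0..r} (\<lambda>\<rho>. 1 / (1 - \<rho>))" using r by (intro continuous_intros) auto
      ultimately show ?thesis by (rule continuous_on_compose2) (use r in auto)
    qed
    then show ?thesis unfolding h_def
      by (intro continuous_on_mult continuous_on_add continuous_on_const continuous_on_subset[OF l1(1) sub])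
  qed
  have h0: "0 \<le> h \<rho>" if "\<rho> \<in> {0..r}" for \<rho>
    unfolding h_def using that r p by (intro mult_nonneg_nonneg add_nonneg_nonneg l1(2) \<omega>0) auto
  have X0: "0 \<le> X" unfolding X_def using n1 p \<omega>0[of 1] by (intro divide_nonneg_nonneg mult_nonneg_nonneg) auto
  have R0: "0 \<le> R" unfolding R_def
    using X0 h0 h by (intro add_nonneg_nonneg mult_nonneg_nonneg integral_nonneg integrable_continuous_interval) auto
  show ?thesis
  proof (cases "T > 0")
    \<comment> \<open>A vanishing mean cannot be divided by, but then the left side is 0 and the
      claim only needs a nonnegative right side.\<close>
    case False
    have "0 \<le> T" using pow_mean_ge_origin[OF r] powr_ge_zero[of "\<bar>f (origin n)\<bar>" p] unfolding T_def by linarith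
    then have "T = 0" using False by simp
    then have "Mp n p r f = 0" by (simp add: Mp)
    also have "0 \<le> 1 / sqrt (C_fun n p l2 r) * sqrt R" using Cf R0 by simp
    finally show ?thesis unfolding R_def X_def h_def .
  next
    case T0: True
    define g where "g = (\<lambda>\<rho>. green_kernel n r \<rho> * l2 \<rho> / (1 - \<rho>\<^sup>2) ^ n)"
    have g: "continuous_on {0..r} g" unfolding g_def
      by (intro continuous_on_div_one_minus_sq sub continuous_on_mult continuous_on_green_kernel n r continuous_on_subset[OF l2(1) sub])
    have bound: "green_kernel n r \<rho> * sphere_avg n pow_lap \<rho> / (1 - \<rho>\<^sup>2) ^ n
       \<le> T powr (1 - 2 / p) * (X * h \<rho>) + T * (p * g \<rho>)" if "\<rho> \<in> {0..r}" for \<rho>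
    proof -
      have \<rho>: "0 \<le> \<rho>" "\<rho> \<le> r" "\<rho> < 1" using that r by auto
      define w where "w = 1 - \<rho>\<^sup>2"
      define K where "K = green_kernel n r \<rho>"
      define v where "v = \<omega> (1 / (1 - \<rho>))"
      have w: "0 < w" unfolding w_def using \<rho> by (intro one_minus_sq_pos) auto
      have K0: "0 \<le> K" unfolding K_def by (rule green_kernel_nonneg[OF n \<rho>(1) r(2)])
      have v: "0 \<le> v" unfolding v_def using \<rho> by (intro \<omega>0) simp
      have l: "0 \<le> p - 1 + l1 \<rho>" using p l1(2)[OF \<rho>(1,3)] by simp
      \<comment> \<open>One of the two majorant factors is spent here against the factor
        \<open>1 - \<rho>\<close> of the kernel bound; the result is the constant
        \<open>\<omega> 1\<close> of the theorem.\<close>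
      have vw: "(1 - \<rho>) * v \<le> \<omega> 1"
        using majorant_le[OF \<omega>, of "1 / (1 - \<rho>)"] \<rho> by (simp add: v_def divide_simps mult.commute split: if_splits)
      have wn: "w ^ n = w\<^sup>2 * w ^ (n - 2)" using n by (metis le_add_diff_inverse power_add)
      have Kb: "K \<le> 2 ^ (n - 2) * w ^ (n - 2) * (1 - \<rho>) / (real n - 1)"
        unfolding K_def w_def by (rule green_kernel_le[OF n \<rho>(1,2) r(2)])
      \<comment> \<open>The squared factor from the hyperbolic gradient reduces the density to
        exponent \<open>n - 2\<close>, exactly the power contained in the kernel bound, so no
        singularity at the unit sphere is left over.\<close>
      have "K * w\<^sup>2 / w ^ n = K / w ^ (n - 2)" using w by (simp add: wn)
      also have "\<dots> \<le> (2 ^ (n - 2) * w ^ (n - 2) * (1 - \<rho>) / (real n - 1)) / w ^ (n - 2)"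
        using w Kb by (intro divide_right_mono) auto
      also have "\<dots> = 2 ^ (n - 2) * (1 - \<rho>) / (real n - 1)" using w by simp
      finally have "K * w\<^sup>2 / w ^ n * v \<le> 2 ^ (n - 2) * (1 - \<rho>) / (real n - 1) * v"
        using v by (intro mult_right_mono)
      also have "\<dots> = 2 ^ (n - 2) / (real n - 1) * ((1 - \<rho>) * v)" by simp
      also have "\<dots> \<le> 2 ^ (n - 2) / (real n - 1) * \<omega> 1"
        using vw n1 by (intro mult_left_mono) auto
      finally have key: "K * w\<^sup>2 / w ^ n * v \<le> 2 ^ (n - 2) / (real n - 1) * \<omega> 1" .
      have "K * sphere_avg n pow_lap \<rho> / w ^ n \<le> K * (p * (p - 1 + l1 \<rho>) * w\<^sup>2 * (T powr (1 - 2 / p) * (C * v)\<^sup>2) + p * l2 \<rho> * T) / w ^ n"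
        using sphere_avg_pow_lap_le[OF \<rho>(1,2) r(2)] T0 K0 w
        by (intro divide_right_mono mult_left_mono) (auto simp: T_def w_def v_def)
      also have "\<dots> = T powr (1 - 2 / p) * (p * (p - 1 + l1 \<rho>) * v * C\<^sup>2 * (K * w\<^sup>2 / w ^ n * v)) + T * (p * (K * l2 \<rho> / w ^ n))"
      proof -
        have "K * (p * a * w\<^sup>2 * (t * (C * v)\<^sup>2) + p * b * T) / W = t * (p * a * v * C\<^sup>2 * (K * w\<^sup>2 / W * v)) + T * (p * (K * b / W))"
          for a b t W :: real
          by (simp add: power2_eq_square add_divide_distrib distrib_left ac_simps)
        then show ?thesis .
      qed
      also have "\<dots> \<le> T powr (1 - 2 / p) * (p * (p - 1 + l1 \<rho>) * v * C\<^sup>2 * (2 ^ (n - 2) / (real n - 1) * \<omega> 1)) + T * (p * (K * l2 \<rho> / w ^ n))"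
        using p l v by (intro add_right_mono mult_left_mono key mult_nonneg_nonneg) auto
      also have "\<dots> = T powr (1 - 2 / p) * (X * h \<rho>) + T * (p * g \<rho>)"
        by (simp add: X_def h_def g_def K_def w_def v_def)
      finally show ?thesis by (simp add: K_def w_def)
    qed
    have Ih: "(h has_integral integral {0..r} h) {0..r}" and Ig: "(g has_integral integral {0..r} g) {0..r}"
      by (intro integrable_integral integrable_continuous_interval h g)+
    have "T - \<bar>f (origin n)\<bar> powr p \<le> T powr (1 - 2 / p) * (X * integral {0..r} h) + T * (p * integral {0..r} g)"
      using has_integral_le[OF pow_mean_green(1)[OF r] has_integral_add[OF
          has_integral_mult_right[OF has_integral_mult_right[OF Ih]] has_integral_mult_right[OF has_integral_mult_right[OF Ig]]]
          bound] by (simp add: T_def)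
    moreover have "integral {0..r} g = real n * green_int n l2 r"
      unfolding g_def using n by (simp add: green_int_eq)
    \<comment> \<open>The value at the origin must also carry the common factor: split off its
      square and compare the remaining power with \<open>T\<close>, which is at least
      \<open>|f(0)|^p\<close>.\<close>
    moreover have "\<bar>f (origin n)\<bar> powr p \<le> T powr (1 - 2 / p) * \<bar>f (origin n)\<bar>\<^sup>2"
    proof (cases "f (origin n) = 0")
      case False
      let ?a = "\<bar>f (origin n)\<bar>"
      have "p * (1 - 2 / p) = p - 2" using p by (simp add: field_simps)
      then have "(?a powr p) powr (1 - 2 / p) = ?a powr (p - 2)" by (simp add: powr_powr)
      moreover have "?a powr p = ?a powr (p - 2) * ?a\<^sup>2"
        using False powr_add[of ?a "p - 2" 2] by simp
      ultimately have "?a powr p = (?a powr p) powr (1 - 2 / p) * ?a\<^sup>2" by (simp only:)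
      also have "\<dots> \<le> T powr (1 - 2 / p) * ?a\<^sup>2"
        using pow_mean_ge_origin[OF r] p by (intro mult_right_mono powr_mono2) (auto simp: T_def)
      finally show ?thesis .
    qed simp
    \<comment> \<open>The term linear in \<open>T\<close> has moved to the left, where its
      coefficient completes \<open>C_fun\<close>.\<close>
    ultimately have "T * C_fun n p l2 r \<le> T powr (1 - 2 / p) * R"
      by (simp add: C_fun_def R_def algebra_simps)
    moreover have "T = T powr (1 - 2 / p) * (T powr (1 / p))\<^sup>2"
    proof -
      have "(T powr (1 / p))\<^sup>2 = T powr (2 / p)" using T0 by (simp add: power2_eq_square flip: powr_add)
      then show ?thesis using T0 by (simp flip: powr_add)
    qed
    ultimately have "T powr (1 - 2 / p) * ((T powr (1 / p))\<^sup>2 * C_fun n p l2 r) \<le> T powr (1 - 2 / p) * R"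
      by (metis mult.assoc)
    then have "(T powr (1 / p))\<^sup>2 * C_fun n p l2 r \<le> R" using T0 by simp
    then have "(T powr (1 / p))\<^sup>2 \<le> R / C_fun n p l2 r" using Cf by (simp add: pos_le_divide_eq)
    then have "T powr (1 / p) \<le> sqrt (R / C_fun n p l2 r)" by (rule real_le_rsqrt)
    then show ?thesis unfolding Mp R_def X_def h_def by (simp add: real_sqrt_divide)
  qed
qed

end

theorem theorem1p4:
  fixes C :: real
  assumes "C > 0"
  shows "\<exists>C'>0. \<forall>(n::nat) (p::real) (\<omega> :: real \<Rightarrow> real) (l1 :: real \<Rightarrow> real) (l2 :: real \<Rightarrow> real)
            (f :: (nat \<Rightarrow> real) \<Rightarrow> real).
           n \<ge> 2 \<longrightarrow> p \<ge> 2 \<longrightarrow> majorant \<omega> \<longrightarrow>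
           continuous_on {0..<1} l1 \<longrightarrow> (\<forall>\<rho>\<in>{0..<1}. l1 \<rho> \<ge> 0) \<longrightarrow>
           continuous_on {0..<1} l2 \<longrightarrow> (\<forall>\<rho>\<in>{0..<1}. l2 \<rho> \<ge> 0) \<longrightarrow>
           (\<forall>r\<in>{0..<1}. green_int n l2 r < 1 / (real n * p)) \<longrightarrow>
           f \<in> H_class n l1 l2 \<longrightarrow>
           (\<forall>r\<in>{0..<1}. Mp n p r (\<lambda>x. norm_n n (grad n f x)) \<le> C * \<omega> (1 / (1 - r))) \<longrightarrow>
           (\<forall>r\<in>{0..<1}.
              Mp n p r f \<le>
                1 / sqrt (C_fun n p l2 r) *
                sqrt (\<bar>f (origin n)\<bar>\<^sup>2
                      + 2 ^ (n - 2) * p * C' * \<omega> 1 / (real n - 1)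
                        * integral {0..r} (\<lambda>\<rho>. (p - 1 + l1 \<rho>) * \<omega> (1 / (1 - \<rho>)))))"
\<comment> \<open>The hypothesis on the gradient enters only through the square of its mean, so the
  constant appears squared and no dimension or exponent is mixed into it.\<close>
proof (intro exI[of _ "C\<^sup>2"] conjI allI impI ballI)
  show "C\<^sup>2 > 0" using assms by simp
qed (rule Mp_le; use assms in auto)

end
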